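(* Let $2\le p<\infty$, $a>0$, $b\in\mathbb R$, $\beta\in(0,1]$, $d\in\mathbb N$, and $0<R_1\le R_2<\infty$. There exist constants $c=c(a,b,\beta,p,R_1,R_2,d)$ and $C=C(a,b,\beta,p,d)$ such that the following holds. Let $\Omega\subset\mathbb R^d$ be compact with a probability measure $\mu$, and let $\Psi=\{\psi_{\mathbf k}\}_{\mathbf k\in\mathbb Z^d}\subset\mathcal C(\Omega)$ be a uniformly bounded Riesz system in $L_2(\Omega,\mu)$: $\sup_{\mathbf x\in\Omega}|\psi_{\mathbf k}(\mathbf x)|\le1$ for all $\mathbf k\in\mathbb Z^d$, and for every finite set $\Lambda\subset\mathbb Z^d$ and all complex numbers $(a_{\mathbf k})_{\mathbf k\in\Lambda}$ $$R_1\Big(\sum_{\mathbf k\in\Lambda}|a_{\mathbf k}|^2\Big)^{1/2}\le\Big\|\sum_{\mathbf k\in\Lambda}a_{\mathbf k}\psi_{\mathbf k}\Big\|_{L_2(\Omega,\mu)}\le R_2\Big(\sum_{\mathbf k\in\Lambda}|a_{\mathbf k}|^2\Big)^{1/2}.$$ Then for every $v\in\mathbb N$ and every $m\in\mathbb N$ satisfying $m\ge c\,v(\log(2v))^4$, $$\varrho_m^o(\mathbf W^{a,b}_{A_\beta}(\Psi),L_p(\Omega,\mu))\le C\,v^{1-1/p-1/\beta-a}(\log(2v))^{(d-1)(a+b)}.$$ Moreover, this bound is provided by the Weak Orthogonal Matching Pursuit (WOMP) with a fixed weakness parameter $t\in(0,1]$ (in the sense described in the context).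
   Context: Class $\mathbf W^{a,b}_{A_\beta}(\Psi)$. For $\mathbf s=(s_1,\dots,s_d)$ with nonnegative integer coordinates let $\rho(\mathbf s):=\{\mathbf k\in\mathbb Z^d:[2^{s_j-1}]\le|k_j|<2^{s_j},\ j=1,\dots,d\}$, where $[x]$ is the integer part of $x$, and $\|\mathbf s\|_1=s_1+\dots+s_d$. For $f=\sum_{\mathbf k}a_{\mathbf k}(f)\psi_{\mathbf k}$ with $\sum_{\mathbf k}|a_{\mathbf k}(f)|<\infty$ put $\delta_{\mathbf s}(f,\Psi):=\sum_{\mathbf k\in\rho(\mathbf s)}a_{\mathbf k}(f)\psi_{\mathbf k}$, $f_j:=\sum_{\|\mathbf s\|_1=j}\delta_{\mathbf s}(f,\Psi)$ for $j=0,1,2,\dots$, and $$|f_j|_{A_\beta(\Psi)}:=\Big(\sum_{\mathbf k\in\bigcup_{\|\mathbf s\|_1=j}\rho(\mathbf s)}|a_{\mathbf k}(f)|^\beta\Big)^{1/\beta}.$$ $\mathbf W^{a,b}_{A_\beta}(\Psi)$ is the set of functions $f$ having such a representation with $|f_j|_{A_\beta(\Psi)}\le2^{-aj}(\max(j,1))^{(d-1)b}$ for all $j=0,1,2,\dots$. Optimal recovery. For $\mathbf F\subset\mathcal C(\Omega)$, $$\varrho_m^o(\mathbf F,L_p(\Omega,\mu)):=\inf_{\xi}\inf_{\mathcal M}\sup_{f\in\mathbf F}\|f-\mathcal M(f(\xi^1),\dots,f(\xi^m))\|_{L_p(\Omega,\mu)},$$ where $\xi=\{\xi^1,\dots,\xi^m\}$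 ranges over all sets of $m$ points of $\Omega$ and $\mathcal M$ over all mappings (not necessarily linear) $\mathbb C^m\to L_p(\Omega,\mu)$. WOMP. Let $\mathcal D$ be a system of nonzero elements of norm at most $1$ in a Hilbert space $H$ and $t\in(0,1]$. Given $f_0\in H$, for $k=1,2,\dots$: choose any $g_k\in\mathcal D$ with $|\langle f_{k-1},g_k\rangle|\ge t\sup_{g\in\mathcal D}|\langle f_{k-1},g\rangle|$; let $G_k(f_0,\mathcal D)$ be the orthogonal projection of $f_0$ onto $\operatorname{span}\{g_1,\dots,g_k\}$; put $f_k:=f_0-G_k(f_0,\mathcal D)$. "Provided by the WOMP" means: for a fixed $t\in(0,1]$ (the constant $c$ being allowed to depend also on $t$) and for $v,m$ as in the claim, there exist points $\xi^1,\dots,\xi^m\in\Omega$, a finite set $Q\subset\mathbb Z^d$ and a number $s$ of iterations (none depending on $f$) such that for every $f_0\in\mathbf W^{a,b}_{A_\beta}(\Psi)$, running the WOMP on $f_0$ in the Hilbert space $L_2(\Omega_m,\mu_m)$, where $\Omega_m=\{\xi^1,\dots,\xi^m\}$ and $\mu_m=\frac1m\sum_{j=1}^m\delta_{\xi^j}$, with respect to the restrictions to $\Omega_m$ of the functions $\psi_{\mathbf k}$, $\mathbf k\in Q$ (with any admissible choices of the $g_k$), the residual $f_s$ satisfies $\|f_s\|_{L_p(\Omega,\mu)}\le C v^{1-1/p-1/\beta-a}(\log(2v))^{(d-1)(a+b)}$. Here $f_s$ is viewed as a function on $\Omega$ by using, on all of $\Omega$, the linear combination of the selected $\psi_{\mathbf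 k}$ with the coefficients found by the algorithm. *)

theory Defs
  imports "HOL-Probability.Probability"
begin

section \<open>Lebesgue spaces of complex-valued functions\<close>

definition Lp_space :: "real \<Rightarrow> 'x measure \<Rightarrow> ('x \<Rightarrow> complex) set" where
  "Lp_space p M = {f. f \<in> borel_measurable M \<and> integrable M (\<lambda>x. cmod (f x) powr p)}"

text \<open>The Bochner integral of a non-integrable function is \<open>0\<close>, so \<open>Lp_norm\<close> is the usual norm
  only on \<open>Lp_space p M\<close>; below it is only applied to members of that space.\<close>

definition Lp_norm :: "real \<Rightarrow> 'x measure \<Rightarrow> ('x \<Rightarrow> complex) \<Rightarrow> real" where
  "Lp_norm p M f = (LINT x|M. cmod (f x) powr p) powr (1 / p)"

definition L2_inner :: "'x measure \<Rightarrow> ('x \<Rightarrow> complex) \<Rightarrow> ('x \<Rightarrow> complex) \<Rightarrow> complex" where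
  "L2_inner M f g = (LINT x|M. f x * cnj (g x))"

definition lin_comb :: "('k \<Rightarrow> 'x \<Rightarrow> complex) \<Rightarrow> 'k set \<Rightarrow> ('k \<Rightarrow> complex) \<Rightarrow> 'x \<Rightarrow> complex" where
  "lin_comb \<psi> K c = (\<lambda>x. \<Sum>k\<in>K. c k * \<psi> k x)"


section \<open>Uniformly bounded Riesz systems\<close>

definition borel_prob_on :: "'x::topological_space set \<Rightarrow> 'x measure \<Rightarrow> bool" where
  "borel_prob_on \<Omega> \<mu> \<longleftrightarrow> sets \<mu> = sets (restrict_space borel \<Omega>) \<and> prob_space \<mu>"

definition bounded_riesz_system ::
  "real \<Rightarrow> real \<Rightarrow> 'x::topological_space set \<Rightarrow> 'x measure \<Rightarrow> ('k \<Rightarrow> 'x \<Rightarrow> complex) \<Rightarrow> bool" where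
  "bounded_riesz_system R1 R2 \<Omega> \<mu> \<psi> \<longleftrightarrow>
     (\<forall>k. continuous_on \<Omega> (\<psi> k)) \<and>
     (\<forall>k. \<forall>x\<in>\<Omega>. cmod (\<psi> k x) \<le> 1) \<and>
     (\<forall>\<Lambda> c. finite \<Lambda> \<longrightarrow>
        R1 * sqrt (\<Sum>k\<in>\<Lambda>. (cmod (c k))\<^sup>2) \<le> Lp_norm 2 \<mu> (lin_comb \<psi> \<Lambda> c) \<and>
        Lp_norm 2 \<mu> (lin_comb \<psi> \<Lambda> c) \<le> R2 * sqrt (\<Sum>k\<in>\<Lambda>. (cmod (c k))\<^sup>2))"


section \<open>The classes $W^{a,b}_{A_\beta}(\Psi)$\<close>

text \<open>The dimension \<open>d\<close> is \<open>CARD('d)\<close>.\<close>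

definition dyadic_block :: "nat ^ 'd \<Rightarrow> (int ^ 'd) set" where
  "dyadic_block s =
     {k. \<forall>j. \<lfloor>2 powr (real (s $ j) - 1)\<rfloor> \<le> \<bar>k $ j\<bar> \<and> \<bar>k $ j\<bar> < 2 ^ (s $ j)}"

definition hyperbolic_layer :: "nat \<Rightarrow> (int ^ 'd::finite) set" where
  "hyperbolic_layer j = (\<Union>s\<in>{s. (\<Sum>i\<in>UNIV. s $ i) = j}. dyadic_block s)"

text \<open>The frequency set of each \<open>f\<^sub>j\<close> is finite, so the sum defining its
  $A_\beta$-quasinorm below is a genuine finite sum.\<close>

lemma finite_hyperbolic_layer: "finite (hyperbolic_layer j :: (int ^ 'd::finite) set)"
proof -
  have "(hyperbolic_layer j :: (int ^ 'd) set) \<subseteq> {k. \<forall>i. k $ i \<in> {- (2 ^ j)..2 ^ j}}"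
  proof
    fix k :: "int ^ 'd"
    assume "k \<in> hyperbolic_layer j"
    then obtain s :: "nat ^ 'd" where s: "(\<Sum>i\<in>UNIV. s $ i) = j" and k: "k \<in> dyadic_block s"
      by (auto simp: hyperbolic_layer_def)
    have "k $ i \<in> {- (2 ^ j)..2 ^ j}" for i
    proof -
      have "s $ i \<le> j"
        using s member_le_sum[of i UNIV "\<lambda>i. s $ i"] by simp
      hence "(2::int) ^ (s $ i) \<le> 2 ^ j"
        by (simp add: power_increasing)
      moreover have "\<bar>k $ i\<bar> < 2 ^ (s $ i)"
        using k by (simp add: dyadic_block_def)
      ultimately have "\<bar>k $ i\<bar> \<le> 2 ^ j"
        by linarith
      thus ?thesis
        by (simp add: abs_le_iff)
    qed
    thus "k \<in> {k. \<forall>i. k $ i \<in> {- (2 ^ j)..2 ^ j}}"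
      by simp
  qed
  moreover have "finite {k :: int ^ 'd. \<forall>i. k $ i \<in> {- (2 ^ j)..2 ^ j}}"
  proof (rule finite_subset)
    show "{k :: int ^ 'd. \<forall>i. k $ i \<in> {- (2 ^ j)..2 ^ j}}
            \<subseteq> vec_lambda ` (UNIV \<rightarrow>\<^sub>E {- (2 ^ j)..2 ^ j})"
    proof
      fix k :: "int ^ 'd"
      assume "k \<in> {k. \<forall>i. k $ i \<in> {- (2 ^ j)..2 ^ j}}"
      hence "vec_nth k \<in> UNIV \<rightarrow>\<^sub>E {- (2 ^ j)..2 ^ j}"
        by auto
      thus "k \<in> vec_lambda ` (UNIV \<rightarrow>\<^sub>E {- (2 ^ j)..2 ^ j})"
        by (intro image_eqI[where x = "vec_nth k"]) (auto simp: vec_nth_inverse)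
    qed
  qed (intro finite_imageI finite_PiE; simp)
  ultimately show ?thesis
    by (rule finite_subset)
qed

definition A_quasinorm :: "real \<Rightarrow> nat \<Rightarrow> (int ^ 'd::finite \<Rightarrow> complex) \<Rightarrow> real" where
  "A_quasinorm \<beta> j c = (\<Sum>k\<in>hyperbolic_layer j. cmod (c k) powr \<beta>) powr (1 / \<beta>)"

text \<open>Only the values of \<open>f\<close> on \<open>\<Omega>\<close> are constrained: functions on \<open>\<Omega>\<close> are represented
  by arbitrary extensions.\<close>

definition W_class ::
  "real \<Rightarrow> real \<Rightarrow> real \<Rightarrow> 'x set \<Rightarrow> (int ^ 'd::finite \<Rightarrow> 'x \<Rightarrow> complex) \<Rightarrow> ('x \<Rightarrow> complex) set" where
  "W_class a b \<beta> \<Omega> \<psi> =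
     {f. \<exists>c. (\<lambda>k. cmod (c k)) summable_on UNIV \<and>
             (\<forall>x\<in>\<Omega>. ((\<lambda>k. c k * \<psi> k x) has_sum f x) UNIV) \<and>
             (\<forall>j. A_quasinorm \<beta> j c
                  \<le> 2 powr (- a * real j) * real (max j 1) powr (real (CARD('d) - 1) * b))}"


section \<open>Optimal recovery\<close>

text \<open>Sets of \<open>m\<close> points are enumerated by distinct lists, and \<open>\<complex>\<^sup>m\<close> by complex lists of
  length \<open>m\<close>. The infima and the supremum are taken in \<open>[0,\<infinity>]\<close>.\<close>

definition optimal_recovery ::
  "nat \<Rightarrow> ('x \<Rightarrow> complex) set \<Rightarrow> real \<Rightarrow> 'x set \<Rightarrow> 'x measure \<Rightarrow> ennreal" where
  "optimal_recovery m F p \<Omega> \<mu> =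
     (INF \<xi>\<in>{\<xi>. length \<xi> = m \<and> distinct \<xi> \<and> set \<xi> \<subseteq> \<Omega>}.
        INF A\<in>{A. \<forall>y. length y = m \<longrightarrow> A y \<in> Lp_space p \<mu>}.
          SUP f\<in>F. ennreal (Lp_norm p \<mu> (\<lambda>x. f x - A (map f \<xi>) x)))"


section \<open>Weak Orthogonal Matching Pursuit\<close>

text \<open>The Hilbert space $L_2(M)$ is represented by functions with the (semi-)inner product
  \<open>L2_inner M\<close>. The dictionary is an indexed family \<open>\<psi> k\<close>, \<open>k \<in> Q\<close>.\<close>

definition is_dictionary :: "'x measure \<Rightarrow> ('k \<Rightarrow> 'x \<Rightarrow> complex) \<Rightarrow> 'k set \<Rightarrow> bool" where
  "is_dictionary M \<psi> Q \<longleftrightarrow> Q \<noteq> {} \<and>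
     (\<forall>k\<in>Q. \<psi> k \<in> Lp_space 2 M \<and> 0 < Lp_norm 2 M (\<psi> k) \<and> Lp_norm 2 M (\<psi> k) \<le> 1)"

definition is_orth_proj ::
  "'x measure \<Rightarrow> ('x \<Rightarrow> complex) set \<Rightarrow> ('x \<Rightarrow> complex) \<Rightarrow> ('x \<Rightarrow> complex) \<Rightarrow> bool" where
  "is_orth_proj M V f G \<longleftrightarrow> G \<in> V \<and> (\<forall>g\<in>V. L2_inner M (\<lambda>x. f x - G x) g = 0)"

text \<open>\<open>womp_run M \<psi> Q t f0 s \<kappa> f\<close>: the elements \<open>\<psi> (\<kappa> 1), \<dots>, \<psi> (\<kappa> s)\<close> and the residuals
  \<open>f 0, \<dots>, f s\<close> are an admissible outcome of \<open>s\<close> iterations started at \<open>f0\<close>. The projections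
  are genuine linear combinations of the selected \<open>\<psi> k\<close>, hence the residuals are functions on
  the whole domain of the \<open>\<psi> k\<close>, even if \<open>M\<close> is concentrated on a few points. If the
  selected elements are linearly dependent in $L_2(M)$, every choice of coefficients representing
  the projection is admissible.\<close>

definition womp_run ::
  "'x measure \<Rightarrow> ('k \<Rightarrow> 'x \<Rightarrow> complex) \<Rightarrow> 'k set \<Rightarrow> real \<Rightarrow> ('x \<Rightarrow> complex) \<Rightarrow> nat
     \<Rightarrow> (nat \<Rightarrow> 'k) \<Rightarrow> (nat \<Rightarrow> 'x \<Rightarrow> complex) \<Rightarrow> bool" where
  "womp_run M \<psi> Q t f0 s \<kappa> f \<longleftrightarrow>
     f 0 = f0 \<and>
     (\<forall>n\<in>{1..s}.
        \<kappa> n \<in> Q \<and>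
        cmod (L2_inner M (f (n - 1)) (\<psi> (\<kappa> n)))
          \<ge> t * (SUP k\<in>Q. cmod (L2_inner M (f (n - 1)) (\<psi> k))) \<and>
        (\<exists>G. is_orth_proj M (range (lin_comb \<psi> (\<kappa> ` {1..n}))) f0 G \<and>
             f n = (\<lambda>x. f0 x - G x)))"

text \<open>The measure $\frac1m\sum_{j=1}^m \delta_{\xi^j}$, with points counted according to
  multiplicity.\<close>

definition empirical_measure :: "'x list \<Rightarrow> 'x measure" where
  "empirical_measure \<xi> = measure_pmf (pmf_of_multiset (mset \<xi>))"

text \<open>The points, the finite set of frequencies and the number of iterations do not depend on
  the function that is recovered.\<close>

definition womp_provides ::
  "nat \<Rightarrow> ('x \<Rightarrow> complex) set \<Rightarrow> real \<Rightarrow> 'x set \<Rightarrow> 'x measure \<Rightarrow> ('k \<Rightarrow> 'x \<Rightarrow> complex)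
     \<Rightarrow> real \<Rightarrow> real \<Rightarrow> bool" where
  "womp_provides m F p \<Omega> \<mu> \<psi> t B \<longleftrightarrow>
     (\<exists>\<xi> Q s. length \<xi> = m \<and> set \<xi> \<subseteq> \<Omega> \<and> finite Q \<and>
        is_dictionary (empirical_measure \<xi>) \<psi> Q \<and>
        (\<forall>f0\<in>F. \<forall>\<kappa> f. womp_run (empirical_measure \<xi>) \<psi> Q t f0 s \<kappa> f \<longrightarrow>
           Lp_norm p \<mu> (f s) \<le> B))"

end

theory Submission
  imports Defs "HOL-Real_Asymp.Real_Asymp"
begin

text \<open>Sample points are chosen so that the empirical second moment of every function
  $f = \sum_{k \in Q} c_k \psi_k$ is comparable to its second moment under \<open>\<mu>\<close>, up to
  an additive error \<open>\<epsilon>\<close> times the squared $\ell_1$ norm of \<open>c\<close>. Such points are found from dyadic superlevel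
  sets: at level \<open>2\<^sup>-\<^sup>i\<close> Maurey's argument replaces \<open>f\<close> by one of finitely many averages of about
  $4^i \log(1/\varepsilon)$ signed basis functions, and a Chernoff bound controls the frequencies of their
  superlevel sets. Taking \<open>\<epsilon>\<close> of the order of the reciprocal of the sparsity turns this into a two-sided
  comparison of norms for sparse coefficient vectors, while the tails of functions from
  the class, which are small in $\ell_1$, remain small at the samples.

  For the greedy algorithm let $h$ be a $2^i$-sparse approximant of $f$ in the empirical norm. A
  step of the algorithm contracts the excess of the squared residual over $\|f - h\|^2$ by a factor
  \<open>1 - const * 2^(-i)\<close>, so a fixed multiple of $2^i$ steps suffices to reach the error of
  $h$. Letting $i$ run from $0$ to \<open>log v\<close> yields the optimal error after a number of
  steps proportional to $v$, because the approximation errors at consecutive $i$ have bounded ratio.\<close>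

section \<open>Points with prescribed frequencies\<close>

text \<open>A restricted isometry for sparse vectors alone would not suffice: what a class function
  leaves after its sparse part is not sparse, only small in l1, and its empirical norm must be
  controlled too. The additive error \<epsilon> times the squared l1 norm serves both purposes. With
  \<epsilon> of order 1/V, Cauchy-Schwarz absorbs it for V-sparse vectors, while for a remainder of
  l1 norm w r(w), w \<le> V, it costs a multiple of w r(w)^2, the order of the bound for the squared
  l2 norm.

  The number of samples stays near V because frequencies are compared only up to a factor 2 and an
  additive error growing like 4^i with the level i. This growth matches the 4^i in the exponent of
  the number of Maurey averages, and it is harmless because level i enters the second moment with
  weight 4^-i.

  For p > 2 the L_p error is interpolated between L_2 and the supremum, and the supremum is bounded
  by an l1 norm of coefficients; this produces V^(1 - 1/p) r(V).\<close>

lemma (in prob_space) exists_le_expectation: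
  fixes F :: "'a \<Rightarrow> real"
  assumes "integrable M F" "expectation F \<le> B"
  shows "\<exists>x\<in>space M. F x \<le> B"
proof (rule ccontr)
  assume "\<not> ?thesis"
  hence less: "\<And>x. x \<in> space M \<Longrightarrow> B < F x" by force
  have "expectation (\<lambda>x. B) < expectation F"
    using assms(1) less by (intro integral_less_AE_space) (auto simp: emeasure_space_1)
  thus False using assms(2) by (simp add: prob_space)
qed

text \<open>Method of conditional expectations: under a random new point the weighted sum of
  products does not grow on average, so some point keeps it from growing. One deterministic list,
  which may repeat points, controls all functionals.\<close>

lemma (in prob_space) exists_list_potential_le:
  fixes F :: "'i \<Rightarrow> 'a \<Rightarrow> real" and w :: "'i \<Rightarrow> real"
  assumes "finite I" "\<And>i. i \<in> I \<Longrightarrow> integrable M (F i)"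
    "\<And>i. i \<in> I \<Longrightarrow> expectation (F i) \<le> 1"
    "\<And>i x. i \<in> I \<Longrightarrow> x \<in> space M \<Longrightarrow> 0 \<le> F i x" "\<And>i. i \<in> I \<Longrightarrow> 0 \<le> w i"
  shows "\<exists>\<xi>. length \<xi> = m \<and> set \<xi> \<subseteq> space M \<and>
           (\<Sum>i\<in>I. w i * (\<Prod>x\<leftarrow>\<xi>. F i x)) \<le> (\<Sum>i\<in>I. w i)"
proof (induction m)
  case 0
  show ?case by (intro exI[of _ "[]"]) simp
next
  case (Suc m)
  then obtain \<xi> where \<xi>: "length \<xi> = m" "set \<xi> \<subseteq> space M"
    "(\<Sum>i\<in>I. w i * (\<Prod>x\<leftarrow>\<xi>. F i x)) \<le> (\<Sum>i\<in>I. w i)" by blast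
  let ?P = "\<lambda>i. w i * (\<Prod>x\<leftarrow>\<xi>. F i x)"
  have P0: "0 \<le> ?P i" if "i \<in> I" for i
    using assms(4,5) that \<xi>(2) by (intro mult_nonneg_nonneg prod_list_nonneg) auto
  have "expectation (\<lambda>x. \<Sum>i\<in>I. ?P i * F i x) = (\<Sum>i\<in>I. ?P i * expectation (F i))"
    using assms(2) by simp
  also have "\<dots> \<le> (\<Sum>i\<in>I. ?P i * 1)"
    by (intro sum_mono mult_left_mono P0 assms(3))
  also have "\<dots> \<le> (\<Sum>i\<in>I. w i)" using \<xi>(3) by simp
  finally obtain x where "x \<in> space M" "(\<Sum>i\<in>I. ?P i * F i x) \<le> (\<Sum>i\<in>I. w i)"
    using exists_le_expectation[of "\<lambda>x. \<Sum>i\<in>I. ?P i * F i x"] assms(2) by auto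
  thus ?case using \<xi> by (intro exI[of _ "x # \<xi>"]) (simp add: mult_ac)
qed

lemma prod_list_powr_indicator:
  "(\<Prod>x\<leftarrow>\<xi>. a powr (s * indicat_real D x) * e) = a powr (s * (\<Sum>x\<leftarrow>\<xi>. indicat_real D x)) * e ^ length \<xi>"
  if "0 < (a::real)"
  using that by (induction \<xi>) (simp_all add: algebra_simps powr_add)

text \<open>A derandomised multiplicative Chernoff bound: the moment generating functions at
  \<open>\<plusminus>ln 2\<close> serve as pessimistic estimators.\<close>

lemma (in prob_space) exists_list_frequencies:
  fixes D :: "'i \<Rightarrow> 'a set" and \<eta> :: "'i \<Rightarrow> real"
  assumes "finite I" "\<And>i. i \<in> I \<Longrightarrow> D i \<in> events"
    and small: "(\<Sum>i\<in>I. 2 * 2 powr (- real m * \<eta> i / 2)) < 1" and \<eta>0: "\<And>i. i \<in> I \<Longrightarrow> 0 \<le> \<eta> i"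
  shows "\<exists>\<xi>. length \<xi> = m \<and> set \<xi> \<subseteq> space M \<and>
     (\<forall>i\<in>I. (\<Sum>x\<leftarrow>\<xi>. indicat_real (D i) x) \<le> real m * (2 * prob (D i) + \<eta> i) \<and>
             real m * prob (D i) \<le> 2 * (\<Sum>x\<leftarrow>\<xi>. indicat_real (D i) x) + real m * \<eta> i)"
proof -
  \<comment> \<open>Each factor is an exponential of the indicator normalised to mean at most 1.
    With q the probability of \<open>D i\<close>, the upper tail rests on 1 + q \<le> exp q and the
    lower one on 1 - q/2 \<le> exp (- q/2).\<close>
  define F :: "'i \<times> bool \<Rightarrow> 'a \<Rightarrow> real" where
    "F = (\<lambda>(i, b) x. if b then 2 powr (1 * indicat_real (D i) x) * exp (- prob (D i))
                     else 2 powr (-1 * indicat_real (D i) x) * exp (prob (D i) / 2))"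
  define w :: "'i \<times> bool \<Rightarrow> real" where "w = (\<lambda>(i, b). 2 powr (- real m * \<eta> i / 2))"
  have F_eq: "F (i, b) x = (if b then (1 + indicat_real (D i) x) * exp (- prob (D i))
       else (1 - indicat_real (D i) x / 2) * exp (prob (D i) / 2))" for i b x
    by (auto simp: F_def indicator_def powr_minus_divide)
  have int: "integrable M (F ib)" and le1: "expectation (F ib) \<le> 1" if "ib \<in> I \<times> UNIV" for ib
  proof -
    obtain i b where ib: "ib = (i, b)" by (cases ib)
    have D: "D i \<in> events" using that assms(2) ib by auto
    have "integrable M (indicat_real (D i))" using D by (simp add: emeasure_eq_measure)
    thus "integrable M (F ib)" unfolding ib F_eq[abs_def] by (cases b) auto
    have E: "expectation (\<lambda>x. 1 + indicat_real (D i) x) = 1 + prob (D i)"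
      "expectation (\<lambda>x. 1 - indicat_real (D i) x / 2) = 1 - prob (D i) / 2"
      using D by (simp_all add: prob_space emeasure_eq_measure)
    have *: "1 + prob (D i) \<le> exp (prob (D i))" "1 - prob (D i) / 2 \<le> exp (- prob (D i) / 2)"
      using exp_ge_add_one_self[of "prob (D i)"] exp_ge_add_one_self[of "- prob (D i) / 2"] by simp_all
    have "(1 + prob (D i)) * exp (- prob (D i)) \<le> exp (prob (D i)) * exp (- prob (D i))"
      "(1 - prob (D i) / 2) * exp (prob (D i) / 2) \<le> exp (- prob (D i) / 2) * exp (prob (D i) / 2)"
      using * by (auto intro!: mult_right_mono)
    thus "expectation (F ib) \<le> 1" unfolding ib F_eq[abs_def] 
      by (cases b) (simp_all add: E exp_add[symmetric])
  qed
  have "\<exists>\<xi>. length \<xi> = m \<and> set \<xi> \<subseteq> space M \<and>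
           (\<Sum>i\<in>I \<times> UNIV. w i * (\<Prod>x\<leftarrow>\<xi>. F i x)) \<le> (\<Sum>i\<in>I \<times> UNIV. w i)"
    using assms(1) int le1 by (intro exists_list_potential_le) (auto simp: w_def F_def)
  then obtain \<xi> where \<xi>: "length \<xi> = m" "set \<xi> \<subseteq> space M"
    "(\<Sum>i\<in>I \<times> UNIV. w i * (\<Prod>x\<leftarrow>\<xi>. F i x)) \<le> (\<Sum>i\<in>I \<times> UNIV. w i)" by blast
  have "(\<Sum>i\<in>I \<times> UNIV. w i) = (\<Sum>i\<in>I. 2 * 2 powr (- real m * \<eta> i / 2))"
    by (simp add: sum.cartesian_product[symmetric] w_def UNIV_bool)
  \<comment> \<open>The total stays below 1 and all terms are nonnegative, so each term is below 1:
    this is the union bound over the sets and over both tails.\<close>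
  hence lt1: "(\<Sum>i\<in>I \<times> UNIV. w i * (\<Prod>x\<leftarrow>\<xi>. F i x)) < 1" using \<xi>(3) small by simp
  have each: "w (i, b) * (\<Prod>x\<leftarrow>\<xi>. F (i, b) x) < 1" if "i \<in> I" for i b
  proof -
    have "w (i, b) * (\<Prod>x\<leftarrow>\<xi>. F (i, b) x) \<le> (\<Sum>i\<in>I \<times> UNIV. w i * (\<Prod>x\<leftarrow>\<xi>. F i x))"
      using that assms(1)
      by (intro member_le_sum) (auto simp: w_def F_def intro!: mult_nonneg_nonneg prod_list_nonneg)
    with lt1 show ?thesis by simp
  qed
  let ?S = "\<lambda>i. \<Sum>x\<leftarrow>\<xi>. indicat_real (D i) x"
  have ln2: "ln 2 > (1/2::real)" using ln2_ge_two_thirds by linarith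
  have "?S i \<le> real m * (2 * prob (D i) + \<eta> i) \<and>
        real m * prob (D i) \<le> 2 * ?S i + real m * \<eta> i" if "i \<in> I" for i
  proof
    have S0: "0 \<le> ?S i" by (intro sum_list_nonneg) auto
    have e: "exp x ^ m = exp (real m * x)" for x by (simp add: exp_of_nat_mult)
    have "2 powr (- real m * \<eta> i / 2) * (2 powr ?S i * exp (real m * - prob (D i))) < 1"
      using each[OF that, of True] \<xi>(1)
      by (simp add: w_def F_def prod_list_powr_indicator[where s = 1, simplified] e)
    hence "exp (- real m * \<eta> i / 2 * ln 2 + ?S i * ln 2 - real m * prob (D i)) < exp 0"
      by (simp add: powr_def exp_add[symmetric] exp_diff[symmetric] algebra_simps)
    hence *: "?S i * ln 2 < real m * \<eta> i / 2 * ln 2 + real m * prob (D i)"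
      unfolding exp_less_cancel_iff by (simp add: algebra_simps)
    \<comment> \<open>Since 2 ln 2 > 1, dividing by ln 2 costs at most the factor 2 in front of the
      probability.\<close>
    have "real m * prob (D i) * 1 \<le> real m * prob (D i) * (2 * ln 2)"
      using ln2 by (intro mult_left_mono) auto
    with * have "?S i * ln 2 \<le> (real m * \<eta> i / 2 + 2 * real m * prob (D i)) * ln 2"
      by (simp add: algebra_simps)
    hence "?S i \<le> real m * \<eta> i / 2 + 2 * real m * prob (D i)"
      using ln2 by (subst (asm) mult_le_cancel_right_pos) auto
    moreover have "0 \<le> real m * \<eta> i" using \<eta>0[OF that] by simp
    ultimately show "?S i \<le> real m * (2 * prob (D i) + \<eta> i)"
      unfolding distrib_left by linarith
    have "2 powr (- real m * \<eta> i / 2) * (2 powr (- ?S i) * exp (real m * (prob (D i) / 2))) < 1"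
      using each[OF that, of False] \<xi>(1)
      by (simp add: w_def F_def prod_list_powr_indicator[where s = "-1", simplified] e)
    hence "exp (- real m * \<eta> i / 2 * ln 2 - ?S i * ln 2 + real m * (prob (D i) / 2)) < exp 0"
      by (simp add: powr_def exp_add[symmetric] exp_diff[symmetric] algebra_simps)
    hence *: "real m * prob (D i) < (2 * ?S i + real m * \<eta> i) * ln 2"
      unfolding exp_less_cancel_iff by (simp add: algebra_simps)
    have "(2 * ?S i + real m * \<eta> i) * ln 2 \<le> (2 * ?S i + real m * \<eta> i) * 1"
      using ln_2_less_1 S0 \<eta>0[OF that] by (intro mult_left_mono) auto
    with * show "real m * prob (D i) \<le> 2 * ?S i + real m * \<eta> i" by simp
  qed
  with \<xi> show ?thesis by blast
qed

section \<open>Discretization on the $\ell_1$ ball\<close>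

definition avg :: "'x list \<Rightarrow> ('x \<Rightarrow> real) \<Rightarrow> real" where
  "avg \<xi> F = (\<Sum>x\<leftarrow>\<xi>. F x) / real (length \<xi>)"

lemma avg_mono: "(\<And>x. x \<in> set \<xi> \<Longrightarrow> F x \<le> G x) \<Longrightarrow> avg \<xi> F \<le> avg \<xi> G"
  unfolding avg_def by (intro divide_right_mono sum_list_mono) auto

lemma avg_nonneg: "(\<And>x. x \<in> set \<xi> \<Longrightarrow> 0 \<le> F x) \<Longrightarrow> 0 \<le> avg \<xi> F"
  unfolding avg_def by (intro divide_nonneg_nonneg sum_list_nonneg) auto

lemma avg_cmult: "avg \<xi> (\<lambda>x. a * F x) = a * avg \<xi> F"
  by (simp add: avg_def sum_list_const_mult)

lemma avg_add: "avg \<xi> (\<lambda>x. F x + G x) = avg \<xi> F + avg \<xi> G"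
  by (simp add: avg_def sum_list_addf add_divide_distrib)

lemma avg_sum: "avg \<xi> (\<lambda>x. \<Sum>i\<in>I. F i x) = (\<Sum>i\<in>I. avg \<xi> (F i))"
proof -
  have "(\<Sum>x\<leftarrow>\<xi>. \<Sum>i\<in>I. F i x) = (\<Sum>i\<in>I. \<Sum>x\<leftarrow>\<xi>. F i x)"
    by (induction \<xi>) (simp_all add: sum.distrib)
  thus ?thesis by (simp add: avg_def sum_divide_distrib)
qed

lemma avg_const: "\<xi> \<noteq> [] \<Longrightarrow> avg \<xi> (\<lambda>x. a) = a"
  by (simp add: avg_def sum_list_triv)

section \<open>Exponential moments and Maurey's approximation in two measures\<close>

lemma exp_le_quadratic:
  fixes y :: real
  assumes "\<bar>y\<bar> \<le> 1"
  shows "exp y \<le> 1 + y + y\<^sup>2"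
proof (cases "0 \<le> y")
  case True
  thus ?thesis using exp_bound[of y] assms by simp
next
  case False
  define z where "z = - y"
  have z: "0 < z" "z \<le> 1" using False assms by (auto simp: z_def)
  have "exp y = 1 / exp z" by (simp add: z_def exp_minus inverse_eq_divide)
  also have "\<dots> \<le> 1 / (1 + z)"
    using z exp_ge_add_one_self[of z] by (intro divide_left_mono) auto
  also have "\<dots> \<le> 1 - z + z\<^sup>2"
  proof -
    have "1 \<le> (1 - z + z\<^sup>2) * (1 + z)" using z by (simp add: algebra_simps power2_eq_square power3_eq_cube)
    thus ?thesis using z by (simp add: divide_le_eq)
  qed
  finally show ?thesis by (simp add: z_def)
qed

text \<open>Hoeffding's lemma with a cruder constant: the linear term averages to zero and only the
  quadratic one is left.\<close>

lemma convex_exp_le: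
  fixes p :: "'i \<Rightarrow> real" and y :: "'i \<Rightarrow> real"
  assumes "finite P" "\<And>i. i \<in> P \<Longrightarrow> 0 \<le> p i" "(\<Sum>i\<in>P. p i) = 1" "(\<Sum>i\<in>P. p i * y i) = 0"
    "\<And>i. i \<in> P \<Longrightarrow> \<bar>y i\<bar> \<le> \<epsilon>" "\<epsilon> \<le> 1"
  shows "(\<Sum>i\<in>P. p i * exp (y i)) \<le> exp (\<epsilon>\<^sup>2)"
proof -
  have "(\<Sum>i\<in>P. p i * exp (y i)) \<le> (\<Sum>i\<in>P. p i * (1 + y i + \<epsilon>\<^sup>2))"
  proof (intro sum_mono mult_left_mono)
    fix i assume i: "i \<in> P"
    have "(y i)\<^sup>2 \<le> \<epsilon>\<^sup>2" using assms(5)[OF i] by (metis abs_ge_zero power2_abs power_mono)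
    thus "exp (y i) \<le> 1 + y i + \<epsilon>\<^sup>2" using exp_le_quadratic[of "y i"] assms(5)[OF i] assms(6) by linarith
  qed (use assms in auto)
  also have "\<dots> = 1 + \<epsilon>\<^sup>2"
    using assms(3,4) by (simp add: distrib_left sum.distrib sum_distrib_right[symmetric])
  also have "\<dots> \<le> exp (\<epsilon>\<^sup>2)" using exp_ge_add_one_self by blast
  finally show ?thesis .
qed

lemma card_four_units: "card {1, -1, \<i>, -\<i> :: complex} = 4"
  by (simp add: card_insert_if complex_eq_iff)

text \<open>Some product of z with a fourth root of unity has real part at least |z| / sqrt 2, and
  7/10 is a rational just below 1 / sqrt 2. Exponential moments of a complex deviation thus reduce
  to those of four real ones.\<close>

lemma cmod_le_of_four_directions:
  fixes z :: complex
  assumes "0 \<le> \<theta>"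
  shows "exp (\<theta> * (7/10 * cmod z)) \<le> (\<Sum>\<sigma>\<in>{1, -1, \<i>, -\<i>}. exp (\<theta> * Re (\<sigma> * z)))"
proof -
  have "\<exists>\<sigma>\<in>{1, -1, \<i>, -\<i>}. 7/10 * cmod z \<le> Re (\<sigma> * z)"
  proof (rule ccontr)
    assume "\<not> ?thesis"
    hence *: "\<bar>Re z\<bar> < 7/10 * cmod z" "\<bar>Im z\<bar> < 7/10 * cmod z" by auto
    have "\<bar>Re z\<bar>\<^sup>2 < (7/10 * cmod z)\<^sup>2" "\<bar>Im z\<bar>\<^sup>2 < (7/10 * cmod z)\<^sup>2"
      using * by (intro power_strict_mono; simp)+
    hence "(Re z)\<^sup>2 + (Im z)\<^sup>2 < 98/100 * (cmod z)\<^sup>2" by (simp add: power_mult_distrib power2_eq_square)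
    thus False unfolding cmod_power2[symmetric] using zero_le_power2[of "cmod z"] by linarith
  qed
  then obtain \<sigma> where \<sigma>: "\<sigma> \<in> {1, -1, \<i>, -\<i>}" "7/10 * cmod z \<le> Re (\<sigma> * z)" by blast
  have "exp (\<theta> * (7/10 * cmod z)) \<le> exp (\<theta> * Re (\<sigma> * z))"
    using mult_left_mono[OF \<sigma>(2) assms] by (simp only: exp_le_cancel_iff)
  also have "\<dots> \<le> (\<Sum>\<sigma>\<in>{1, -1, \<i>, -\<i>}. exp (\<theta> * Re (\<sigma> * z)))"
    using \<sigma>(1) by (intro member_le_sum) auto
  finally show ?thesis .
qed

text \<open>Maurey's empirical method, with the averaging over random samples replaced by a greedy
  choice that controls exponential moments with respect to both measures simultaneously.\<close>

lemma (in prob_space) maurey_approximation: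
  fixes \<phi> :: "'i \<Rightarrow> 'a \<Rightarrow> complex" and p :: "'i \<Rightarrow> real" and P :: "'i set"
  defines "f \<equiv> (\<lambda>x. \<Sum>i\<in>P. of_real (p i) * \<phi> i x)"
  assumes P: "finite P" "\<And>i. i \<in> P \<Longrightarrow> 0 \<le> p i" "(\<Sum>i\<in>P. p i) = 1"
    and \<phi>: "\<And>i. i \<in> P \<Longrightarrow> \<phi> i \<in> borel_measurable M"
      "\<And>i x. i \<in> P \<Longrightarrow> x \<in> space M \<Longrightarrow> cmod (\<phi> i x) \<le> 1"
    and \<xi>: "\<xi> \<noteq> []" "set \<xi> \<subseteq> space M" and r: "0 < r" "r \<le> 1" and n: "0 < n"
  shows "\<exists>is. length is = n \<and> set is \<subseteq> P \<and>
     prob {x\<in>space M. r < cmod (f x - (\<Sum>i\<leftarrow>is. \<phi> i x) / of_nat n)} \<le> 8 * exp (- real n * r\<^sup>2 / 33) \<and>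
     avg \<xi> (indicat_real {x\<in>space M. r < cmod (f x - (\<Sum>i\<leftarrow>is. \<phi> i x) / of_nat n)})
       \<le> 8 * exp (- real n * r\<^sup>2 / 33)"
proof -
  \<comment> \<open>Close to the minimiser of 4 \<theta>^2 - 7 \<theta> r / 10, and the value there
    is below - r^2 / 33. The bound \<open>r \<le> 1\<close> gives
    \<open>2 * \<theta> \<le> 1\<close>, the range of the quadratic bound for the
    exponential.\<close>
  define \<theta> where "\<theta> = r / 12"
  have \<theta>: "0 < \<theta>" "2 * \<theta> \<le> 1" using r by (auto simp: \<theta>_def)
  define Z where "Z = (\<lambda>is x. (\<Sum>i\<leftarrow>is. \<phi> i x - f x))"
  define W where "W = (\<lambda>is x. \<Sum>\<sigma>\<in>{1, -1, \<i>, -\<i>}. exp (\<theta> * Re (\<sigma> * Z is x)))"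
  \<comment> \<open>Adding the two measures makes one choice of indices good for both. The potential
    starts at 4 + 4, whence the factor 8.\<close>
  define \<Lambda> where "\<Lambda> = (\<lambda>F. expectation F + avg \<xi> F)"
  have fm: "f \<in> borel_measurable M" unfolding f_def using \<phi>(1) by auto
  have fb: "cmod (f x) \<le> 1" if "x \<in> space M" for x
  proof -
    have "cmod (f x) \<le> (\<Sum>i\<in>P. p i * cmod (\<phi> i x))"
      unfolding f_def by (rule order_trans[OF norm_sum]) (auto simp: norm_mult P(2) intro!: sum_mono)
    also have "\<dots> \<le> (\<Sum>i\<in>P. p i * 1)" using that P(2) \<phi>(2) by (intro sum_mono mult_left_mono) auto
    finally show ?thesis using P(3) by simp
  qed
  have Zm: "Z is \<in> borel_measurable M" if "set is \<subseteq> P" for "is"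
    using that
  proof (induction "is")
    case (Cons i "is")
    hence "\<phi> i \<in> borel_measurable M" "Z is \<in> borel_measurable M" using \<phi>(1) by auto
    moreover have "Z (i # is) = (\<lambda>x. \<phi> i x - f x + Z is x)" by (auto simp: Z_def)
    ultimately show ?case using fm by simp
  qed (simp add: Z_def)
  have Zb: "cmod (Z is x) \<le> 2 * real (length is)" if "set is \<subseteq> P" "x \<in> space M" for "is" x
    using that
  proof (induction "is")
    case (Cons i "is")
    have "cmod (\<phi> i x - f x + Z is x) \<le> cmod (\<phi> i x) + cmod (f x) + cmod (Z is x)"
      by (metis norm_triangle_ineq norm_triangle_ineq4 add_right_mono order_trans)
    also have "\<dots> \<le> 1 + 1 + 2 * real (length is)" using Cons \<phi>(2) fb by (intro add_mono) auto
    finally show ?case by (simp add: Z_def)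
  qed (simp add: Z_def)
  have \<sigma>1: "cmod \<sigma> = 1" if "\<sigma> \<in> {1, -1, \<i>, -\<i>}" for \<sigma> using that by auto
  have Wint: "integrable M (W is)" if "set is \<subseteq> P" for "is"
  proof -
    have "integrable M (\<lambda>x. exp (\<theta> * Re (\<sigma> * Z is x)))" if \<sigma>: "\<sigma> \<in> {1, -1, \<i>, -\<i>}" for \<sigma>
    proof (rule integrable_const_bound[of _ "exp (\<theta> * (2 * real (length is)))"])
      have "Re (\<sigma> * Z is x) \<le> 2 * real (length is)" if "x \<in> space M" for x
        using Zb[OF \<open>set is \<subseteq> P\<close> that] complex_Re_le_cmod[of "\<sigma> * Z is x"] \<sigma>1[OF \<sigma>]
        by (simp add: norm_mult)
      thus "AE x in M. norm (exp (\<theta> * Re (\<sigma> * Z is x))) \<le> exp (\<theta> * (2 * real (length is)))"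
        using \<theta> by (intro AE_I2) auto
      show "(\<lambda>x. exp (\<theta> * Re (\<sigma> * Z is x))) \<in> borel_measurable M"
        using Zm[OF \<open>set is \<subseteq> P\<close>] by measurable
    qed
    thus ?thesis unfolding W_def by (intro Bochner_Integration.integrable_sum)
  qed
  have step: "(\<Sum>i\<in>P. p i * W (i # is) x) \<le> exp (4 * \<theta>\<^sup>2) * W is x"
    if "set is \<subseteq> P" "x \<in> space M" for "is" x
  proof -
    have eq: "(\<Sum>i\<in>P. p i * W (i # is) x) =
       (\<Sum>\<sigma>\<in>{1, -1, \<i>, -\<i>}. exp (\<theta> * Re (\<sigma> * Z is x)) * (\<Sum>i\<in>P. p i * exp (\<theta> * Re (\<sigma> * (\<phi> i x - f x)))))"
      unfolding W_def sum_distrib_left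
      by (subst sum.swap) (simp add: Z_def ring_distribs exp_add mult_ac)
    also have "\<dots> \<le> (\<Sum>\<sigma>\<in>{1, -1, \<i>, -\<i>}. exp (\<theta> * Re (\<sigma> * Z is x)) * exp ((2 * \<theta>)\<^sup>2))"
    proof (intro sum_mono mult_left_mono convex_exp_le P \<theta>)
      fix \<sigma> :: complex assume \<sigma>: "\<sigma> \<in> {1, -1, \<i>, -\<i>}"
      have fx: "f x = (\<Sum>i\<in>P. of_real (p i) * \<phi> i x)" by (simp add: f_def)
      have "(\<Sum>i\<in>P. of_real (p i) * (\<sigma> * (\<phi> i x - f x)))
          = (\<Sum>i\<in>P. \<sigma> * (of_real (p i) * \<phi> i x) - of_real (p i) * (\<sigma> * f x))"
        by (simp add: algebra_simps)
      also have "\<dots> = \<sigma> * f x - (\<Sum>i\<in>P. of_real (p i)) * (\<sigma> * f x)"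
        unfolding sum_subtractf sum_distrib_left[symmetric] sum_distrib_right[symmetric] fx[symmetric] ..
      also have "(\<Sum>i\<in>P. complex_of_real (p i)) = 1" using P(3) by (metis of_real_1 of_real_sum)
      finally have "Re (\<Sum>i\<in>P. of_real (p i) * (\<sigma> * (\<phi> i x - f x))) = 0" by simp
      hence "\<theta> * (\<Sum>i\<in>P. p i * Re (\<sigma> * (\<phi> i x - f x))) = 0" by simp
      thus "(\<Sum>i\<in>P. p i * (\<theta> * Re (\<sigma> * (\<phi> i x - f x)))) = 0"
        by (simp add: sum_distrib_left mult_ac)
      fix i assume i: "i \<in> P"
      have "\<bar>Re (\<sigma> * (\<phi> i x - f x))\<bar> \<le> cmod (\<phi> i x - f x)"
        using abs_Re_le_cmod[of "\<sigma> * (\<phi> i x - f x)"] \<sigma>1[OF \<sigma>] by (simp add: norm_mult)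
      also have "\<dots> \<le> 2" using norm_triangle_ineq4[of "\<phi> i x" "f x"] \<phi>(2)[OF i] fb that(2) by force
      finally show "\<bar>\<theta> * Re (\<sigma> * (\<phi> i x - f x))\<bar> \<le> 2 * \<theta>" using \<theta> by (simp add: abs_mult)
    qed auto
    also have "\<dots> = W is x * exp ((2 * \<theta>)\<^sup>2)" unfolding W_def sum_distrib_right ..
    finally show ?thesis by (simp add: mult.commute power_mult_distrib)
  qed
  have "\<exists>is. length is = n \<and> set is \<subseteq> P \<and> \<Lambda> (W is) \<le> 8 * exp (4 * \<theta>\<^sup>2) ^ n" for n
  proof (induction n)
    case 0
    have "W [] = (\<lambda>x. 4)" by (simp add: W_def Z_def card_four_units del: sum.insert sum.insert_if)
    thus ?case using \<xi> by (intro exI[of _ "[]"]) (simp add: \<Lambda>_def avg_const prob_space)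
  next
    case (Suc n)
    then obtain "is" where "is": "length is = n" "set is \<subseteq> P" "\<Lambda> (W is) \<le> 8 * exp (4 * \<theta>\<^sup>2) ^ n" by blast
    have int: "integrable M (W (i # is))" if "i \<in> P" for i using "is" that by (intro Wint) auto
    have "(\<Sum>i\<in>P. p i * \<Lambda> (W (i # is))) = \<Lambda> (\<lambda>x. \<Sum>i\<in>P. p i * W (i # is) x)"
      using int by (simp add: \<Lambda>_def avg_sum avg_cmult distrib_left sum.distrib)
    also have "\<dots> \<le> \<Lambda> (\<lambda>x. exp (4 * \<theta>\<^sup>2) * W is x)"
      unfolding \<Lambda>_def using step[OF "is"(2)] \<xi> Wint[OF "is"(2)] int
      by (intro add_mono avg_mono integral_mono) auto
    also have "\<dots> = exp (4 * \<theta>\<^sup>2) * \<Lambda> (W is)" by (simp add: \<Lambda>_def avg_cmult distrib_left)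
    also have "\<dots> \<le> exp (4 * \<theta>\<^sup>2) * (8 * exp (4 * \<theta>\<^sup>2) ^ n)" using "is"(3) by (intro mult_left_mono) auto
    finally have le: "(\<Sum>i\<in>P. p i * \<Lambda> (W (i # is))) \<le> 8 * exp (4 * \<theta>\<^sup>2) ^ Suc n" by (simp add: mult_ac)
    have "\<exists>i\<in>P. \<Lambda> (W (i # is)) \<le> 8 * exp (4 * \<theta>\<^sup>2) ^ Suc n"
    proof (rule ccontr)
      let ?B = "8 * exp (4 * \<theta>\<^sup>2) ^ Suc n"
      assume "\<not> ?thesis"
      hence gt: "?B < \<Lambda> (W (i # is))" if "i \<in> P" for i using that by force
      have "\<exists>i\<in>P. 0 < p i" 
      proof (rule ccontr)
        assume "\<not> ?thesis"
        hence "(\<Sum>i\<in>P. p i) \<le> 0" by (intro sum_nonpos) force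
        thus False using P(3) by simp
      qed
      hence "(\<Sum>i\<in>P. p i * ?B) < (\<Sum>i\<in>P. p i * \<Lambda> (W (i # is)))"
        using gt P(1,2) by (intro sum_strict_mono_ex1) (force intro!: mult_left_mono)+
      thus False using le P(3) by (simp add: sum_distrib_right[symmetric])
    qed
    then obtain i where "i \<in> P" "\<Lambda> (W (i # is)) \<le> 8 * exp (4 * \<theta>\<^sup>2) ^ Suc n" by blast
    thus ?case using "is" by (intro exI[of _ "i # is"]) auto
  qed
  then obtain "is" where "is": "length is = n" "set is \<subseteq> P" "\<Lambda> (W is) \<le> 8 * exp (4 * \<theta>\<^sup>2) ^ n" by blast
  define D where "D = {x\<in>space M. r < cmod (f x - (\<Sum>i\<leftarrow>is. \<phi> i x) / of_nat n)}"
  have Zeq: "Z is x = (\<Sum>i\<leftarrow>is. \<phi> i x) - of_nat n * f x" for x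
    unfolding Z_def using "is"(1)
    by (simp add: sum_list_subtractf sum_list_triv)
  have Dm: "D \<in> events"
  proof -
    have "D = {x\<in>space M. r < cmod (- Z is x / of_nat n)}"
      unfolding D_def Zeq using n by (simp add: field_simps)
    thus ?thesis using Zm[OF "is"(2)] by simp
  qed
  have ind: "exp (\<theta> * (7/10 * (real n * r))) * indicat_real D x \<le> W is x" for x
  proof (cases "x \<in> D")
    case True
    have "f x - (\<Sum>i\<leftarrow>is. \<phi> i x) / of_nat n = - Z is x / of_nat n"
      unfolding Zeq using n by (simp add: field_simps)
    hence "r < cmod (Z is x) / real n" using True by (simp add: D_def norm_divide)
    hence "real n * r \<le> cmod (Z is x)" using n by (simp add: field_simps)
    hence "exp (\<theta> * (7/10 * (real n * r))) \<le> exp (\<theta> * (7/10 * cmod (Z is x)))"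
      using \<theta> by (simp add: mult.commute[of r])
    also have "\<dots> \<le> W is x" unfolding W_def using \<theta> by (intro cmod_le_of_four_directions) auto
    finally show ?thesis using True by simp
  qed (auto simp: W_def intro!: sum_nonneg)
  \<comment> \<open>Markov's inequality for both measures at once.\<close>
  have "exp (\<theta> * (7/10 * (real n * r))) * \<Lambda> (indicat_real D)
      = \<Lambda> (\<lambda>x. exp (\<theta> * (7/10 * (real n * r))) * indicat_real D x)"
    using Dm by (simp add: \<Lambda>_def avg_cmult distrib_left)
  also have "\<dots> \<le> \<Lambda> (W is)"
    unfolding \<Lambda>_def using ind Wint[OF "is"(2)] Dm
    by (intro add_mono avg_mono integral_mono) (auto simp: emeasure_eq_measure)
  also note "is"(3)
  finally have "\<Lambda> (indicat_real D) \<le> 8 * exp (4 * \<theta>\<^sup>2) ^ n / exp (\<theta> * (7/10 * (real n * r)))"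
    by (simp add: field_simps)
  also have "\<dots> = 8 * exp (real n * (4 * \<theta>\<^sup>2) - \<theta> * (7/10 * (real n * r)))"
    by (simp add: exp_of_nat_mult exp_diff)
  also have "\<dots> \<le> 8 * exp (- real n * r\<^sup>2 / 33)"
    using mult_nonneg_nonneg[of "real n" "r\<^sup>2"] by (simp add: \<theta>_def power2_eq_square field_simps)
  finally have fin: "prob D + avg \<xi> (indicat_real D) \<le> 8 * exp (- real n * r\<^sup>2 / 33)"
    using Dm by (simp add: \<Lambda>_def)
  have "0 \<le> avg \<xi> (indicat_real D)" by (intro avg_nonneg) auto
  with fin have "prob D \<le> 8 * exp (- real n * r\<^sup>2 / 33)" "avg \<xi> (indicat_real D) \<le> 8 * exp (- real n * r\<^sup>2 / 33)"
    using measure_nonneg[of M D] by linarith+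
  thus ?thesis using "is" unfolding D_def by blast
qed

section \<open>The empirical measure as a normalised sum over the sample list\<close>

lemma integral_empirical_measure:
  fixes F :: "'x \<Rightarrow> 'b::{banach, second_countable_topology}"
  assumes "\<xi> \<noteq> []"
  shows "(LINT x|empirical_measure \<xi>. F x) = (\<Sum>x\<leftarrow>\<xi>. F x) /\<^sub>R real (length \<xi>)"
proof -
  have "(LINT x|empirical_measure \<xi>. F x)
      = (\<Sum>x\<in>set \<xi>. (count (mset \<xi>) x / real (length \<xi>)) *\<^sub>R F x)"
    unfolding empirical_measure_def using assms
    by (subst integral_measure_pmf[where A = "set \<xi>"]) auto
  also have "\<dots> = (\<Sum>x\<in>set \<xi>. real (count (mset \<xi>) x) *\<^sub>R F x) /\<^sub>R real (length \<xi>)"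
    by (simp add: scaleR_sum_right field_simps)
  also have "(\<Sum>x\<in>set \<xi>. real (count (mset \<xi>) x) *\<^sub>R F x) = (\<Sum>x\<leftarrow>\<xi>. F x)"
  proof (induction \<xi>)
    case (Cons y \<xi>)
    have *: "(\<Sum>x\<in>set (y # \<xi>). real (count (mset \<xi>) x) *\<^sub>R F x) = (\<Sum>x\<in>set \<xi>. real (count (mset \<xi>) x) *\<^sub>R F x)"
      by (intro sum.mono_neutral_right) (auto simp: count_eq_zero_iff)
    have "(\<Sum>x\<in>set (y # \<xi>). real (count (mset (y # \<xi>)) x) *\<^sub>R F x)
        = (\<Sum>x\<in>set (y # \<xi>). real (count (mset \<xi>) x) *\<^sub>R F x + (if x = y then F x else 0))"
      by (intro sum.cong) (auto simp: algebra_simps)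
    also have "\<dots> = (\<Sum>x\<leftarrow>\<xi>. F x) + F y"
      unfolding sum.distrib * Cons by simp
    finally show ?case by simp
  qed simp
  finally show ?thesis .
qed

lemma integral_empirical_measure_avg:
  "\<xi> \<noteq> [] \<Longrightarrow> (LINT x|empirical_measure \<xi>. F x) = avg \<xi> F" for F :: "'x \<Rightarrow> real"
  by (simp add: integral_empirical_measure avg_def field_simps)

lemma measure_empirical_measure:
  "\<xi> \<noteq> [] \<Longrightarrow> measure (empirical_measure \<xi>) D = avg \<xi> (indicat_real D)"
  by (subst integral_empirical_measure_avg[symmetric]) (simp_all add: empirical_measure_def)

lemma prob_space_empirical_measure: "prob_space (empirical_measure \<xi>)"
  unfolding empirical_measure_def by (rule prob_space_measure_pmf)

lemma AE_empirical_measure: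
  "\<xi> \<noteq> [] \<Longrightarrow> (AE x in empirical_measure \<xi>. P x) \<longleftrightarrow> (\<forall>x\<in>set \<xi>. P x)"
  unfolding empirical_measure_def AE_measure_pmf_iff by simp

lemma sets_empirical_measure [simp]: "sets (empirical_measure \<xi>) = UNIV"
  and space_empirical_measure [simp]: "space (empirical_measure \<xi>) = UNIV"
  by (simp_all add: empirical_measure_def)

section \<open>Second moments through dyadic superlevel sets\<close>

lemma four_power_eq: "(4::real) ^ n = (2 ^ n)\<^sup>2"
  by (simp add: power2_eq_square flip: power_mult_distrib)

text \<open>If i is the first level with 2^-i < u, then u \<le> 2 * 2^-i and this level alone pays
  for u^2; if no level up to L is reached, then u^2 \<le> 4^-L.\<close>

lemma square_le_dyadic_levels:
  fixes u :: real
  assumes "0 \<le> u" "u \<le> 1"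
  shows "u\<^sup>2 \<le> (\<Sum>i=1..L. 4 / 4 ^ i * (if 1 / 2 ^ i < u then 1 else 0)) + 1 / 4 ^ L"
proof (induction L)
  case 0
  show ?case using assms by (simp add: power_le_one)
next
  case (Suc L)
  show ?case
  proof (cases "1 / 2 ^ Suc L < u")
    case True
    moreover have "1 / 4 ^ L \<le> (5::real) / (4 * 4 ^ L)" by (simp add: field_simps)
    ultimately show ?thesis using Suc by simp
  next
    case False
    hence "u\<^sup>2 \<le> (1 / 2 ^ Suc L)\<^sup>2" using assms by (intro power_mono) auto
    also have "\<dots> = 1 / 4 ^ Suc L" by (simp add: power_divide four_power_eq power_mult_distrib)
    finally show ?thesis by (intro add_increasing sum_nonneg) auto
  qed
qed

text \<open>The active levels form a final segment starting at some i0 with 4^-(i0 + 1) < u^2, and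
  their geometric sum is at most 4/3 of 4^-i0; hence 16/3. Level i is tested at half the threshold
  used in \<open>square_le_dyadic_levels\<close>: this gap is the room for replacing a function by
  an approximant.\<close>

lemma dyadic_levels_le_square:
  fixes u :: real
  shows "(\<Sum>i=1..L. 1 / 4 ^ i * (if 1 / 2 ^ Suc i < u then 1 else 0)) \<le> 16 / 3 * u\<^sup>2"
proof -
  have sq: "1 / 4 ^ n < u\<^sup>2" if "1 / 2 ^ n < u" for n
  proof -
    have "(1 / 2 ^ n)\<^sup>2 < u\<^sup>2" using that by (intro power_strict_mono) auto
    moreover have "(1 / 2 ^ n)\<^sup>2 = 1 / (4::real) ^ n"
      by (simp add: power_divide four_power_eq)
    ultimately show ?thesis by simp
  qed
  let ?S = "\<lambda>L. \<Sum>i=1..L. 1 / 4 ^ i * (if 1 / 2 ^ Suc i < u then 1 else 0 :: real)"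
  \<comment> \<open>Strengthened for the induction: the unspent geometric tail is kept in reserve,
    and as long as the last level is not reached the sum is empty.\<close>
  have "if 1 / 2 ^ Suc L < u then ?S L \<le> 16 / 3 * u\<^sup>2 - 1 / 3 / 4 ^ L else ?S L = 0"
  proof (induction L)
    case 0
    show ?case using sq[of 1] by (cases "1 / 2 < u") simp_all
  next
    case (Suc L)
    have half: "1 / 2 ^ Suc (Suc L) < u" if "1 / 2 ^ Suc L < u"
      by (rule le_less_trans[OF _ that]) (simp add: field_simps)
    show ?case
    proof (cases "1 / 2 ^ Suc L < u")
      case True
      have "(1::real) / 3 / 4 ^ L = 4 / 3 / 4 ^ Suc L" by simp
      moreover have "?S (Suc L) = ?S L + 1 / 4 ^ Suc L" using True half by simp
      ultimately show ?thesis using Suc True half by simp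
    next
      case False
      thus ?thesis using Suc sq[of "Suc (Suc L)"]
        by (cases "1 / 2 ^ Suc (Suc L) < u") (simp_all add: field_simps)
    qed
  qed
  hence main: "if 1 / 2 ^ Suc L < u then ?S L \<le> 16 / 3 * u\<^sup>2 - 1 / 3 / 4 ^ L else ?S L = 0" .
  have nonneg: "0 \<le> 16 / 3 * u\<^sup>2" "0 \<le> 1 / 3 / (4::real) ^ L" by simp_all
  show ?thesis
  proof (cases "1 / 2 ^ Suc L < u")
    case True
    from main[unfolded if_P[OF True]] nonneg show ?thesis by linarith
  next
    case False
    from main[unfolded if_not_P[OF False]] nonneg show ?thesis by linarith
  qed
qed

text \<open>Layer-cake argument: both second moments are comparable to weighted sums of measures of
  superlevel sets, so it suffices to compare these level by level. The factors 4, 2 and 16/3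
  multiply to 128/3, rounded up to 50.\<close>

lemma second_moment_comparison:
  fixes u :: "'a \<Rightarrow> real"
  assumes "prob_space M" "prob_space N" "u \<in> borel_measurable M" "u \<in> borel_measurable N"
    and bM: "AE x in M. 0 \<le> u x \<and> u x \<le> 1" and bN: "AE x in N. 0 \<le> u x \<and> u x \<le> 1"
    and le: "\<And>i. i \<in> {1..L} \<Longrightarrow> measure M {x\<in>space M. 1 / 2 ^ i < u x}
               \<le> 2 * measure N {x\<in>space N. 1 / 2 ^ Suc i < u x} + \<eta> i"
  shows "(LINT x|M. (u x)\<^sup>2) \<le> (50::real) * (LINT x|N. (u x)\<^sup>2) + (\<Sum>i=1..L. 4 / 4 ^ i * \<eta> i) + 1 / 4 ^ L"
proof -
  interpret M: prob_space M by fact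
  interpret N: prob_space N by fact
  note [measurable] = assms(3,4)
  let ?EM = "\<lambda>i. {x\<in>space M. 1 / 2 ^ i < u x}"
  let ?EN = "\<lambda>i. {x\<in>space N. 1 / 2 ^ Suc i < u x}"
  have intM: "integrable M (\<lambda>x. (u x)\<^sup>2)"
  proof (rule M.integrable_const_bound[of _ 1])
    show "AE x in M. norm ((u x)\<^sup>2) \<le> 1" using bM by eventually_elim (simp add: power_le_one)
  qed simp
  have intN: "integrable N (\<lambda>x. (u x)\<^sup>2)"
  proof (rule N.integrable_const_bound[of _ 1])
    show "AE x in N. norm ((u x)\<^sup>2) \<le> 1" using bN by eventually_elim (simp add: power_le_one)
  qed simp
  have iM: "integrable M (indicat_real (?EM i))" for i by (simp add: M.emeasure_eq_measure)
  have iN: "integrable N (indicat_real (?EN i))" for i by (simp add: N.emeasure_eq_measure)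
  have "(LINT x|M. (u x)\<^sup>2) \<le> (LINT x|M. (\<Sum>i=1..L. 4 / 4 ^ i * indicat_real (?EM i) x) + 1 / 4 ^ L)"
  proof (rule integral_mono_AE[OF intM])
    show "AE x in M. (u x)\<^sup>2 \<le> (\<Sum>i=1..L. 4 / 4 ^ i * indicat_real (?EM i) x) + 1 / 4 ^ L"
      using bM AE_space
    proof eventually_elim
      case (elim x)
      have "(\<Sum>i=1..L. 4 / 4 ^ i * (if 1 / 2 ^ i < u x then 1 else 0)) = (\<Sum>i=1..L. 4 / 4 ^ i * indicat_real (?EM i) x)"
        using elim by (intro sum.cong) (auto simp: indicator_def)
      with square_le_dyadic_levels[of "u x" L] elim show ?case by metis
    qed
  qed (use iM in auto)
  also have "\<dots> = (\<Sum>i=1..L. 4 / 4 ^ i * measure M (?EM i)) + 1 / 4 ^ L"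
    using iM by (simp add: M.prob_space)
  also have "\<dots> \<le> (\<Sum>i=1..L. 4 / 4 ^ i * (2 * measure N (?EN i) + \<eta> i)) + 1 / 4 ^ L"
    using le by (intro add_right_mono sum_mono mult_left_mono) auto
  also have "\<dots> = 8 * (\<Sum>i=1..L. 1 / 4 ^ i * measure N (?EN i)) + (\<Sum>i=1..L. 4 / 4 ^ i * \<eta> i) + 1 / 4 ^ L"
    by (simp add: distrib_left sum.distrib sum_distrib_left mult_ac)
  also have "(\<Sum>i=1..L. 1 / 4 ^ i * measure N (?EN i)) = (LINT x|N. (\<Sum>i=1..L. 1 / 4 ^ i * indicat_real (?EN i) x))"
    using iN by simp
  also have "\<dots> \<le> (LINT x|N. 16 / 3 * (u x)\<^sup>2)"
  proof (rule integral_mono)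
    fix x assume x: "x \<in> space N"
    have "(\<Sum>i=1..L. 1 / 4 ^ i * indicat_real (?EN i) x) = (\<Sum>i=1..L. 1 / 4 ^ i * (if 1 / 2 ^ Suc i < u x then 1 else 0))"
      using x by (intro sum.cong) (auto simp: indicator_def)
    thus "(\<Sum>i=1..L. 1 / 4 ^ i * indicat_real (?EN i) x) \<le> 16 / 3 * (u x)\<^sup>2"
      using dyadic_levels_le_square[of "u x" L] by metis
  qed (use iN intN in auto)
  also have "\<dots> = 16 / 3 * (LINT x|N. (u x)\<^sup>2)" by simp
  finally have "(LINT x|M. (u x)\<^sup>2) \<le> 8 * (16 / 3 * (LINT x|N. (u x)\<^sup>2)) + (\<Sum>i=1..L. 4 / 4 ^ i * \<eta> i) + 1 / 4 ^ L"
    by simp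
  moreover have "0 \<le> (LINT x|N. (u x)\<^sup>2)" by simp
  ultimately show ?thesis by linarith
qed

lemma sum_inverse_four_powers: "(\<Sum>i=1..L. 1 / (4::real) ^ i) \<le> 1 / 3"
proof -
  have "(\<Sum>i=1..L. 1 / (4::real) ^ i) = 1 / 3 - 1 / 3 / 4 ^ L"
  proof (induction L)
    case (Suc L)
    have "1 / 3 - 1 / 3 / 4 ^ L + 1 / 4 ^ Suc L = 1 / 3 - 1 / 3 / (4::real) ^ Suc L"
      by (simp add: field_simps)
    thus ?case using Suc by simp
  qed simp
  thus ?thesis by simp
qed

text \<open>Because of the weight 4 / 4^i the sampling error at level i costs \<epsilon> / (4 L)
  whatever i is, a quarter of \<epsilon> in total. The Maurey errors take another quarter and the
  cut-off at level L the remaining half. The factor 3 is explained by the double exchange in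
  \<open>l1_ball_discretization\<close>.\<close>

lemma level_error_budget:
  fixes \<epsilon> :: real
  assumes "128 * exp (- real L) \<le> \<epsilon>" "1 \<le> L"
  shows "(\<Sum>i=1..L. 4 / 4 ^ i * (4 ^ i * (\<epsilon> / (16 * real L)) + 3 * (8 * exp (- real L)))) + 1 / 4 ^ L \<le> \<epsilon>"
proof -
  have "(\<Sum>i=1..L. 4 / 4 ^ i * (4 ^ i * (\<epsilon> / (16 * real L)) + 3 * (8 * exp (- real L))))
      = (\<Sum>i=1..L. \<epsilon> / (4 * real L) + 96 * exp (- real L) * (1 / 4 ^ i))"
    by (intro sum.cong) (simp_all add: field_simps)
  also have "\<dots> = \<epsilon> / 4 + 96 * exp (- real L) * (\<Sum>i=1..L. 1 / 4 ^ i)"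
    using assms(2) by (simp add: sum.distrib sum_distrib_left)
  also have "\<dots> \<le> \<epsilon> / 4 + 96 * exp (- real L) * (1 / 3)"
    by (intro add_left_mono mult_left_mono sum_inverse_four_powers) auto
  also have "96 * exp (- real L) * (1 / 3) \<le> \<epsilon> / 4" using assms(1) by simp
  finally have 1: "(\<Sum>i=1..L. 4 / 4 ^ i * (4 ^ i * (\<epsilon> / (16 * real L)) + 3 * (8 * exp (- real L)))) \<le> \<epsilon> / 2"
    by simp
  have "exp 1 ^ L \<le> (4::real) ^ L" using exp_le by (intro power_mono) auto
  hence "1 / 4 ^ L \<le> 1 / (exp 1 ^ L :: real)" by (intro divide_left_mono) auto
  also have "\<dots> = exp (- real L)" by (simp add: exp_minus exp_of_nat_mult[symmetric] inverse_eq_divide)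
  also have "\<dots> \<le> \<epsilon> / 2" using assms(1) exp_ge_zero[of "- real L"] by linarith
  finally show ?thesis using 1 by linarith
qed

text \<open>The number of candidate averages and the failure weight both have exponents proportional
  to 4^i, so one condition on m serves every level: per unit of 4^i the weight contributes at least
  (1600/3) L ln K, against 528 L ln K from the count.\<close>

lemma union_bound_small:
  fixes \<epsilon> K :: real
  assumes L: "1 \<le> L" and K: "4 \<le> K" and m: "25600 * real L ^ 2 * ln K \<le> real m * \<epsilon>"
  shows "(\<Sum>i=1..L. K ^ (528 * 4 ^ i * L) * (2 * 2 powr (- real m * (4 ^ i * (\<epsilon> / (16 * real L))) / 2))) < 1"
proof -
  have lnK: "1 \<le> ln K" using K exp_le by (subst ln_ge_iff) auto
  have "K ^ (528 * 4 ^ i * L) * (2 * 2 powr (- real m * (4 ^ i * (\<epsilon> / (16 * real L))) / 2)) \<le> 2 * exp (- 4 * real L)"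
    if "i \<in> {1..L}" for i
  proof -
    have "1600 * real L * ln K \<le> real m * (\<epsilon> / (16 * real L))"
      using m L by (simp add: field_simps power2_eq_square)
    moreover have "0 \<le> 1600 * real L * ln K" using lnK by simp
    ultimately have "(1600 * real L * ln K) * (1/3) \<le> real m * (\<epsilon> / (16 * real L)) * (ln 2 / 2)"
      using ln2_ge_two_thirds by (intro mult_mono[of _ _ "1/3"]) auto
    hence "528 * real L * ln K - real m * (\<epsilon> / (16 * real L)) * (ln 2 / 2) \<le> - 4 * (real L * 1)"
      using mult_left_mono[OF lnK, of "real L"] by simp
    hence "4 ^ i * (528 * real L * ln K - real m * (\<epsilon> / (16 * real L)) * (ln 2 / 2)) \<le> 4 ^ i * (- 4 * real L)"
      by (intro mult_left_mono) auto
    also have "\<dots> \<le> 1 * (- 4 * real L)" by (intro mult_right_mono_neg) auto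
    finally have *: "4 ^ i * (528 * real L * ln K - real m * (\<epsilon> / (16 * real L)) * (ln 2 / 2)) \<le> - 4 * real L" by simp
    have "K ^ (528 * 4 ^ i * L) = exp (real (528 * 4 ^ i * L) * ln K)"
      using K by (simp only: exp_of_nat_mult) simp
    hence "K ^ (528 * 4 ^ i * L) * (2 * 2 powr (- real m * (4 ^ i * (\<epsilon> / (16 * real L))) / 2))
      = 2 * exp (4 ^ i * (528 * real L * ln K - real m * (\<epsilon> / (16 * real L)) * (ln 2 / 2)))"
      by (simp add: powr_def exp_add[symmetric] exp_diff[symmetric] algebra_simps)
    thus ?thesis using * by simp
  qed
  hence "(\<Sum>i=1..L. K ^ (528 * 4 ^ i * L) * (2 * 2 powr (- real m * (4 ^ i * (\<epsilon> / (16 * real L))) / 2)))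
     \<le> (\<Sum>i=1..L. 2 * exp (- 4 * real L))" by (rule sum_mono)
  also have "\<dots> = 2 * real L / exp (4 * real L)" by (simp add: exp_minus field_simps)
  also have "\<dots> < 1"
  proof -
    have "2 * real L < exp (4 * real L)" using exp_ge_add_one_self[of "4 * real L"] by linarith
    thus ?thesis by simp
  qed
  finally show ?thesis .
qed

lemma (in prob_space) prob_level_transfer:
  assumes "random_variable borel h" "random_variable borel g" "0 \<le> \<epsilon>"
    "prob {x\<in>space M. r < cmod (h x - g x)} \<le> \<epsilon>" "a + r = b"
  shows "prob {x\<in>space M. b < cmod (h x)} \<le> prob {x\<in>space M. a < cmod (g x)} + \<epsilon>"
proof -
  note [measurable] = assms(1,2)
  have "{x\<in>space M. b < cmod (h x)} \<subseteq> {x\<in>space M. a < cmod (g x)} \<union> {x\<in>space M. r < cmod (h x - g x)}"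
  proof
    fix x assume "x \<in> {x\<in>space M. b < cmod (h x)}"
    moreover have "cmod (h x) \<le> cmod (g x) + cmod (h x - g x)" by (metis norm_triangle_sub)
    ultimately show "x \<in> {x\<in>space M. a < cmod (g x)} \<union> {x\<in>space M. r < cmod (h x - g x)}"
      using assms(5) by auto
  qed
  hence "prob {x\<in>space M. b < cmod (h x)}
       \<le> prob ({x\<in>space M. a < cmod (g x)} \<union> {x\<in>space M. r < cmod (h x - g x)})"
    by (intro finite_measure_mono) auto
  also have "\<dots> \<le> prob {x\<in>space M. a < cmod (g x)} + prob {x\<in>space M. r < cmod (h x - g x)}"
    by (intro measure_Un_le) auto
  finally show ?thesis using assms(4) by simp
qed

text \<open>At level \<open>2\<^sup>-\<^sup>i\<close> a function from the ball is
  replaced by an average of \<open>528 4\<^sup>i L\<close> signed basis functions; the superlevel sets of these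
  finitely many averages are the sets whose frequencies the points have to reproduce.\<close>

lemma (in prob_space) l1_ball_discretization:
  fixes \<psi> :: "'k \<Rightarrow> 'a \<Rightarrow> complex" and \<epsilon> :: real
  assumes Q: "finite Q" "Q \<noteq> {}" and \<psi>: "\<And>k. k \<in> Q \<Longrightarrow> \<psi> k \<in> borel_measurable M"
      "\<And>k x. k \<in> Q \<Longrightarrow> x \<in> space M \<Longrightarrow> cmod (\<psi> k x) \<le> 1"
    and L: "1 \<le> L" "128 * exp (- real L) \<le> \<epsilon>"
    and m: "1 \<le> m" "25600 * real L ^ 2 * ln (4 * real (card Q)) \<le> real m * \<epsilon>"
  shows "\<exists>\<xi>. length \<xi> = m \<and> set \<xi> \<subseteq> space M \<and>
    (\<forall>c. (\<Sum>k\<in>Q. \<bar>Re (c k)\<bar> + \<bar>Im (c k)\<bar>) = 1 \<longrightarrow>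
      avg \<xi> (\<lambda>x. (cmod (lin_comb \<psi> Q c x))\<^sup>2) \<le> 50 * (LINT x|M. (cmod (lin_comb \<psi> Q c x))\<^sup>2) + \<epsilon> \<and>
      (LINT x|M. (cmod (lin_comb \<psi> Q c x))\<^sup>2) \<le> 50 * avg \<xi> (\<lambda>x. (cmod (lin_comb \<psi> Q c x))\<^sup>2) + \<epsilon>)"
proof -
  define U where "U = {1, -1, \<i>, -\<i> :: complex}"
  define P where "P = Q \<times> U"
  define \<phi> where "\<phi> = (\<lambda>(k, \<sigma>) x. \<sigma> * \<psi> k x)"
  \<comment> \<open>528 = 33 * 16: with r = 2^-i / 4 the Maurey error exp (- n r^2 / 33) becomes exp
    (- L) at every level.\<close>
  define n where "n = (\<lambda>i. 528 * 4 ^ i * L)"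
  define \<theta> where "\<theta> = \<epsilon> / (16 * real L)"
  define g where "g = (\<lambda>i is x. (\<Sum>j\<leftarrow>is. \<phi> j x) / of_nat (n i))"
  define I where "I = Sigma {1..L} (\<lambda>i. {is. set is \<subseteq> P \<and> length is = n i})"
  \<comment> \<open>The threshold lies midway between 2^-i and 2^-(i+1), at distance r from both, so
    one family of sets serves both directions of the comparison.\<close>
  define D where "D = (\<lambda>(i, is). {x\<in>space M. 3 / 4 / 2 ^ i < cmod (g i is x)})"
  have \<epsilon>: "0 < \<epsilon>" using L(2) exp_gt_zero[of "- real L"] by linarith
  have n0: "0 < n i" for i using L(1) by (simp add: n_def)
  have P: "finite P" "card P = 4 * card Q" using Q by (simp_all add: P_def U_def card_cartesian_product card_four_units del: card.insert card_insert_if)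
  have U1: "cmod \<sigma> = 1" if "\<sigma> \<in> U" for \<sigma> using that by (auto simp: U_def)
  have \<phi>m: "\<phi> j \<in> borel_measurable M" if "j \<in> P" for j using that \<psi>(1) by (auto simp: P_def \<phi>_def)
  have \<phi>b: "cmod (\<phi> j x) \<le> 1" if "j \<in> P" "x \<in> space M" for j x
    using that \<psi>(2) U1 by (auto simp: P_def \<phi>_def norm_mult)
  have gm: "g i is \<in> borel_measurable M" if "set is \<subseteq> P" for i "is"
  proof -
    have "(\<lambda>x. \<Sum>j\<leftarrow>is. \<phi> j x) \<in> borel_measurable M" using that \<phi>m by (induction "is") auto
    thus ?thesis unfolding g_def by auto
  qed
  have finI: "finite I" unfolding I_def using P(1) by (intro finite_SigmaI finite_lists_length_eq) auto
  have "(\<Sum>j\<in>I. 2 * 2 powr (- real m * (4 ^ fst j * \<theta>) / 2))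
     = (\<Sum>i=1..L. \<Sum>is | set is \<subseteq> P \<and> length is = n i. 2 * 2 powr (- real m * (4 ^ i * \<theta>) / 2))"
    unfolding I_def using P(1) by (subst sum.Sigma) (auto simp: finite_lists_length_eq case_prod_beta)
  also have "\<dots> = (\<Sum>i=1..L. (4 * real (card Q)) ^ (528 * 4 ^ i * L) * (2 * 2 powr (- real m * (4 ^ i * \<theta>) / 2)))"
    using P by (simp add: card_lists_length_eq n_def)
  also have "\<dots> < 1" unfolding \<theta>_def using L(1) m(2) Q
    by (intro union_bound_small) (auto simp: Suc_le_eq card_gt_0_iff)
  finally have small: "(\<Sum>j\<in>I. 2 * 2 powr (- real m * (4 ^ fst j * \<theta>) / 2)) < 1" .
  have "\<exists>\<xi>. length \<xi> = m \<and> set \<xi> \<subseteq> space M \<and>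
     (\<forall>j\<in>I. (\<Sum>x\<leftarrow>\<xi>. indicat_real (D j) x) \<le> real m * (2 * prob (D j) + 4 ^ fst j * \<theta>) \<and>
             real m * prob (D j) \<le> 2 * (\<Sum>x\<leftarrow>\<xi>. indicat_real (D j) x) + real m * (4 ^ fst j * \<theta>))"
    using finI small gm \<epsilon> by (intro exists_list_frequencies) (auto simp: I_def D_def \<theta>_def)
  then obtain \<xi> where \<xi>: "length \<xi> = m" "set \<xi> \<subseteq> space M"
    and freq: "\<And>j. j \<in> I \<Longrightarrow> (\<Sum>x\<leftarrow>\<xi>. indicat_real (D j) x) \<le> real m * (2 * prob (D j) + 4 ^ fst j * \<theta>)"
      "\<And>j. j \<in> I \<Longrightarrow> real m * prob (D j) \<le> 2 * (\<Sum>x\<leftarrow>\<xi>. indicat_real (D j) x) + real m * (4 ^ fst j * \<theta>)"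
    by blast
  have \<xi>0: "\<xi> \<noteq> []" using \<xi>(1) m(1) by auto
  interpret N: prob_space "empirical_measure \<xi>" by (rule prob_space_empirical_measure)
  \<comment> \<open>The empirical measure lives on the whole type, whereas the sets are cut to
    \<open>space M\<close>; all sample points lie there, so the frequencies agree.\<close>
  have Nset: "N.prob {x\<in>space M. R x} = N.prob {x\<in>space (empirical_measure \<xi>). R x}" for R
  proof -
    have "avg \<xi> (indicat_real {x\<in>space M. R x}) = avg \<xi> (indicat_real {x. R x})"
      using \<xi>(2) by (intro antisym avg_mono) (auto simp: indicator_def)
    thus ?thesis using \<xi>0 by (simp add: measure_empirical_measure)
  qed
  have freq': "N.prob (D j) \<le> 2 * prob (D j) + 4 ^ fst j * \<theta>"
     "prob (D j) \<le> 2 * N.prob (D j) + 4 ^ fst j * \<theta>" if "j \<in> I" for j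
    using freq[OF that] \<xi>(1) m(1) \<xi>0 by (simp_all add: measure_empirical_measure avg_def field_simps)
  have main: "avg \<xi> (\<lambda>x. (cmod (lin_comb \<psi> Q c x))\<^sup>2) \<le> 50 * (LINT x|M. (cmod (lin_comb \<psi> Q c x))\<^sup>2) + \<epsilon> \<and>
      (LINT x|M. (cmod (lin_comb \<psi> Q c x))\<^sup>2) \<le> 50 * avg \<xi> (\<lambda>x. (cmod (lin_comb \<psi> Q c x))\<^sup>2) + \<epsilon>"
    if c1: "(\<Sum>k\<in>Q. \<bar>Re (c k)\<bar> + \<bar>Im (c k)\<bar>) = 1" for c
  proof -
    define f where "f = lin_comb \<psi> Q c"
    \<comment> \<open>The weights are the positive and negative parts of Re and Im of the
      coefficients. They sum to 1 exactly because the coefficients are normalised in |Re| +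
      |Im|.\<close>
    define p where "p = (\<lambda>(k, \<sigma>). max 0 (Re (cnj \<sigma> * c k)))"
    have sumU: "(\<Sum>j\<in>P. F j) = (\<Sum>k\<in>Q. F (k, 1) + F (k, -1) + F (k, \<i>) + F (k, -\<i>))" for F :: "'k \<times> complex \<Rightarrow> 'z::comm_monoid_add"
      unfolding P_def sum.cartesian_product'
      by (intro sum.cong) (auto simp: U_def complex_eq_iff add.assoc)
    have p1: "(\<Sum>j\<in>P. p j) = 1"
      unfolding sumU c1[symmetric] by (intro sum.cong) (auto simp: p_def)
    have f_eq: "f = (\<lambda>x. \<Sum>j\<in>P. of_real (p j) * \<phi> j x)"
    proof
      fix x
      show "f x = (\<Sum>j\<in>P. of_real (p j) * \<phi> j x)"
        unfolding f_def lin_comb_def sumU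
        by (intro sum.cong) (auto simp: p_def \<phi>_def complex_eq_iff max_def algebra_simps)
    qed
    have p0: "0 \<le> p j" for j by (auto simp: p_def split: prod.splits)
    have fm [measurable]: "f \<in> borel_measurable M" unfolding f_def lin_comb_def using \<psi>(1) by auto
    have fb: "cmod (f x) \<le> 1" if "x \<in> space M" for x
    proof -
      have "cmod (f x) \<le> (\<Sum>j\<in>P. p j * cmod (\<phi> j x))"
        unfolding f_eq by (rule order_trans[OF norm_sum]) (auto simp: norm_mult p0 intro!: sum_mono)
      also have "\<dots> \<le> (\<Sum>j\<in>P. p j * 1)" using that p0 \<phi>b by (intro sum_mono mult_left_mono) auto
      finally show ?thesis using p1 by simp
    qed
    \<comment> \<open>The function is exchanged for its average on either side of the frequency
      comparison. The exchange under the factor 2 counts twice, which makes three Maurey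
      errors.\<close>
    have level: "N.prob {x\<in>space (empirical_measure \<xi>). 1 / 2 ^ i < cmod (f x)}
          \<le> 2 * prob {x\<in>space M. 1 / 2 ^ Suc i < cmod (f x)} + (4 ^ i * \<theta> + 3 * (8 * exp (- real L))) \<and>
        prob {x\<in>space M. 1 / 2 ^ i < cmod (f x)}
          \<le> 2 * N.prob {x\<in>space (empirical_measure \<xi>). 1 / 2 ^ Suc i < cmod (f x)} + (4 ^ i * \<theta> + 3 * (8 * exp (- real L)))"
      if i: "i \<in> {1..L}" for i
    proof -
      define r :: real where "r = 1 / 4 / 2 ^ i"
      have "1 / 4 / 2 ^ i \<le> (1 / 4 / 1 :: real)" by (intro divide_left_mono) auto
      hence "r \<le> 1" unfolding r_def by linarith
      moreover have "0 < r" by (simp add: r_def)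
      ultimately have r: "0 < r" "r \<le> 1" by simp_all
      have e: "exp (- real (n i) * r\<^sup>2 / 33) = exp (- real L)"
        by (simp add: n_def r_def power_divide power_mult_distrib four_power_eq)
      have "\<exists>is. length is = n i \<and> set is \<subseteq> P \<and>
        prob {x\<in>space M. r < cmod (f x - (\<Sum>j\<leftarrow>is. \<phi> j x) / of_nat (n i))} \<le> 8 * exp (- real (n i) * r\<^sup>2 / 33) \<and>
        avg \<xi> (indicat_real {x\<in>space M. r < cmod (f x - (\<Sum>j\<leftarrow>is. \<phi> j x) / of_nat (n i))})
          \<le> 8 * exp (- real (n i) * r\<^sup>2 / 33)"
        unfolding f_eq by (rule maurey_approximation) (use P(1) p0 p1 \<phi>m \<phi>b \<xi>0 \<xi>(2) r n0[of i] in auto)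
      then obtain "is" where "is": "length is = n i" "set is \<subseteq> P"
        "prob {x\<in>space M. r < cmod (f x - g i is x)} \<le> 8 * exp (- real L)"
        "avg \<xi> (indicat_real {x\<in>space M. r < cmod (f x - g i is x)}) \<le> 8 * exp (- real L)"
        unfolding e g_def by blast
      have N_is: "N.prob {x\<in>space (empirical_measure \<xi>). r < cmod (f x - g i is x)} \<le> 8 * exp (- real L)"
        unfolding Nset[symmetric] using "is"(4) \<xi>0 by (simp add: measure_empirical_measure)
      have N_is': "N.prob {x\<in>space (empirical_measure \<xi>). r < cmod (g i is x - f x)} \<le> 8 * exp (- real L)"
        using N_is by (simp add: norm_minus_commute)
      have is3': "prob {x\<in>space M. r < cmod (g i is x - f x)} \<le> 8 * exp (- real L)"
        using "is"(3) by (simp add: norm_minus_commute)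
      have j: "(i, is) \<in> I" using "is" i by (simp add: I_def)
      have gm' [measurable]: "g i is \<in> borel_measurable M" using gm "is" by blast
      have m_emp: "h \<in> borel_measurable (empirical_measure \<xi>)" for h :: "'a \<Rightarrow> complex"
        by (simp add: empirical_measure_def)
      have half: "1 / 2 ^ Suc i + r = 3 / 4 / 2 ^ i" "3 / 4 / 2 ^ i + r = 1 / 2 ^ i"
        by (simp_all add: r_def field_simps)
      have D_eq: "D (i, is) = {x\<in>space M. 3 / 4 / 2 ^ i < cmod (g i is x)}" by (simp add: D_def)
      have ND_eq: "N.prob (D (i, is)) = N.prob {x\<in>space (empirical_measure \<xi>). 3 / 4 / 2 ^ i < cmod (g i is x)}"
        unfolding D_eq by (rule Nset)
      note t1 = N.prob_level_transfer[OF m_emp m_emp _ N_is half(2)] N.prob_level_transfer[OF m_emp m_emp _ N_is' half(1)]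
      note t2 = prob_level_transfer[OF fm gm' _ "is"(3) half(2)] prob_level_transfer[OF gm' fm _ is3' half(1)]
      show ?thesis
        using t1 t2 freq'[OF j] unfolding ND_eq unfolding D_eq by simp
    qed
    have AE: "AE x in M. 0 \<le> cmod (f x) \<and> cmod (f x) \<le> 1"
      "AE x in empirical_measure \<xi>. 0 \<le> cmod (f x) \<and> cmod (f x) \<le> 1"
      using fb \<xi> \<xi>0 by (auto simp: AE_empirical_measure)
    have um: "(\<lambda>x. cmod (f x)) \<in> borel_measurable M" "(\<lambda>x. cmod (f x)) \<in> borel_measurable (empirical_measure \<xi>)"
      by (auto simp: empirical_measure_def)
    note budget = level_error_budget[OF L(2,1), folded \<theta>_def]
    have "(LINT x|M. (cmod (f x))\<^sup>2) \<le> 50 * (LINT x|empirical_measure \<xi>. (cmod (f x))\<^sup>2) +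
        (\<Sum>i=1..L. 4 / 4 ^ i * (4 ^ i * \<theta> + 3 * (8 * exp (- real L)))) + 1 / 4 ^ L"
      using level by (intro second_moment_comparison prob_space_axioms N.prob_space_axioms um AE) blast
    moreover have "(LINT x|empirical_measure \<xi>. (cmod (f x))\<^sup>2) \<le> 50 * (LINT x|M. (cmod (f x))\<^sup>2) +
        (\<Sum>i=1..L. 4 / 4 ^ i * (4 ^ i * \<theta> + 3 * (8 * exp (- real L)))) + 1 / 4 ^ L"
      using level by (intro second_moment_comparison prob_space_axioms N.prob_space_axioms um AE) blast
    ultimately show ?thesis using budget \<xi>0
      unfolding f_def[symmetric] by (simp add: integral_empirical_measure_avg)
  qed
  show ?thesis using \<xi> main by blast
qed

text \<open>Homogeneity extends the estimate from the unit sphere. Passing from |Re| + |Im| to the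
  modulus costs a factor 2 in the norm, hence 4 in front of \<epsilon>.\<close>

lemma (in prob_space) l1_discretization:
  fixes \<psi> :: "'k \<Rightarrow> 'a \<Rightarrow> complex" and \<epsilon> :: real
  assumes Q: "finite Q" "Q \<noteq> {}" and \<psi>: "\<And>k. k \<in> Q \<Longrightarrow> \<psi> k \<in> borel_measurable M"
      "\<And>k x. k \<in> Q \<Longrightarrow> x \<in> space M \<Longrightarrow> cmod (\<psi> k x) \<le> 1"
    and L: "1 \<le> L" "128 * exp (- real L) \<le> \<epsilon>"
    and m: "1 \<le> m" "25600 * real L ^ 2 * ln (4 * real (card Q)) \<le> real m * \<epsilon>"
  shows "\<exists>\<xi>. length \<xi> = m \<and> set \<xi> \<subseteq> space M \<and>
    (\<forall>c. avg \<xi> (\<lambda>x. (cmod (lin_comb \<psi> Q c x))\<^sup>2)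
           \<le> 50 * (LINT x|M. (cmod (lin_comb \<psi> Q c x))\<^sup>2) + 4 * \<epsilon> * (\<Sum>k\<in>Q. cmod (c k))\<^sup>2 \<and>
         (LINT x|M. (cmod (lin_comb \<psi> Q c x))\<^sup>2)
           \<le> 50 * avg \<xi> (\<lambda>x. (cmod (lin_comb \<psi> Q c x))\<^sup>2) + 4 * \<epsilon> * (\<Sum>k\<in>Q. cmod (c k))\<^sup>2)"
proof -
  let ?N = "\<lambda>c x. (cmod (lin_comb \<psi> Q c x))\<^sup>2"
  obtain \<xi> where \<xi>: "length \<xi> = m" "set \<xi> \<subseteq> space M" and
    ball: "\<And>c. (\<Sum>k\<in>Q. \<bar>Re (c k)\<bar> + \<bar>Im (c k)\<bar>) = 1 \<Longrightarrow>
      avg \<xi> (?N c) \<le> 50 * (LINT x|M. ?N c x) + \<epsilon> \<and> (LINT x|M. ?N c x) \<le> 50 * avg \<xi> (?N c) + \<epsilon>"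
    using l1_ball_discretization[where \<psi> = \<psi>, OF Q \<psi> L m] by blast
  have \<epsilon>: "0 < \<epsilon>" using L(2) exp_gt_zero[of "- real L"] by linarith
  have "avg \<xi> (?N c) \<le> 50 * (LINT x|M. ?N c x) + 4 * \<epsilon> * (\<Sum>k\<in>Q. cmod (c k))\<^sup>2 \<and>
     (LINT x|M. ?N c x) \<le> 50 * avg \<xi> (?N c) + 4 * \<epsilon> * (\<Sum>k\<in>Q. cmod (c k))\<^sup>2" for c
  proof -
    define s where "s = (\<Sum>k\<in>Q. \<bar>Re (c k)\<bar> + \<bar>Im (c k)\<bar>)"
    have s0: "0 \<le> s" by (auto simp: s_def intro!: sum_nonneg)
    have "s \<le> (\<Sum>k\<in>Q. 2 * cmod (c k))"
      unfolding s_def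
    proof (intro sum_mono)
      show "\<bar>Re (c k)\<bar> + \<bar>Im (c k)\<bar> \<le> 2 * cmod (c k)" for k
        using abs_Re_le_cmod[of "c k"] abs_Im_le_cmod[of "c k"] by linarith
    qed
    hence "s\<^sup>2 \<le> (2 * (\<Sum>k\<in>Q. cmod (c k)))\<^sup>2" using s0 by (intro power_mono) (auto simp: sum_distrib_left)
    hence s2: "s\<^sup>2 * \<epsilon> \<le> 4 * \<epsilon> * (\<Sum>k\<in>Q. cmod (c k))\<^sup>2"
      using \<epsilon> by (simp add: power_mult_distrib mult_ac mult_left_mono)
    show ?thesis
    proof (cases "s = 0")
      case True
      hence "\<forall>k\<in>Q. c k = 0" unfolding s_def
        using Q(1) by (subst (asm) sum_nonneg_eq_0_iff) (auto simp: complex_eq_iff add_nonneg_eq_0_iff)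
      hence "?N c = (\<lambda>x. 0)" by (auto simp: lin_comb_def)
      thus ?thesis using \<epsilon> by (simp add: avg_def)
    next
      case False
      define c' where "c' = (\<lambda>k. c k / of_real s)"
      have "(\<Sum>k\<in>Q. \<bar>Re (c' k)\<bar> + \<bar>Im (c' k)\<bar>) = (\<Sum>k\<in>Q. \<bar>Re (c k)\<bar> + \<bar>Im (c k)\<bar>) / s"
        unfolding c'_def sum_divide_distrib using s0 by (intro sum.cong) (auto simp: add_divide_distrib)
      hence c'1: "(\<Sum>k\<in>Q. \<bar>Re (c' k)\<bar> + \<bar>Im (c' k)\<bar>) = 1" using False by (simp add: s_def[symmetric])
      have "lin_comb \<psi> Q c x = of_real s * lin_comb \<psi> Q c' x" for x
        using False by (simp add: lin_comb_def c'_def sum_distrib_left)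
      hence N: "?N c = (\<lambda>x. s\<^sup>2 * ?N c' x)" by (auto simp: norm_mult power_mult_distrib)
      have "s\<^sup>2 * avg \<xi> (?N c') \<le> s\<^sup>2 * (50 * (LINT x|M. ?N c' x) + \<epsilon>)"
        "s\<^sup>2 * (LINT x|M. ?N c' x) \<le> s\<^sup>2 * (50 * avg \<xi> (?N c') + \<epsilon>)"
        using ball[OF c'1] by (auto intro!: mult_left_mono)
      thus ?thesis using s2 unfolding N avg_cmult by (simp add: distrib_left mult_ac)
    qed
  qed
  with \<xi> show ?thesis by blast
qed

section \<open>Sparse approximation of the classes\<close>

lemma card_int_vec_box:
  "finite {k :: int ^ 'd::finite. \<forall>i. k $ i \<in> A i}" "card {k :: int ^ 'd::finite. \<forall>i. k $ i \<in> A i} = (\<Prod>i\<in>UNIV. card (A i))"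
  if "\<And>i. finite (A i)"
proof -
  have eq: "{k :: int ^ 'd. \<forall>i. k $ i \<in> A i} = vec_lambda ` (PiE UNIV A)"
  proof (intro equalityI subsetI)
    fix k :: "int ^ 'd" assume "k \<in> {k. \<forall>i. k $ i \<in> A i}"
    thus "k \<in> vec_lambda ` (PiE UNIV A)" by (intro image_eqI[where x = "vec_nth k"]) (auto simp: vec_nth_inverse)
  qed auto
  show "finite {k :: int ^ 'd. \<forall>i. k $ i \<in> A i}" unfolding eq using that by (intro finite_imageI finite_PiE) auto
  have "inj_on vec_lambda (PiE UNIV A :: ('d \<Rightarrow> int) set)" by (auto simp: inj_on_def vec_lambda_inject)
  thus "card {k :: int ^ 'd. \<forall>i. k $ i \<in> A i} = (\<Prod>i\<in>UNIV. card (A i))"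
    unfolding eq by (simp add: card_image card_PiE)
qed

lemma card_dyadic_block:
  "finite (dyadic_block s)" "card (dyadic_block s :: (int ^ 'd::finite) set) \<le> 2 ^ (CARD('d) + (\<Sum>i\<in>UNIV. s $ i))"
proof -
  let ?B = "{k :: int ^ 'd. \<forall>i. k $ i \<in> {- (2 ^ (s $ i))..<2 ^ (s $ i)}}"
  have sub: "dyadic_block s \<subseteq> ?B" 
  proof
    fix k assume k: "k \<in> dyadic_block s"
    have "- (2 ^ (s $ i)) \<le> k $ i \<and> k $ i < 2 ^ (s $ i)" for i
    proof -
      have "\<bar>k $ i\<bar> < 2 ^ (s $ i)" using k by (simp add: dyadic_block_def)
      thus ?thesis by linarith
    qed
    thus "k \<in> ?B" by simp
  qed
  show "finite (dyadic_block s)" by (rule finite_subset[OF sub card_int_vec_box(1)]) simp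
  have "card {- (2 ^ n)..<2 ^ n :: int} = 2 ^ Suc n" for n by (simp add: nat_mult_distrib nat_power_eq)
  hence "card ?B = (\<Prod>i\<in>UNIV. 2 ^ Suc (s $ i))" by (subst card_int_vec_box(2)) auto
  also have "\<dots> = 2 ^ (CARD('d) + (\<Sum>i\<in>UNIV. s $ i))"
    unfolding power_sum[symmetric] by (simp only: sum_Suc add.commute)
  finally show "card (dyadic_block s) \<le> 2 ^ (CARD('d) + (\<Sum>i\<in>UNIV. s $ i))"
    using card_mono[OF card_int_vec_box(1) sub] by simp
qed

text \<open>Once the sum is fixed, one coordinate is determined by the other d - 1; this exponent is
  the source of the logarithmic power in the rate.\<close>

lemma card_compositions_le:
  "finite {s :: nat ^ 'd::finite. (\<Sum>i\<in>UNIV. s $ i) = j}"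
  "card {s :: nat ^ 'd::finite. (\<Sum>i\<in>UNIV. s $ i) = j} \<le> (j + 1) ^ (CARD('d) - 1)"
proof -
  let ?S = "{s :: nat ^ 'd. (\<Sum>i\<in>UNIV. s $ i) = j}"
  obtain i0 :: 'd where True by blast
  define \<Phi> where "\<Phi> = (\<lambda>s :: nat ^ 'd. restrict (vec_nth s) (UNIV - {i0}))"
  have inj: "inj_on \<Phi> ?S"
  proof
    fix s t assume s: "s \<in> ?S" and t: "t \<in> ?S" and eq: "\<Phi> s = \<Phi> t"
    have other: "s $ i = t $ i" if "i \<noteq> i0" for i
      using fun_cong[OF eq, of i] that by (simp add: \<Phi>_def)
    have "s $ i0 + (\<Sum>i\<in>UNIV - {i0}. s $ i) = t $ i0 + (\<Sum>i\<in>UNIV - {i0}. t $ i)"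
      using s t by (simp add: sum.remove[symmetric])
    moreover have "(\<Sum>i\<in>UNIV - {i0}. s $ i) = (\<Sum>i\<in>UNIV - {i0}. t $ i)" using other by (intro sum.cong) auto
    ultimately have "s $ i = t $ i" for i using other by (cases "i = i0") auto
    thus "s = t" by (simp add: vec_eq_iff)
  qed
  have sub: "\<Phi> ` ?S \<subseteq> (UNIV - {i0}) \<rightarrow>\<^sub>E {0..j}"
  proof
    fix h assume "h \<in> \<Phi> ` ?S"
    then obtain s where s: "h = \<Phi> s" "(\<Sum>i\<in>UNIV. s $ i) = j" by blast
    have "s $ i \<le> j" for i using s(2) member_le_sum[of i UNIV "\<lambda>i. s $ i"] by simp
    thus "h \<in> (UNIV - {i0}) \<rightarrow>\<^sub>E {0..j}" by (auto simp: s(1) \<Phi>_def)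
  qed
  have fin: "finite ((UNIV - {i0}) \<rightarrow>\<^sub>E {0..j})" by (intro finite_PiE) auto
  show "finite ?S" using inj_on_finite[OF inj sub fin] .
  have "card ?S \<le> card ((UNIV - {i0}) \<rightarrow>\<^sub>E {0..j})" by (rule card_inj_on_le[OF inj sub fin])
  thus "card ?S \<le> (j + 1) ^ (CARD('d) - 1)" by (simp add: card_PiE card_Diff_singleton)
qed

lemma card_hyperbolic_layer:
  "card (hyperbolic_layer j :: (int ^ 'd::finite) set) \<le> (j + 1) ^ (CARD('d) - 1) * 2 ^ (CARD('d) + j)"
proof -
  let ?S = "{s :: nat ^ 'd. (\<Sum>i\<in>UNIV. s $ i) = j}"
  have "card (hyperbolic_layer j :: (int ^ 'd) set) \<le> (\<Sum>s\<in>?S. card (dyadic_block s))"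
    unfolding hyperbolic_layer_def by (intro card_UN_le card_compositions_le)
  also have "\<dots> \<le> (\<Sum>s\<in>?S. 2 ^ (CARD('d) + j))"
    using card_dyadic_block(2)[where 'd = 'd] by (intro sum_mono) auto
  also have "\<dots> \<le> (j + 1) ^ (CARD('d) - 1) * 2 ^ (CARD('d) + j)"
    using card_compositions_le(2)[where 'd='d] by simp
  finally show ?thesis .
qed

text \<open>The index s consists of the binary lengths of the coordinates. A zero coordinate has
  length 0, which fits the block because the integer part of 1/2 is 0.\<close>

lemma hyperbolic_layers_cover: "\<exists>j. k \<in> hyperbolic_layer j"
proof -
  define s where "s = (\<chi> i. LEAST n. \<bar>k $ i\<bar> < 2 ^ n)"
  have "\<lfloor>2 powr (real (s $ i) - 1)\<rfloor> \<le> \<bar>k $ i\<bar> \<and> \<bar>k $ i\<bar> < 2 ^ (s $ i)" for i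
  proof
    have ex: "\<bar>k $ i\<bar> < 2 ^ nat \<bar>k $ i\<bar>"
    proof -
      have "int (nat \<bar>k $ i\<bar>) < int (2 ^ nat \<bar>k $ i\<bar>)" by (simp only: of_nat_less_iff less_exp)
      thus ?thesis by simp
    qed
    show "\<bar>k $ i\<bar> < 2 ^ (s $ i)" unfolding s_def vec_lambda_beta by (rule LeastI[where P = "\<lambda>n. \<bar>k $ i\<bar> < 2 ^ n", OF ex])
    show "\<lfloor>2 powr (real (s $ i) - 1)\<rfloor> \<le> \<bar>k $ i\<bar>"
    proof (cases "s $ i")
      case 0
      have "\<lfloor>2 powr (-1 :: real)\<rfloor> = 0" by (simp add: powr_minus_divide)
      thus ?thesis using 0 by simp
    next
      case (Suc n)
      have "\<not> \<bar>k $ i\<bar> < 2 ^ n" using Suc not_less_Least[of n "\<lambda>n. \<bar>k $ i\<bar> < 2 ^ n"] by (simp add: s_def)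
      moreover have "\<lfloor>2 powr real n\<rfloor> = 2 ^ n" by (simp add: powr_realpow)
      ultimately show ?thesis using Suc by simp
    qed
  qed
  hence "k \<in> dyadic_block s" by (simp add: dyadic_block_def)
  thus ?thesis by (auto simp: hyperbolic_layer_def)
qed

text \<open>Logarithmic factors occur with exponents of either sign, as b is arbitrary;
  comparability of the bases in both directions covers increasing and decreasing powers
  alike.\<close>

lemma powr_le_powr_comparable:
  fixes x y K g :: real
  assumes "0 < x" "0 < y" "x \<le> K * y" "y \<le> K * x"
  shows "x powr g \<le> K powr \<bar>g\<bar> * y powr g"
proof -
  have "0 < K * y" using assms by linarith
  hence K: "0 < K" using assms(2) by (simp add: zero_less_mult_iff)
  show ?thesis
  proof (cases "0 \<le> g")
    case True
    have "x powr g \<le> (K * y) powr g" using assms True by (intro powr_mono2) auto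
    thus ?thesis using True K assms by (simp add: powr_mult)
  next
    case False
    have "x powr g \<le> (y / K) powr g" using assms False K by (intro powr_mono2') (auto simp: field_simps)
    thus ?thesis using False K assms by (simp add: powr_divide powr_minus_divide field_simps)
  qed
qed

text \<open>A Stechkin-type estimate: Markov's inequality for |c|^\<beta> counts the large
  coefficients, and below the threshold |c| \<le> |c|^\<beta> \<tau>^(1 - \<beta>). The parameter v
  is real so that values below 1 can force the set of large coefficients to be empty.\<close>

lemma threshold_bounds:
  fixes c :: "'k \<Rightarrow> complex" and B \<beta> v :: real
  assumes S: "finite S" and \<beta>: "0 < \<beta>" "\<beta> \<le> 1" and B: "0 < B" and v: "0 < v"
    and le: "(\<Sum>k\<in>S. cmod (c k) powr \<beta>) powr (1 / \<beta>) \<le> B"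
  defines "\<tau> \<equiv> B * v powr (- 1 / \<beta>)"
  shows "real (card {k\<in>S. \<tau> < cmod (c k)}) \<le> v"
    and "(\<Sum>k | k \<in> S \<and> cmod (c k) \<le> \<tau>. cmod (c k)) \<le> B * v powr (1 - 1 / \<beta>)"
proof -
  let ?s = "\<Sum>k\<in>S. cmod (c k) powr \<beta>"
  have s0: "0 \<le> ?s" by (intro sum_nonneg) auto
  have s: "?s \<le> B powr \<beta>"
  proof -
    have "(?s powr (1 / \<beta>)) powr \<beta> \<le> B powr \<beta>" using le \<beta> by (intro powr_mono2) auto
    thus ?thesis using \<beta> s0 by (simp add: powr_powr)
  qed
  have \<tau>: "0 < \<tau>" using B v by (simp add: \<tau>_def)
  have \<tau>\<beta>: "\<tau> powr \<beta> = B powr \<beta> / v"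
    using B v \<beta> by (simp add: \<tau>_def powr_mult powr_divide powr_powr powr_minus_divide)
  have "real (card {k\<in>S. \<tau> < cmod (c k)}) * \<tau> powr \<beta> = (\<Sum>k | k \<in> S \<and> \<tau> < cmod (c k). \<tau> powr \<beta>)" by simp
  also have "\<dots> \<le> (\<Sum>k | k \<in> S \<and> \<tau> < cmod (c k). cmod (c k) powr \<beta>)"
    using \<tau> \<beta> by (intro sum_mono powr_mono2) auto
  also have "\<dots> \<le> ?s" using S by (intro sum_mono2) auto
  also note s
  finally have "B powr \<beta> * (real (card {k\<in>S. \<tau> < cmod (c k)}) / v) \<le> B powr \<beta> * 1"
    unfolding \<tau>\<beta> by (simp add: mult_ac)
  hence "real (card {k\<in>S. \<tau> < cmod (c k)}) / v \<le> 1"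
    using B by (subst (asm) mult_le_cancel_left_pos) auto
  thus "real (card {k\<in>S. \<tau> < cmod (c k)}) \<le> v" using v by simp
  have "(\<Sum>k | k \<in> S \<and> cmod (c k) \<le> \<tau>. cmod (c k)) \<le> (\<Sum>k | k \<in> S \<and> cmod (c k) \<le> \<tau>. cmod (c k) powr \<beta> * \<tau> powr (1 - \<beta>))"
  proof (intro sum_mono)
    fix k assume k: "k \<in> {k. k \<in> S \<and> cmod (c k) \<le> \<tau>}"
    have "cmod (c k) = cmod (c k) powr \<beta> * cmod (c k) powr (1 - \<beta>)"
      by (cases "c k = 0") (simp_all add: powr_add[symmetric])
    also have "\<dots> \<le> cmod (c k) powr \<beta> * \<tau> powr (1 - \<beta>)"
      using k \<beta> by (intro mult_left_mono powr_mono2) auto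
    finally show "cmod (c k) \<le> cmod (c k) powr \<beta> * \<tau> powr (1 - \<beta>)" .
  qed
  also have "\<dots> = (\<Sum>k | k \<in> S \<and> cmod (c k) \<le> \<tau>. cmod (c k) powr \<beta>) * \<tau> powr (1 - \<beta>)"
    by (simp add: sum_distrib_right)
  also have "\<dots> \<le> ?s * \<tau> powr (1 - \<beta>)" using S by (intro mult_right_mono sum_mono2) auto
  also have "\<dots> \<le> B powr \<beta> * \<tau> powr (1 - \<beta>)" using s by (intro mult_right_mono) auto
  also have "\<tau> powr (1 - \<beta>) = B powr (1 - \<beta>) * v powr (1 - 1 / \<beta>)"
  proof -
    have "- 1 / \<beta> * (1 - \<beta>) = 1 - 1 / \<beta>" using \<beta> by (simp add: field_simps)
    thus ?thesis using B v by (simp only: \<tau>_def powr_mult powr_powr powr_ge_zero less_imp_le)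
  qed
  also have "B powr \<beta> * (B powr (1 - \<beta>) * v powr (1 - 1 / \<beta>)) = B * v powr (1 - 1 / \<beta>)"
    using B by (simp add: powr_add[symmetric] mult.assoc[symmetric])
  finally show "(\<Sum>k | k \<in> S \<and> cmod (c k) \<le> \<tau>. cmod (c k)) \<le> B * v powr (1 - 1 / \<beta>)" .
qed

section \<open>Decay of the layers and its balance against their cardinality\<close>

definition layer_weight :: "real \<Rightarrow> real \<Rightarrow> nat \<Rightarrow> real" where
  "layer_weight a \<gamma> j = 2 powr (- a * real j) * real (max j 1) powr \<gamma>"

lemma layer_weight_pos: "0 < layer_weight a \<gamma> j" by (simp add: layer_weight_def)

text \<open>A shift by i brings geometric decay at the price of a polynomial factor, uniformly in n,
  so the weights beyond a layer can be summed relative to it.\<close>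

lemma layer_weight_add_le:
  "layer_weight a \<gamma> (n + i) \<le> layer_weight a \<gamma> n * (2 powr (- a * real i) * (1 + real i) powr \<bar>\<gamma>\<bar>)"
proof -
  have "real (max (n + i) 1) powr \<gamma> \<le> (1 + real i) powr \<bar>\<gamma>\<bar> * real (max n 1) powr \<gamma>"
  proof (rule powr_le_powr_comparable)
    have "max (n + i) 1 \<le> (1 + i) * max n 1" "max n 1 \<le> (1 + i) * max (n + i) 1"
      by (auto simp: max_def algebra_simps)
    hence "real (max (n + i) 1) \<le> real ((1 + i) * max n 1)" "real (max n 1) \<le> real ((1 + i) * max (n + i) 1)"
      by (simp_all only: of_nat_le_iff)
    thus "real (max (n + i) 1) \<le> (1 + real i) * real (max n 1)" "real (max n 1) \<le> (1 + real i) * real (max (n + i) 1)"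
      unfolding of_nat_mult of_nat_add by simp_all
  qed auto
  hence "2 powr (- a * real (n + i)) * real (max (n + i) 1) powr \<gamma>
      \<le> 2 powr (- a * real (n + i)) * ((1 + real i) powr \<bar>\<gamma>\<bar> * real (max n 1) powr \<gamma>)"
    by (intro mult_left_mono) auto
  moreover have "2 powr (- a * real (n + i)) = 2 powr (- a * real n) * 2 powr (- a * real i)"
    by (simp add: powr_add[symmetric] algebra_simps)
  ultimately show ?thesis unfolding layer_weight_def by (simp only: mult_ac)
qed

lemma summable_exp_poly:
  fixes a q :: real
  assumes "0 < a"
  shows "summable (\<lambda>i. 2 powr (- a * real i) * (1 + real i) powr q)"
proof (rule summable_comparison_test_bigo)
  show "summable (\<lambda>n. norm (real n powr - 2))" by (simp add: summable_real_powr_iff)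
  show "(\<lambda>i. 2 powr (- a * real i) * (1 + real i) powr q) \<in> O(\<lambda>n. real n powr - 2)"
    using assms by real_asymp
qed

text \<open>n is the last layer up to which the hyperbolic cross has of the order of w elements.
  From 2^n n^D ~ w one gets n ~ log w and 2^-(a n) ~ w^-a (log w)^(D a), so the weight 2^-(a n) n^(D
  b) acquires the logarithmic exponent D (a + b).\<close>

lemma balanced_layer:
  fixes a b w :: real and D :: nat
  assumes a: "0 < a" and w: "1 \<le> w"
  obtains n :: nat where "2 ^ n * real (n + 1) ^ D \<le> w"
    "layer_weight a (real D * b) n
       \<le> (2 powr a * 3 powr (real D * a) * (3 + 2 * real D) powr \<bar>real D * (a + b)\<bar>) * w powr - a * ln (2 * w) powr (real D * (a + b))"
proof -
  let ?P = "\<lambda>n. 2 ^ n * real (n + 1) ^ D \<le> w"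
  obtain N :: nat where N: "w < real N" using reals_Archimedean2 by blast
  have bound: "n \<le> N" if "?P n" for n
  proof (rule ccontr)
    assume "\<not> n \<le> N"
    have "real n < 2 ^ n" by (rule of_nat_less_two_power)
    also have "\<dots> * 1 \<le> 2 ^ n * real (n + 1) ^ D" by (intro mult_left_mono) auto
    finally show False using that N \<open>\<not> n \<le> N\<close> by simp
  qed
  define n where "n = (GREATEST n. ?P n)"
  have n: "?P n" unfolding n_def by (rule GreatestI_nat[where P = ?P and k = 0, OF _ bound]) (use w in auto)
  have n1: "w < 2 ^ Suc n * real (n + 2) ^ D"
  proof (rule ccontr)
    assume "\<not> ?thesis"
    hence "?P (Suc n)" by simp
    hence "Suc n \<le> n" using Greatest_le_nat[where P = ?P, OF _ bound] unfolding n_def by blast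
    thus False by simp
  qed
  define x where "x = real (max n 1)"
  have x: "1 \<le> x" "real n + 2 \<le> 3 * x" "real n + 1 \<le> 2 * x" by (auto simp: x_def)
  have lnw: "ln 2 \<le> ln (2 * w)" using w by simp
  have lnw0: "0 < ln (2 * w)" using w by simp
  have "2 ^ n * 1 \<le> 2 ^ n * real (n + 1) ^ D" by (intro mult_left_mono) auto
  from order_trans[OF this n] have "2 ^ n \<le> w" by simp
  hence "2 ^ (n + 1) \<le> 2 * w" by simp
  hence "ln (2 ^ (n + 1)) \<le> ln (2 * w)" by (subst ln_le_cancel_iff) (use w in auto)
  hence "real (n + 1) * ln 2 \<le> ln (2 * w)" by (simp only: ln_realpow)
  moreover have "x * ln 2 \<le> real (n + 1) * ln 2" by (intro mult_right_mono) (auto simp: x_def)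
  ultimately have A: "x * ln 2 \<le> ln (2 * w)" by linarith
  have "x * (1/2) \<le> x * ln 2" using ln2_ge_two_thirds x by (intro mult_left_mono) auto
  with A have "x \<le> 2 * ln (2 * w)" by linarith
  also have "\<dots> \<le> (3 + 2 * real D) * ln (2 * w)" using lnw0 by (intro mult_right_mono) auto
  finally have c1: "x \<le> (3 + 2 * real D) * ln (2 * w)" .
  have "ln (2 * w) \<le> ln (2 * (2 ^ Suc n * real (n + 2) ^ D))" using n1 w by simp
  also have "\<dots> = ln (2 ^ (n + 2)) + ln (real (n + 2) ^ D)" 
  proof -
    have "2 * (2 ^ Suc n * real (n + 2) ^ D) = 2 ^ (n + 2) * real (n + 2) ^ D" by simp
    thus ?thesis by (simp only:) (rule ln_mult_pos; simp)
  qed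
  also have "\<dots> = real (n + 2) * ln 2 + real D * ln (real (n + 2))" by (simp only: ln_realpow)
  also have "\<dots> \<le> real (n + 2) * 1 + real D * (real (n + 2) - 1)"
    using ln_2_less_1 by (intro add_mono mult_left_mono ln_le_minus_one) auto
  also have "\<dots> \<le> 3 * x + real D * (2 * x)" using x by (intro add_mono mult_left_mono) auto
  finally have c2: "ln (2 * w) \<le> (3 + 2 * real D) * x" by (simp add: algebra_simps)
  have xg: "x powr (real D * (a + b)) \<le> (3 + 2 * real D) powr \<bar>real D * (a + b)\<bar> * ln (2 * w) powr (real D * (a + b))"
    using x lnw0 c1 c2 by (intro powr_le_powr_comparable) auto
  have "w \<le> 2 * 2 ^ n * (3 * x) ^ D"
  proof -
    have "w \<le> 2 ^ Suc n * real (n + 2) ^ D" using n1 by simp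
    also have "\<dots> \<le> 2 ^ Suc n * (3 * x) ^ D" using x by (intro mult_left_mono power_mono) auto
    finally show ?thesis by simp
  qed
  hence "w powr a \<le> (2 * 2 ^ n * (3 * x) ^ D) powr a" using a w by (intro powr_mono2) auto
  also have "\<dots> = 2 powr a * 2 powr (a * real n) * (3 powr (real D * a) * x powr (real D * a))"
    using x by (simp add: powr_mult powr_powr flip: powr_realpow) (simp add: mult_ac)
  finally have wa: "w powr a \<le> 2 powr a * 2 powr (a * real n) * (3 powr (real D * a) * x powr (real D * a))" .
  have "2 powr (- a * real n) \<le> 2 powr a * 3 powr (real D * a) * x powr (real D * a) * w powr - a"
    using wa w by (simp add: powr_minus field_simps)
  hence "2 powr (- a * real n) * x powr (real D * b)
      \<le> (2 powr a * 3 powr (real D * a) * x powr (real D * a) * w powr - a) * x powr (real D * b)"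
    by (intro mult_right_mono) auto
  also have "\<dots> = 2 powr a * 3 powr (real D * a) * w powr - a * x powr (real D * (a + b))"
    by (simp add: powr_add distrib_left)
  also have "\<dots> \<le> 2 powr a * 3 powr (real D * a) * w powr - a * ((3 + 2 * real D) powr \<bar>real D * (a + b)\<bar> * ln (2 * w) powr (real D * (a + b)))"
    by (intro mult_left_mono xg) auto
  finally have "layer_weight a (real D * b) n
       \<le> (2 powr a * 3 powr (real D * a) * (3 + 2 * real D) powr \<bar>real D * (a + b)\<bar>) * w powr - a * ln (2 * w) powr (real D * (a + b))"
    by (simp add: layer_weight_def x_def mult_ac)
  with n show ?thesis by (rule that)
qed

text \<open>Up to constants, the size of a single coefficient left over by the w-sparse approximants
  below. The remainder has l1 norm of order w times this rate, and squared l2 norm of order w times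
  its square.\<close>

definition approx_rate :: "real \<Rightarrow> real \<Rightarrow> real \<Rightarrow> nat \<Rightarrow> real \<Rightarrow> real" where
  "approx_rate a b \<beta> D w = w powr (- (1 / \<beta>) - a) * ln (2 * w) powr (real D * (a + b))"

lemma sum_shift_le_suminf:
  fixes h :: "nat \<Rightarrow> real"
  assumes "finite X" "X \<subseteq> {n..}" "summable h" "\<And>i. 0 \<le> h i"
  shows "(\<Sum>j\<in>X. h (j - n)) \<le> suminf h"
proof -
  have "inj_on (\<lambda>j. j - n) X" using assms(2) by (auto simp: inj_on_def subset_iff) (metis le_add_diff_inverse)
  hence "(\<Sum>j\<in>X. h (j - n)) = (\<Sum>i\<in>(\<lambda>j. j - n) ` X. h i)" by (simp add: sum.reindex)
  also have "\<dots> \<le> suminf h" using assms by (intro sum_le_suminf) auto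
  finally show ?thesis .
qed

lemma sum_UN_le_sum_sum:
  fixes h :: "'k \<Rightarrow> real"
  assumes "finite I" "\<And>i. i \<in> I \<Longrightarrow> finite (A i)" "\<And>k. 0 \<le> h k"
  shows "(\<Sum>k\<in>(\<Union>i\<in>I. A i). h k) \<le> (\<Sum>i\<in>I. \<Sum>k\<in>A i. h k)"
  using assms(1,2)
proof (induction I)
  case (insert i I)
  have "(\<Sum>k\<in>A i \<union> (\<Union>i\<in>I. A i). h k) \<le> (\<Sum>k\<in>A i. h k) + (\<Sum>k\<in>(\<Union>i\<in>I. A i). h k)"
    using insert assms(3) by (subst sum_Un) (auto intro!: sum_nonneg)
  thus ?case using insert by force
qed simp

lemma sum_le_sum_layers:
  fixes F :: "(int ^ 'd::finite) set" and h :: "int ^ 'd \<Rightarrow> real"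
  assumes "finite F" "\<And>k. 0 \<le> h k" "\<And>k j. k \<in> F \<Longrightarrow> k \<in> hyperbolic_layer j \<Longrightarrow> J \<le> j"
  shows "\<exists>J'. (\<Sum>k\<in>F. h k) \<le> (\<Sum>j\<in>{J..<J'}. \<Sum>k\<in>hyperbolic_layer j \<inter> F. h k)"
proof -
  obtain l where l: "\<And>k :: int ^ 'd. k \<in> hyperbolic_layer (l k)" using hyperbolic_layers_cover by metis
  obtain J' where J': "\<And>k. k \<in> F \<Longrightarrow> l k < J'"
    using finite_nat_set_iff_bounded[of "l ` F"] assms(1) by auto
  have "F \<subseteq> (\<Union>j\<in>{J..<J'}. hyperbolic_layer j \<inter> F)" using l J' assms(3) by force
  hence "(\<Sum>k\<in>F. h k) \<le> (\<Sum>k\<in>(\<Union>j\<in>{J..<J'}. hyperbolic_layer j \<inter> F). h k)"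
    using assms(1,2) by (intro sum_mono2) auto
  also have "\<dots> \<le> (\<Sum>j\<in>{J..<J'}. \<Sum>k\<in>hyperbolic_layer j \<inter> F. h k)"
    using assms(1,2) by (intro sum_UN_le_sum_sum) auto
  finally show ?thesis by blast
qed

text \<open>Thresholding with v = 1/2: fewer than one coefficient lies above the threshold, hence
  none, and the bound for the small coefficients covers the whole layer.\<close>

lemma sum_layer_le:
  fixes c :: "int ^ 'd::finite \<Rightarrow> complex"
  assumes \<beta>: "0 < \<beta>" "\<beta> \<le> 1" and "A_quasinorm \<beta> j c \<le> B" "0 < B"
  shows "(\<Sum>k\<in>hyperbolic_layer j. cmod (c k)) \<le> 2 powr (1 / \<beta>) * B"
proof -
  let ?\<tau> = "B * (1/2) powr (- 1 / \<beta>)"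
  note t = threshold_bounds[OF finite_hyperbolic_layer \<beta> assms(4) _ assms(3)[unfolded A_quasinorm_def], of "1/2"]
  have "card {k\<in>hyperbolic_layer j. ?\<tau> < cmod (c k)} = 0" using t(1) by simp
  hence "{k\<in>hyperbolic_layer j. ?\<tau> < cmod (c k)} = {}" using finite_hyperbolic_layer[of j] by (subst (asm) card_0_eq) auto
  hence "{k. k \<in> hyperbolic_layer j \<and> cmod (c k) \<le> ?\<tau>} = hyperbolic_layer j" by force
  hence "(\<Sum>k\<in>hyperbolic_layer j. cmod (c k)) \<le> B * (1/2) powr (1 - 1 / \<beta>)" using t(2) by simp
  also have "\<dots> \<le> B * 2 powr (1 / \<beta>)"
    using assms(4) by (intro mult_left_mono) (simp_all add: powr_divide powr_diff field_simps)
  finally show ?thesis by (simp add: mult.commute)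
qed

text \<open>Half of the decay 2^-(a j) is spent on smallness beyond layer J, the other half on the
  convergence of the sum.\<close>

lemma sum_outside_layers_le:
  fixes c :: "int ^ 'd::finite \<Rightarrow> complex"
  assumes a: "0 < a" and \<beta>: "0 < \<beta>" "\<beta> \<le> 1" and A: "\<And>j. A_quasinorm \<beta> j c \<le> layer_weight a \<gamma> j"
    and F: "finite F" "F \<inter> (\<Union>j<J. hyperbolic_layer j) = {}"
  shows "(\<Sum>k\<in>F. cmod (c k))
     \<le> 2 powr (1 / \<beta>) * (\<Sum>i. 2 powr (- (a / 2) * real i) * (1 + real i) powr \<bar>\<gamma>\<bar>) * 2 powr (- (a / 2) * real J)"
proof -
  let ?h = "\<lambda>i. 2 powr (- (a / 2) * real i) * (1 + real i) powr \<bar>\<gamma>\<bar>"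
  have sm: "summable ?h" using a by (intro summable_exp_poly) auto
  have "J \<le> j" if "k \<in> F" "k \<in> hyperbolic_layer j" for k j
    using F(2) that by (metis IntI UN_I empty_iff lessThan_iff not_less)
  then obtain J' where "(\<Sum>k\<in>F. cmod (c k)) \<le> (\<Sum>j\<in>{J..<J'}. \<Sum>k\<in>hyperbolic_layer j \<inter> F. cmod (c k))"
    using sum_le_sum_layers[of F "\<lambda>k. cmod (c k)" J] F by auto
  also have "\<dots> \<le> (\<Sum>j\<in>{J..<J'}. 2 powr (1 / \<beta>) * 2 powr (- (a / 2) * real J) * ?h j)"
  proof (intro sum_mono)
    fix j assume j: "j \<in> {J..<J'}"
    have "(\<Sum>k\<in>hyperbolic_layer j \<inter> F. cmod (c k)) \<le> (\<Sum>k\<in>hyperbolic_layer j. cmod (c k))"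
      using finite_hyperbolic_layer by (intro sum_mono2) auto
    also have "\<dots> \<le> 2 powr (1 / \<beta>) * layer_weight a \<gamma> j" by (intro sum_layer_le \<beta> A layer_weight_pos)
    also have "layer_weight a \<gamma> j \<le> 2 powr (- a * real j) * (1 + real j) powr \<bar>\<gamma>\<bar>"
      using layer_weight_add_le[of a \<gamma> 0 j] by (simp add: layer_weight_def)
    also have "2 powr (- a * real j) = 2 powr (- (a / 2) * real j) * 2 powr (- (a / 2) * real j)"
      by (simp add: powr_add[symmetric])
    also have "\<dots> \<le> 2 powr (- (a / 2) * real J) * 2 powr (- (a / 2) * real j)"
      using a j by (intro mult_right_mono powr_mono) auto
    finally show "(\<Sum>k\<in>hyperbolic_layer j \<inter> F. cmod (c k)) \<le> 2 powr (1 / \<beta>) * 2 powr (- (a / 2) * real J) * ?h j"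
      by (simp add: mult_left_mono mult_right_mono mult_ac)
  qed
  also have "\<dots> = 2 powr (1 / \<beta>) * 2 powr (- (a / 2) * real J) * (\<Sum>j\<in>{J..<J'}. ?h j)"
    by (simp add: sum_distrib_left)
  also have "\<dots> \<le> 2 powr (1 / \<beta>) * 2 powr (- (a / 2) * real J) * suminf ?h"
    using sm by (intro mult_left_mono sum_le_suminf) auto
  finally show ?thesis by (simp add: mult_ac)
qed

text \<open>The full layers up to the balanced one, followed by geometrically thinning thresholds.\<close>

lemma sparse_approximation:
  fixes c :: "int ^ 'd::finite \<Rightarrow> complex" and a b \<beta> w :: real
  defines "D \<equiv> CARD('d) - 1"
  defines "K \<equiv> 2 powr a * 3 powr (real D * a) * (3 + 2 * real D) powr \<bar>real D * (a + b)\<bar>"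
  defines "S \<equiv> (\<Sum>i. 2 powr (- (a / 2) * real i) * (1 + real i) powr \<bar>real D * b\<bar>)"
  assumes a: "0 < a" and \<beta>: "0 < \<beta>" "\<beta> \<le> 1" and A: "\<And>j. A_quasinorm \<beta> j c \<le> layer_weight a (real D * b) j"
    and w: "1 \<le> w" and J: "log 2 w * (1 + 2 / (a * \<beta>)) \<le> real J"
  shows "\<exists>T \<subseteq> (\<Union>j\<le>J. hyperbolic_layer j). real (card T) \<le> (2 ^ (CARD('d) + 1) + (\<Sum>i. 2 powr (- (a * \<beta> / 2) * real i))) * w \<and>
     (\<forall>F. finite F \<and> F \<inter> T = {} \<longrightarrow> (\<Sum>k\<in>F. cmod (c k)) \<le> K * S * w * approx_rate a b \<beta> D w) \<and>
     (\<forall>k. k \<notin> T \<longrightarrow> cmod (c k) \<le> K * S * approx_rate a b \<beta> D w)"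
proof -
  obtain n where n: "2 ^ n * real (n + 1) ^ D \<le> w"
    "layer_weight a (real D * b) n \<le> K * w powr - a * ln (2 * w) powr (real D * (a + b))"
    using balanced_layer[OF a w, of D b] unfolding K_def by blast
  \<comment> \<open>Layer n + i gets the quota \<open>v i\<close>, that is w 2^-(\<kappa> i). With
    \<kappa> = a \<beta> / 2 the power 1/\<beta> of the thinning uses up half of the decay of the
    weights, so quotas and thresholds are both summable.\<close>
  define \<kappa> where "\<kappa> = a * \<beta> / 2"
  define B where "B = layer_weight a (real D * b)"
  define v where "v = (\<lambda>i. w * 2 powr (- \<kappa> * real i))"
  define \<tau> where "\<tau> = (\<lambda>i. B (n + i) * v i powr (- 1 / \<beta>))"
  define h where "h = (\<lambda>i. 2 powr (- (a / 2) * real i) * (1 + real i) powr \<bar>real D * b\<bar>)"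
  define E where "E = (\<lambda>j. if j \<le> n then hyperbolic_layer j else {k\<in>hyperbolic_layer j. \<tau> (j - n) < cmod (c k)})"
  define T where "T = (\<Union>j\<le>J. E j)"
  have \<kappa>: "0 < \<kappa>" using a \<beta> by (simp add: \<kappa>_def)
  have B0: "0 < B j" for j by (simp add: B_def layer_weight_pos)
  have v0: "0 < v i" for i using w by (simp add: v_def)
  have h0: "0 \<le> h i" for i by (simp add: h_def)
  have sumh: "summable h" unfolding h_def using a by (intro summable_exp_poly) auto
  have Sh: "S = suminf h" by (simp add: S_def h_def)
  have K0: "0 \<le> K" by (simp add: K_def)
  have S0: "0 \<le> S" unfolding Sh by (rule suminf_nonneg[OF sumh h0])
  have Bni: "B (n + i) \<le> B n * (2 powr (- a * real i) * (1 + real i) powr \<bar>real D * b\<bar>)" for i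
    unfolding B_def by (rule layer_weight_add_le)
  have Bn: "B n * w powr (- 1 / \<beta>) \<le> K * approx_rate a b \<beta> D w"
  proof -
    have le: "B n * w powr (- 1 / \<beta>) \<le> K * w powr - a * ln (2 * w) powr (real D * (a + b)) * w powr (- 1 / \<beta>)"
      unfolding B_def by (intro mult_right_mono n) auto
    have "- (1 / \<beta>) - a = - a + - 1 / \<beta>" by simp
    hence "w powr (- (1 / \<beta>) - a) = w powr - a * w powr (- 1 / \<beta>)" by (simp only: powr_add)
    hence "K * w powr - a * ln (2 * w) powr (real D * (a + b)) * w powr (- 1 / \<beta>) = K * approx_rate a b \<beta> D w"
      by (simp add: approx_rate_def)
    with le show ?thesis by metis
  qed
  have \<tau>h: "\<tau> i \<le> K * approx_rate a b \<beta> D w * h i" for i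
  proof -
    have e: "v i powr (- 1 / \<beta>) = w powr (- 1 / \<beta>) * 2 powr (a / 2 * real i)"
      unfolding v_def using w \<beta> by (subst powr_mult) (simp_all add: powr_powr \<kappa>_def)
    have "\<tau> i \<le> B n * (2 powr (- a * real i) * (1 + real i) powr \<bar>real D * b\<bar>) * v i powr (- 1 / \<beta>)"
      unfolding \<tau>_def by (intro mult_right_mono Bni) auto
    also have "2 powr (- (a / 2) * real i) = 2 powr (- a * real i) * 2 powr (a / 2 * real i)"
      by (simp add: powr_add[symmetric])
    hence "B n * (2 powr (- a * real i) * (1 + real i) powr \<bar>real D * b\<bar>) * v i powr (- 1 / \<beta>) = B n * w powr (- 1 / \<beta>) * h i"
      unfolding e h_def by (simp only: mult_ac)
    also have "\<dots> \<le> K * approx_rate a b \<beta> D w * h i" by (intro mult_right_mono Bn h0)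
    finally show ?thesis .
  qed
  have thr: "real (card {k\<in>hyperbolic_layer (n + i). \<tau> i < cmod (c k)}) \<le> v i"
    "(\<Sum>k | k \<in> hyperbolic_layer (n + i) \<and> cmod (c k) \<le> \<tau> i. cmod (c k)) \<le> B (n + i) * v i powr (1 - 1 / \<beta>)" for i
    using threshold_bounds[OF finite_hyperbolic_layer \<beta> B0 v0 A[of "n + i", unfolded A_quasinorm_def, folded B_def], of i]
    unfolding \<tau>_def by auto
  have thr2: "B (n + i) * v i powr (1 - 1 / \<beta>) \<le> K * w * approx_rate a b \<beta> D w * h i" for i
  proof -
    have "B (n + i) * v i powr (1 - 1 / \<beta>) = v i * \<tau> i"
      unfolding \<tau>_def using v0[of i] by (simp add: powr_diff powr_minus_divide)
    also have "\<dots> \<le> w * \<tau> i"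
    proof (intro mult_right_mono)
      have "2 powr (- \<kappa> * real i) \<le> 2 powr 0" using \<kappa> by (intro powr_mono) auto
      thus "v i \<le> w" using w by (simp add: v_def mult_left_le)
      show "0 \<le> \<tau> i" using B0[of "n + i"] by (simp add: \<tau>_def)
    qed
    also have "\<dots> \<le> w * (K * approx_rate a b \<beta> D w * h i)" using w by (intro mult_left_mono \<tau>h) auto
    finally show ?thesis by (simp add: mult_ac)
  qed
  have nw: "real n \<le> log 2 w"
  proof -
    have "2 ^ n * 1 \<le> 2 ^ n * real (n + 1) ^ D" by (intro mult_left_mono) auto
    from order_trans[OF this n(1)] have "2 powr real n \<le> w" by (simp add: powr_realpow)
    thus ?thesis using w by (subst le_log_iff) auto
  qed
  have log0: "0 \<le> log 2 w" using w by simp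
  have nJ: "n \<le> J"
  proof -
    have "log 2 w * 1 \<le> log 2 w * (1 + 2 / (a * \<beta>))" using log0 a \<beta> by (intro mult_left_mono) auto
    thus ?thesis using nw J by simp
  qed
  \<comment> \<open>Beyond layer J the quota is below 1, so no coefficient exceeds its threshold
    there. Since n \<le> log w, this happens once i > log w / \<kappa>, which explains the summand 2
    / (a \<beta>) in the condition on J.\<close>
  have empty: "{k\<in>hyperbolic_layer j. \<tau> (j - n) < cmod (c k)} = {}" if "J < j" for j
  proof -
    have nj: "n + (j - n) = j" using that nJ by simp
    have "log 2 w * (2 / (a * \<beta>)) < real (j - n)"
      using that J nw nJ by (simp add: distrib_left of_nat_diff)
    hence "log 2 w < \<kappa> * real (j - n)" using a \<beta> by (simp add: \<kappa>_def field_simps)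
    hence "w < 2 powr (\<kappa> * real (j - n))" using w by (subst (asm) log_less_iff) auto
    hence "v (j - n) < 1" by (simp add: v_def powr_minus_divide)
    hence "card {k\<in>hyperbolic_layer j. \<tau> (j - n) < cmod (c k)} = 0" using thr(1)[of "j - n"] unfolding nj by linarith
    thus ?thesis using finite_hyperbolic_layer[of j] by (subst (asm) card_0_eq) auto
  qed
  have notT: "n < j \<and> cmod (c k) \<le> \<tau> (j - n)" if "k \<notin> T" "k \<in> hyperbolic_layer j" for k j
  proof (cases "j \<le> J")
    case True
    hence "k \<notin> E j" using that by (auto simp: T_def)
    thus ?thesis using that by (auto simp: E_def split: if_splits)
  next
    case False
    hence "J < j" by simp
    from empty[OF this] show ?thesis using that(2) nJ False by auto
  qed
  have "T \<subseteq> (\<Union>j\<le>J. hyperbolic_layer j)" by (auto simp: T_def E_def split: if_splits)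
  moreover have "real (card T) \<le> (2 ^ (CARD('d) + 1) + (\<Sum>i. 2 powr (- (a * \<beta> / 2) * real i))) * w"
  proof -
    have "card T \<le> (\<Sum>j\<le>J. card (E j))" unfolding T_def by (rule card_UN_le) simp
    also have "{..J} = {..n} \<union> {n<..J}" using nJ by auto
    also have "(\<Sum>j\<in>{..n} \<union> {n<..J}. card (E j)) = (\<Sum>j\<le>n. card (E j)) + (\<Sum>j\<in>{n<..J}. card (E j))"
      by (intro sum.union_disjoint) auto
    finally have "real (card T) \<le> real (\<Sum>j\<le>n. card (E j)) + real (\<Sum>j\<in>{n<..J}. card (E j))" by linarith
    moreover have "real (\<Sum>j\<le>n. card (E j)) \<le> 2 ^ (CARD('d) + 1) * w"
    proof -
      have "(\<Sum>j\<le>n. card (E j)) \<le> (\<Sum>j\<le>n. (n + 1) ^ D * 2 ^ CARD('d) * 2 ^ j)"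
      proof (intro sum_mono)
        fix j assume j: "j \<in> {..n}"
        have "card (E j) \<le> (j + 1) ^ D * 2 ^ (CARD('d) + j)" using j card_hyperbolic_layer[where 'd='d] by (simp add: E_def D_def)
        also have "\<dots> \<le> (n + 1) ^ D * 2 ^ (CARD('d) + j)" using j by (intro mult_right_mono power_mono) auto
        finally show "card (E j) \<le> (n + 1) ^ D * 2 ^ CARD('d) * 2 ^ j" by (simp add: power_add mult_ac)
      qed
      also have "\<dots> = (n + 1) ^ D * 2 ^ CARD('d) * (\<Sum>j\<le>n. 2 ^ j)" by (simp add: sum_distrib_left)
      also have "(\<Sum>j\<le>n. 2 ^ j) \<le> (2 ^ (n + 1) :: nat)" by (induction n) auto
      finally have "real (\<Sum>j\<le>n. card (E j)) \<le> real ((n + 1) ^ D * 2 ^ CARD('d) * 2 ^ (n + 1))"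
        by (simp only: of_nat_le_iff mult_le_mono)
      also have "\<dots> = 2 ^ (CARD('d) + 1) * (2 ^ n * real (n + 1) ^ D)" by (simp add: power_add mult_ac)
      also have "\<dots> \<le> 2 ^ (CARD('d) + 1) * w" using n by (intro mult_left_mono) auto
      finally show ?thesis .
    qed
    moreover have "real (\<Sum>j\<in>{n<..J}. card (E j)) \<le> (\<Sum>i. 2 powr (- (a * \<beta> / 2) * real i)) * w"
    proof -
      have "real (\<Sum>j\<in>{n<..J}. card (E j)) \<le> (\<Sum>j\<in>{n<..J}. v (j - n))"
        unfolding of_nat_sum
      proof (intro sum_mono)
        fix j assume "j \<in> {n<..J}"
        thus "real (card (E j)) \<le> v (j - n)" using thr(1)[of "j - n"] by (simp add: E_def)
      qed
      also have "\<dots> = w * (\<Sum>j\<in>{n<..J}. 2 powr (- \<kappa> * real (j - n)))" by (simp add: v_def sum_distrib_left)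
      also have "\<dots> \<le> w * (\<Sum>i. 2 powr (- \<kappa> * real i))"
        using w summable_exp_poly[OF \<kappa>, of 0] by (intro mult_left_mono sum_shift_le_suminf) auto
      finally show ?thesis by (simp add: \<kappa>_def mult_ac)
    qed
    ultimately show ?thesis by (simp add: distrib_right)
  qed
  moreover have "(\<Sum>k\<in>F. cmod (c k)) \<le> K * S * w * approx_rate a b \<beta> D w" if F: "finite F" "F \<inter> T = {}" for F
  proof -
    have "Suc n \<le> j" if "k \<in> F" "k \<in> hyperbolic_layer j" for k j using notT[OF _ that(2)] that(1) F(2) by (force simp: Suc_le_eq)
    then obtain J' where "(\<Sum>k\<in>F. cmod (c k)) \<le> (\<Sum>j\<in>{Suc n..<J'}. \<Sum>k\<in>hyperbolic_layer j \<inter> F. cmod (c k))"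
      using sum_le_sum_layers[of F "\<lambda>k. cmod (c k)" "Suc n"] F by auto
    also have "\<dots> \<le> (\<Sum>j\<in>{Suc n..<J'}. K * w * approx_rate a b \<beta> D w * h (j - n))"
    proof (intro sum_mono)
      fix j assume j: "j \<in> {Suc n..<J'}"
      hence nj: "n + (j - n) = j" by simp
      have "(\<Sum>k\<in>hyperbolic_layer j \<inter> F. cmod (c k)) \<le> (\<Sum>k | k \<in> hyperbolic_layer j \<and> cmod (c k) \<le> \<tau> (j - n). cmod (c k))"
        using F notT finite_hyperbolic_layer[of j] by (intro sum_mono2) auto
      also have "\<dots> \<le> B j * v (j - n) powr (1 - 1 / \<beta>)" using thr(2)[of "j - n"] unfolding nj .
      also have "\<dots> \<le> K * w * approx_rate a b \<beta> D w * h (j - n)" using thr2[of "j - n"] unfolding nj .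
      finally show "(\<Sum>k\<in>hyperbolic_layer j \<inter> F. cmod (c k)) \<le> K * w * approx_rate a b \<beta> D w * h (j - n)" .
    qed
    also have "\<dots> = K * w * approx_rate a b \<beta> D w * (\<Sum>j\<in>{Suc n..<J'}. h (j - n))" by (simp add: sum_distrib_left)
    also have "\<dots> \<le> K * w * approx_rate a b \<beta> D w * S"
      unfolding Sh using K0 w sumh h0 by (intro mult_left_mono sum_shift_le_suminf) (auto simp: approx_rate_def)
    finally show ?thesis by (simp add: mult_ac)
  qed
  moreover have "cmod (c k) \<le> K * S * approx_rate a b \<beta> D w" if k: "k \<notin> T" for k
  proof -
    obtain j where j: "k \<in> hyperbolic_layer j" using hyperbolic_layers_cover by blast
    have "cmod (c k) \<le> K * approx_rate a b \<beta> D w * h (j - n)" using notT[OF k j] \<tau>h[of "j - n"] by linarith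
    also have "h (j - n) \<le> S" unfolding Sh using sum_le_suminf[OF sumh, of "{j - n}"] h0 by simp
    hence "K * approx_rate a b \<beta> D w * h (j - n) \<le> K * approx_rate a b \<beta> D w * S"
      using K0 by (intro mult_left_mono) (auto simp: approx_rate_def)
    finally show ?thesis by (simp only: mult_ac)
  qed
  ultimately show ?thesis by blast
qed

text \<open>What the sampling argument uses about the class. The tail outside \<open>Q\<close> is
  bounded by r w without a factor w because it enters as a pointwise error; the tail inside
  \<open>Q\<close> may be w times larger in l1, since it is measured in mean square.\<close>

definition sparse_tails :: "real \<Rightarrow> (real \<Rightarrow> real) \<Rightarrow> 'k set \<Rightarrow> real \<Rightarrow> ('k \<Rightarrow> complex) \<Rightarrow> bool" where
  "sparse_tails C r Q V c \<longleftrightarrow>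
     (\<forall>F. finite F \<longrightarrow> (\<Sum>k\<in>F. cmod (c k)) \<le> C * r 1) \<and>
     (\<forall>w. 1 \<le> w \<and> w \<le> V \<longrightarrow>
        (\<forall>F. finite F \<and> F \<inter> Q = {} \<longrightarrow> (\<Sum>k\<in>F. cmod (c k)) \<le> C * r w) \<and>
        (\<exists>T\<subseteq>Q. real (card T) \<le> C * w \<and>
           (\<forall>F. finite F \<and> F \<inter> T = {} \<longrightarrow> (\<Sum>k\<in>F. cmod (c k)) \<le> C * w * r w) \<and>
           (\<forall>k. k \<notin> T \<longrightarrow> cmod (c k) \<le> C * r w)))"

lemma approx_rate_pos: "1 \<le> w \<Longrightarrow> 0 < approx_rate a b \<beta> D w"
  by (simp add: approx_rate_def)

text \<open>The spare power of w beats the logarithm, whatever the sign of D (a + b). This converts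
  the exponential smallness of far layers into the rate.\<close>

lemma approx_rate_lower_bound:
  "\<exists>C>0. \<forall>w\<ge>1. w powr (- (1 / \<beta>) - a - 1) \<le> C * approx_rate a b \<beta> D w"
proof -
  define g where "g = real D * (a + b)"
  define C where "C = 3 powr \<bar>g\<bar> * (if g = 0 then 1 else 2 * \<bar>g\<bar> powr \<bar>g\<bar>)"
  have C: "0 < C" by (simp add: C_def)
  have "w powr (- (1 / \<beta>) - a - 1) \<le> C * approx_rate a b \<beta> D w" if w: "1 \<le> w" for w
  proof -
    define x where "x = ln (2 * w)"
    have "ln 2 \<le> x" unfolding x_def using w by simp
    hence x: "2 / 3 \<le> x" using ln2_ge_two_thirds by linarith
    \<comment> \<open>x may be smaller than 1; it is 3 x * x \<ge> 1 that allows x^(-g) to be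
      bounded by (3 x)^|g| for either sign of g.\<close>
    have "(2/3) * (2/3) \<le> x * x" using x by (intro mult_mono) auto
    hence xx: "1 \<le> 3 * x * x" by simp
    have "x powr (- g) \<le> (3 * x) powr \<bar>- g\<bar> * 1 powr (- g)"
      using x xx by (intro powr_le_powr_comparable) auto
    also have "\<dots> = 3 powr \<bar>g\<bar> * x powr \<bar>g\<bar>" using x by (simp add: powr_mult)
    also have "x powr \<bar>g\<bar> \<le> (if g = 0 then 1 else 2 * \<bar>g\<bar> powr \<bar>g\<bar>) * w"
    proof (cases "g = 0")
      case False
      have "x \<le> (2 * w) powr (1 / \<bar>g\<bar>) / (1 / \<bar>g\<bar>)" unfolding x_def using w False by (intro ln_powr_bound) auto
      hence "x powr \<bar>g\<bar> \<le> ((2 * w) powr (1 / \<bar>g\<bar>) * \<bar>g\<bar>) powr \<bar>g\<bar>" using x by (intro powr_mono2) auto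
      also have "\<dots> = 2 * w * \<bar>g\<bar> powr \<bar>g\<bar>" using w False by (simp add: powr_mult powr_powr)
      finally show ?thesis using False by (simp add: mult_ac)
    qed (use w x in auto)
    hence "3 powr \<bar>g\<bar> * x powr \<bar>g\<bar> \<le> C * w" unfolding C_def by (simp add: mult.assoc mult_left_mono)
    finally have "x powr (- g) \<le> C * w" .
    hence "1 \<le> C * w * x powr g" using x by (simp add: powr_minus field_simps)
    hence "w powr (- (1 / \<beta>) - a - 1) * 1 \<le> w powr (- (1 / \<beta>) - a - 1) * (C * w * x powr g)" by (intro mult_left_mono) auto
    also have "\<dots> = C * (w powr (- (1 / \<beta>) - a - 1) * w powr 1) * x powr g" using w by (simp add: mult_ac)
    also have "w powr (- (1 / \<beta>) - a - 1) * w powr 1 = w powr (- (1 / \<beta>) - a)" by (simp only: powr_add[symmetric]) simp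
    finally show ?thesis by (simp add: approx_rate_def x_def g_def mult_ac)
  qed
  with C show ?thesis by blast
qed

text \<open>Supplies the bounded ratio of consecutive errors in the dyadic stages of the
  algorithm.\<close>

lemma approx_rate_doubling:
  assumes "1 \<le> w" "0 < a" "0 < \<beta>"
  shows "approx_rate a b \<beta> D w \<le> 2 powr (1 / \<beta> + a + \<bar>real D * (a + b)\<bar>) * approx_rate a b \<beta> D (2 * w)"
proof -
  let ?g = "real D * (a + b)"
  have l2: "ln 2 \<le> ln (2 * w)" using assms by simp
  have l4: "ln (2 * (2 * w)) = ln 2 + ln (2 * w)" using assms by (subst ln_mult_pos) auto
  have lp: "0 < ln (2 * w)" using assms by simp
  have "ln (2 * w) powr ?g \<le> 2 powr \<bar>?g\<bar> * ln (2 * (2 * w)) powr ?g"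
  proof -
    define x where "x = ln (2 * w)"
    have x: "0 < x" "ln 2 \<le> x" "0 < ln (2::real)" using l2 lp by (simp_all add: x_def)
    have comparable: "x \<le> 2 * (y + x)" "y + x \<le> 2 * x" "0 < y + x" if "0 < y" "y \<le> x" for y :: real
      using that by simp_all
    have "x powr ?g \<le> 2 powr \<bar>?g\<bar> * (ln 2 + x) powr ?g"
      by (rule powr_le_powr_comparable) (rule comparable[OF x(3,2)] x)+
    thus ?thesis unfolding l4 x_def .
  qed
  hence "w powr (- (1 / \<beta>) - a) * ln (2 * w) powr ?g
     \<le> w powr (- (1 / \<beta>) - a) * (2 powr \<bar>?g\<bar> * ln (2 * (2 * w)) powr ?g)" by (intro mult_left_mono) auto
  moreover have "w powr (- (1 / \<beta>) - a) = 2 powr (1 / \<beta> + a) * (2 * w) powr (- (1 / \<beta>) - a)"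
  proof -
    have "2 powr (1 / \<beta> + a) * 2 powr (- (1 / \<beta>) - a) = (1::real)" by (simp add: powr_add[symmetric])
    thus ?thesis using assms by (simp add: powr_mult)
  qed
  ultimately show ?thesis unfolding approx_rate_def powr_add[of _ _ "\<bar>?g\<bar>"] by (simp only: mult_ac)
qed

text \<open>One C serves all V, and the number of layers is only logarithmic in V. Hence |Q| is at
  most polynomial in V, and its logarithm, which enters the number of samples, is of order log
  V.\<close>

lemma class_sparse_tails:
  fixes a b \<beta> :: real
  defines "D \<equiv> CARD('d::finite) - 1"
  assumes a: "0 < a" and \<beta>: "0 < \<beta>" "\<beta> \<le> 1"
  shows "\<exists>C\<ge>1. \<forall>V\<ge>1. \<exists>J. real J \<le> C * ln (2 * V) \<and>
    (\<forall>c :: int ^ 'd \<Rightarrow> complex. (\<forall>j. A_quasinorm \<beta> j c \<le> layer_weight a (real D * b) j) \<longrightarrow>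
       sparse_tails C (approx_rate a b \<beta> D) (\<Union>j\<le>J. hyperbolic_layer j) V c)"
proof -
  let ?r = "approx_rate a b \<beta> D"
  obtain C3 where C3: "0 < C3" "\<And>w. 1 \<le> w \<Longrightarrow> w powr (- (1 / \<beta>) - a - 1) \<le> C3 * ?r w"
    using approx_rate_lower_bound by blast
  define S0 where "S0 = 2 powr (1 / \<beta>) * (\<Sum>i. 2 powr (- (a / 2) * real i) * (1 + real i) powr \<bar>real D * b\<bar>)"
  define K where "K = 2 powr a * 3 powr (real D * a) * (3 + 2 * real D) powr \<bar>real D * (a + b)\<bar>"
  define S where "S = (\<Sum>i. 2 powr (- (a / 2) * real i) * (1 + real i) powr \<bar>real D * b\<bar>)"
  define C2 where "C2 = 2 ^ (CARD('d) + 1) + (\<Sum>i. 2 powr (- (a * \<beta> / 2) * real i))"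
  \<comment> \<open>The first two summands meet the condition on J in
    \<open>sparse_approximation\<close>; the last one makes 2^-(a J / 2) at most V^(-1/\<beta> - a -
    1).\<close>
  define M where "M = 1 + 2 / (a * \<beta>) + 2 / a * (1 / \<beta> + a + 1)"
  define C where "C = 1 + S0 * C3 + K * S + C2 + (M + 1) * 2"
  have S: "0 \<le> S" unfolding S_def using summable_exp_poly[of "a / 2"] a by (intro suminf_nonneg) auto
  have S0: "0 \<le> S0" using S by (simp add: S0_def S_def)
  have K: "0 \<le> K" by (simp add: K_def)
  have C2: "0 \<le> C2" unfolding C2_def using summable_exp_poly[of "a * \<beta> / 2" 0] a \<beta>
    by (intro add_nonneg_nonneg suminf_nonneg) auto
  have M: "1 \<le> M" using a \<beta> by (simp add: M_def)
  have ks: "0 \<le> K * S" "0 \<le> S0 * C3" using K S S0 C3 by auto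
  have C: "1 \<le> C" "S0 * C3 \<le> C" "K * S \<le> C" "C2 \<le> C" "(M + 1) * 2 \<le> C" using ks C2 M by (auto simp: C_def)
  have "\<exists>J. real J \<le> C * ln (2 * V) \<and>
    (\<forall>c :: int ^ 'd \<Rightarrow> complex. (\<forall>j. A_quasinorm \<beta> j c \<le> layer_weight a (real D * b) j) \<longrightarrow>
       sparse_tails C ?r (\<Union>j\<le>J. hyperbolic_layer j) V c)" if V: "1 \<le> V" for V
  proof -
    define J where "J = nat \<lceil>M * log 2 V\<rceil>"
    have log0: "0 \<le> log 2 V" using V by simp
    have MV: "0 \<le> M * log 2 V" using M log0 by simp
    have J: "M * log 2 V \<le> real J" "real J \<le> M * log 2 V + 1" unfolding J_def using MV by linarith+
    have lnV: "2 / 3 \<le> ln (2 * V)"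
    proof -
      have "ln 2 \<le> ln (2 * V)" using V by simp
      thus ?thesis using ln2_ge_two_thirds by linarith
    qed
    have "log 2 V \<le> 2 * ln V"
    proof -
      have "ln V * (1 / ln 2) \<le> ln V * 2" using ln2_ge_two_thirds V by (intro mult_left_mono) (auto simp: divide_le_eq)
      thus ?thesis by (simp add: log_def)
    qed
    also have "\<dots> \<le> 2 * ln (2 * V)" using V by simp
    finally have "M * log 2 V \<le> M * (2 * ln (2 * V))" using M by (intro mult_left_mono) auto
    hence "real J \<le> (M + 1) * 2 * ln (2 * V)" using J(2) lnV by (simp add: algebra_simps)
    also have "\<dots> \<le> C * ln (2 * V)" using C lnV by (intro mult_right_mono) auto
    finally have JC: "real J \<le> C * ln (2 * V)" .
    have "sparse_tails C ?r (\<Union>j\<le>J. hyperbolic_layer j) V c"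
      if c: "\<And>j. A_quasinorm \<beta> j c \<le> layer_weight a (real D * b) j" for c :: "int ^ 'd \<Rightarrow> complex"
      unfolding sparse_tails_def
    proof (intro conjI allI impI)
      fix F :: "(int ^ 'd) set" assume F: "finite F"
      have "(\<Sum>k\<in>F. cmod (c k)) \<le> S0 * 2 powr (- (a / 2) * real 0)"
        unfolding S0_def using F by (intro sum_outside_layers_le[OF a \<beta> c]) auto
      also have "\<dots> \<le> S0 * (C3 * ?r 1)" using C3(2)[of 1] S0 by (intro mult_left_mono) auto
      also have "\<dots> = (S0 * C3) * ?r 1" by simp
      also have "\<dots> \<le> C * ?r 1" using C approx_rate_pos[of 1] by (intro mult_right_mono) (auto simp: less_imp_le)
      finally show "(\<Sum>k\<in>F. cmod (c k)) \<le> C * ?r 1" .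
    next
      fix w and F :: "(int ^ 'd) set" assume w: "1 \<le> w \<and> w \<le> V" and F: "finite F \<and> F \<inter> (\<Union>j\<le>J. hyperbolic_layer j) = {}"
      have "(\<Sum>k\<in>F. cmod (c k)) \<le> S0 * 2 powr (- (a / 2) * real (Suc J))"
        unfolding S0_def using F by (intro sum_outside_layers_le[OF a \<beta> c]) (auto simp: lessThan_Suc_atMost)
      also have "\<dots> \<le> S0 * V powr (- (1 / \<beta>) - a - 1)"
      proof (intro mult_left_mono S0)
        have "2 / a * (1 / \<beta> + a + 1) * log 2 V \<le> M * log 2 V" using log0 a \<beta> by (intro mult_right_mono) (auto simp: M_def)
        also have "\<dots> \<le> real (Suc J)" using J(1) by simp
        finally have "a / 2 * (2 / a * (1 / \<beta> + a + 1) * log 2 V) \<le> a / 2 * real (Suc J)" using a by (intro mult_left_mono) auto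
        moreover have "a / 2 * (2 / a * (1 / \<beta> + a + 1) * log 2 V) = - (log 2 V * (- (1 / \<beta>) - a - 1))"
          using a by (simp add: field_simps)
        ultimately have "- (a / 2) * real (Suc J) \<le> log 2 V * (- (1 / \<beta>) - a - 1)" by linarith
        hence "2 powr (- (a / 2) * real (Suc J)) \<le> 2 powr (log 2 V * (- (1 / \<beta>) - a - 1))" by (intro powr_mono) auto
        also have "\<dots> = V powr (- (1 / \<beta>) - a - 1)" using V by (simp only: powr_powr[symmetric]) simp
        finally show "2 powr (- (a / 2) * real (Suc J)) \<le> V powr (- (1 / \<beta>) - a - 1)" .
      qed
      also have "\<dots> \<le> S0 * w powr (- (1 / \<beta>) - a - 1)"
      proof (intro mult_left_mono powr_mono2' S0)
        have "0 < 1 / \<beta>" using \<beta> by simp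
        thus "- (1 / \<beta>) - a - 1 \<le> 0" using a by linarith
      qed (use w in auto)
      also have "\<dots> \<le> S0 * (C3 * ?r w)" using C3(2) w S0 by (intro mult_left_mono) auto
      also have "\<dots> = (S0 * C3) * ?r w" by simp
      also have "\<dots> \<le> C * ?r w" using C approx_rate_pos[of w] w by (intro mult_right_mono) (auto simp: less_imp_le)
      finally show "(\<Sum>k\<in>F. cmod (c k)) \<le> C * ?r w" .
    next
      fix w assume w: "1 \<le> w \<and> w \<le> V"
      have "log 2 w * (1 + 2 / (a * \<beta>)) \<le> log 2 V * M"
        using w a \<beta> log0 by (intro mult_mono) (auto simp: M_def)
      hence wJ: "log 2 w * (1 + 2 / (a * \<beta>)) \<le> real J" using J(1) by (simp add: mult.commute)
      have "\<exists>T \<subseteq> (\<Union>j\<le>J. hyperbolic_layer j). real (card T) \<le> C2 * w \<and>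
         (\<forall>F. finite F \<and> F \<inter> T = {} \<longrightarrow> (\<Sum>k\<in>F. cmod (c k)) \<le> K * S * w * ?r w) \<and>
         (\<forall>k. k \<notin> T \<longrightarrow> cmod (c k) \<le> K * S * ?r w)"
        unfolding K_def S_def C2_def D_def
      proof (rule sparse_approximation[OF a \<beta>])
        show "A_quasinorm \<beta> j c \<le> layer_weight a (real (CARD('d) - 1) * b) j" for j
          using c[of j] unfolding D_def .
        show "1 \<le> w" using w by simp
        show "log 2 w * (1 + 2 / (a * \<beta>)) \<le> real J" by (rule wJ)
      qed
      then obtain T where T: "T \<subseteq> (\<Union>j\<le>J. hyperbolic_layer j) \<and> real (card T) \<le> C2 * w \<and>
         (\<forall>F. finite F \<and> F \<inter> T = {} \<longrightarrow> (\<Sum>k\<in>F. cmod (c k)) \<le> K * S * w * ?r w) \<and>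
         (\<forall>k. k \<notin> T \<longrightarrow> cmod (c k) \<le> K * S * ?r w)" by (rule exE)
      have r0: "0 \<le> ?r w" using approx_rate_pos[of w] w by (simp add: less_imp_le)
      have le: "C2 * w \<le> C * w" "K * S * w * ?r w \<le> C * w * ?r w" "K * S * ?r w \<le> C * ?r w"
        using C w r0 by (intro mult_right_mono; simp)+
      show "\<exists>T\<subseteq>(\<Union>j\<le>J. hyperbolic_layer j). real (card T) \<le> C * w \<and>
           (\<forall>F. finite F \<and> F \<inter> T = {} \<longrightarrow> (\<Sum>k\<in>F. cmod (c k)) \<le> C * w * ?r w) \<and>
           (\<forall>k. k \<notin> T \<longrightarrow> cmod (c k) \<le> C * ?r w)"
      proof (intro exI[of _ T] conjI allI impI)
        show "T \<subseteq> (\<Union>j\<le>J. hyperbolic_layer j)" using T by (rule conjunct1)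
        show "real (card T) \<le> C * w" using T le(1) by linarith
        show "(\<Sum>k\<in>F. cmod (c k)) \<le> C * w * ?r w" if "finite F \<and> F \<inter> T = {}" for F
          using T that le(2) order_trans by metis
        show "cmod (c k) \<le> C * ?r w" if "k \<notin> T" for k
          using T that le(3) order_trans by metis
      qed
    qed
    with JC show ?thesis by blast
  qed
  with C(1) show ?thesis by blast
qed

section \<open>Orthogonal matching pursuit\<close>

lemma L2_inner_empirical:
  "\<xi> \<noteq> [] \<Longrightarrow> L2_inner (empirical_measure \<xi>) f g = (\<Sum>x\<leftarrow>\<xi>. f x * cnj (g x)) /\<^sub>R real (length \<xi>)"
  by (simp add: L2_inner_def integral_empirical_measure)

context
  fixes \<xi> :: "'x list" assumes \<xi>: "\<xi> \<noteq> []"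
begin

abbreviation (input) "ip \<equiv> L2_inner (empirical_measure \<xi>)"
abbreviation (input) "sq \<equiv> \<lambda>f :: 'x \<Rightarrow> complex. avg \<xi> (\<lambda>x. (cmod (f x))\<^sup>2)"

section \<open>Projections and a single greedy step in the empirical inner product\<close>

lemma inner_sum_right: "ip f (\<lambda>x. \<Sum>k\<in>K. c k * \<phi> k x) = (\<Sum>k\<in>K. cnj (c k) * ip f (\<phi> k))"
proof -
  have "(\<Sum>x\<leftarrow>\<xi>. f x * cnj (\<Sum>k\<in>K. c k * \<phi> k x)) = (\<Sum>k\<in>K. cnj (c k) * (\<Sum>x\<leftarrow>\<xi>. f x * cnj (\<phi> k x)))"
    by (induction \<xi>) (simp_all add: sum_distrib_left sum.distrib distrib_left mult_ac)
  thus ?thesis using \<xi> by (simp add: L2_inner_empirical scaleR_sum_right)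
qed

lemma sq_diff: "sq (\<lambda>x. f x - g x) = sq f + sq g - 2 * Re (ip f g)"
proof -
  have eq: "(\<Sum>x\<leftarrow>\<xi>. (cmod (f x - g x))\<^sup>2)
      = (\<Sum>x\<leftarrow>\<xi>. (cmod (f x))\<^sup>2) + (\<Sum>x\<leftarrow>\<xi>. (cmod (g x))\<^sup>2) - 2 * Re (\<Sum>x\<leftarrow>\<xi>. f x * cnj (g x))"
    unfolding cmod_power2 by (induction \<xi>) (simp_all add: power2_eq_square algebra_simps)
  show ?thesis using \<xi> unfolding avg_def eq
    by (simp add: L2_inner_empirical diff_divide_distrib add_divide_distrib) (simp add: divide_inverse)
qed

lemma orth_proj_minimal:
  assumes "is_orth_proj (empirical_measure \<xi>) (range (lin_comb \<psi> K)) f G" "G' \<in> range (lin_comb \<psi> K)"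
  shows "sq (\<lambda>x. f x - G x) \<le> sq (\<lambda>x. f x - G' x)"
proof -
  obtain a b where G: "G = lin_comb \<psi> K a" "G' = lin_comb \<psi> K b"
    using assms unfolding is_orth_proj_def by blast
  define H where "H = (\<lambda>x. G' x - G x)"
  have "H = lin_comb \<psi> K (\<lambda>k. b k - a k)"
    by (simp add: H_def G lin_comb_def sum_subtractf left_diff_distrib)
  hence "ip (\<lambda>x. f x - G x) H = 0" using assms unfolding is_orth_proj_def by blast
  hence "sq (\<lambda>x. (f x - G x) - H x) = sq (\<lambda>x. f x - G x) + sq H" unfolding sq_diff by simp
  moreover have "(f x - G x) - H x = f x - G' x" for x by (simp add: H_def)
  moreover have "0 \<le> sq H" by (intro avg_nonneg) auto
  ultimately show ?thesis by simp
qed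

text \<open>The larger span contains the old projection plus the correlation times the new element,
  and norm at most 1 makes this competitor gain the squared correlation. Its coefficients are
  written as a sum of two functions so that a repeated selection is covered.\<close>

lemma greedy_step_gain:
  assumes G: "is_orth_proj (empirical_measure \<xi>) (range (lin_comb \<psi> K)) f G"
    and G': "is_orth_proj (empirical_measure \<xi>) (range (lin_comb \<psi> (insert k K))) f G'"
    and K: "finite K" and \<psi>: "sq (\<psi> k) \<le> 1"
  shows "sq (\<lambda>x. f x - G' x) \<le> sq (\<lambda>x. f x - G x) - (cmod (ip (\<lambda>x. f x - G x) (\<psi> k)))\<^sup>2"
proof -
  define \<theta> where "\<theta> = ip (\<lambda>x. f x - G x) (\<psi> k)"
  obtain a where a: "G = lin_comb \<psi> K a" using G unfolding is_orth_proj_def by blast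
  have "lin_comb \<psi> (insert k K) (\<lambda>j. (if j \<in> K then a j else 0) + (if j = k then \<theta> else 0)) = (\<lambda>x. G x + \<theta> * \<psi> k x)"
  proof
    fix x
    have "(\<Sum>j\<in>insert k K. (if j \<in> K then a j else 0) * \<psi> j x) = (\<Sum>j\<in>K. a j * \<psi> j x)"
      using K by (intro sum.mono_neutral_cong_right) auto
    moreover have "(\<Sum>j\<in>insert k K. (if j = k then \<theta> else 0) * \<psi> j x) = \<theta> * \<psi> k x"
      using K by (subst sum.mono_neutral_right[of _ "{k}"]) auto
    ultimately show "lin_comb \<psi> (insert k K) (\<lambda>j. (if j \<in> K then a j else 0) + (if j = k then \<theta> else 0)) x = G x + \<theta> * \<psi> k x"
      unfolding lin_comb_def a distrib_right sum.distrib by (simp only:)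
  qed
  hence "(\<lambda>x. G x + \<theta> * \<psi> k x) \<in> range (lin_comb \<psi> (insert k K))" 
    by (rule range_eqI[OF sym, where f = "lin_comb \<psi> (insert k K)"])
  hence "sq (\<lambda>x. f x - G' x) \<le> sq (\<lambda>x. (f x - G x) - \<theta> * \<psi> k x)"
    using orth_proj_minimal[OF G'] by (simp add: diff_diff_eq)
  also have "\<dots> = sq (\<lambda>x. f x - G x) + sq (\<lambda>x. \<theta> * \<psi> k x) - 2 * Re (ip (\<lambda>x. f x - G x) (\<lambda>x. \<theta> * \<psi> k x))"
    by (rule sq_diff)
  also have "ip (\<lambda>x. f x - G x) (\<lambda>x. \<theta> * \<psi> k x) = cnj \<theta> * \<theta>"
    using inner_sum_right[of "\<lambda>x. f x - G x" "\<lambda>_. \<theta>" \<psi> "{k}"] by (simp add: \<theta>_def)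
  also have "Re (cnj \<theta> * \<theta>) = (cmod \<theta>)\<^sup>2" unfolding cmod_power2 by (simp add: power2_eq_square)
  also have "sq (\<lambda>x. \<theta> * \<psi> k x) = (cmod \<theta>)\<^sup>2 * sq (\<psi> k)" by (simp add: norm_mult power_mult_distrib avg_cmult)
  finally show ?thesis using mult_left_mono[OF \<psi>, of "(cmod \<theta>)\<^sup>2"] by (simp add: \<theta>_def)
qed

text \<open>Let h be the T-sparse competitor, F the residual and H = h - G. As F is orthogonal to
  the selected elements, only indices in T - K contribute, and Cauchy-Schwarz with the lower Riesz
  bound gives Re <F, H> \<le> s sqrt (N / A) ||H||. In ||F - H||^2 = ||F||^2 + ||H||^2 - 2 Re <F, H>
  the arithmetic-geometric mean inequality then cancels ||H||^2. Only the sparsity of h enters, not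
  the size of its coefficients.\<close>

lemma greedy_correlation_bound:
  assumes G: "is_orth_proj (empirical_measure \<xi>) (range (lin_comb \<psi> K)) f G"
    and K: "finite K" and T: "finite T" "real (card T) \<le> N"
    and A: "0 < A" "\<And>z. A * (\<Sum>k\<in>T \<union> K. (cmod (z k))\<^sup>2) \<le> sq (lin_comb \<psi> (T \<union> K) z)"
    and s: "\<And>k. k \<in> T \<Longrightarrow> cmod (ip (\<lambda>x. f x - G x) (\<psi> k)) \<le> s" "0 \<le> s"
  shows "A * (sq (\<lambda>x. f x - G x) - sq (\<lambda>x. f x - lin_comb \<psi> T c x)) \<le> N * s\<^sup>2"
proof -
  define F where "F = (\<lambda>x. f x - G x)"
  obtain a where a: "G = lin_comb \<psi> K a" using G unfolding is_orth_proj_def by blast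
  define z where "z = (\<lambda>k. (if k \<in> T then c k else 0) - (if k \<in> K then a k else 0))"
  define H where "H = lin_comb \<psi> (T \<union> K) z"
  have ext: "(\<Sum>k\<in>T \<union> K. (if k \<in> T then c k else 0) * \<psi> k x) = lin_comb \<psi> T c x"
    "(\<Sum>k\<in>T \<union> K. (if k \<in> K then a k else 0) * \<psi> k x) = G x" for x
    unfolding lin_comb_def a using T K by (auto intro!: sum.mono_neutral_cong_right)
  have H: "H x = lin_comb \<psi> T c x - G x" for x
    unfolding ext[symmetric] by (simp add: H_def z_def lin_comb_def left_diff_distrib sum_subtractf)
  hence "sq (\<lambda>x. f x - lin_comb \<psi> T c x) = sq (\<lambda>x. F x - H x)" by (simp add: F_def)
  hence expand: "sq (\<lambda>x. f x - lin_comb \<psi> T c x) = sq F + sq H - 2 * Re (ip F H)" by (simp add: sq_diff)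
  have orth: "ip F (\<psi> k) = 0" if "k \<in> K" for k
  proof -
    have "lin_comb \<psi> K (\<lambda>j. if j = k then 1 else 0) = \<psi> k"
    proof
      fix x
      show "lin_comb \<psi> K (\<lambda>j. if j = k then 1 else 0) x = \<psi> k x"
        unfolding lin_comb_def using K that by (subst sum.mono_neutral_right[of _ "{k}"]) auto
    qed
    hence "\<psi> k \<in> range (lin_comb \<psi> K)" 
      by (rule range_eqI[OF sym, where f = "lin_comb \<psi> K"])
    thus ?thesis using G unfolding is_orth_proj_def F_def by blast
  qed
  have "ip F H = (\<Sum>k\<in>T \<union> K. cnj (z k) * ip F (\<psi> k))"
    unfolding H_def lin_comb_def by (rule inner_sum_right)
  also have "\<dots> = (\<Sum>k\<in>T - K. cnj (z k) * ip F (\<psi> k))"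
    using T K orth by (intro sum.mono_neutral_right) auto
  also have "cmod \<dots> \<le> (\<Sum>k\<in>T - K. cmod (z k) * cmod (ip F (\<psi> k)))"
    by (rule order_trans[OF norm_sum]) (simp add: norm_mult)
  also have "\<dots> \<le> (\<Sum>k\<in>T - K. cmod (z k) * s)"
    using s by (intro sum_mono mult_left_mono) (auto simp: F_def)
  also have "\<dots> = s * (\<Sum>k\<in>T - K. cmod (z k) * 1)" by (simp add: sum_distrib_left mult_ac)
  finally have c1: "cmod (ip F H) \<le> s * (\<Sum>k\<in>T - K. cmod (z k) * 1)" .
  have "(\<Sum>k\<in>T - K. cmod (z k) * 1)\<^sup>2 \<le> (\<Sum>k\<in>T - K. (cmod (z k))\<^sup>2) * (\<Sum>k\<in>T - K. 1\<^sup>2)"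
    by (rule Cauchy_Schwarz_ineq_sum)
  also have "\<dots> \<le> (\<Sum>k\<in>T \<union> K. (cmod (z k))\<^sup>2) * N"
  proof (intro mult_mono)
    have "real (card (T - K)) \<le> real (card T)" using T by (simp add: card_mono)
    thus "(\<Sum>k\<in>T - K. 1\<^sup>2) \<le> N" using T by simp
    show "(\<Sum>k\<in>T - K. (cmod (z k))\<^sup>2) \<le> (\<Sum>k\<in>T \<union> K. (cmod (z k))\<^sup>2)" using T K by (intro sum_mono2) auto
  qed (auto intro!: sum_nonneg)
  finally have c2: "A * (\<Sum>k\<in>T - K. cmod (z k) * 1)\<^sup>2 \<le> N * sq H"
  proof -
    assume le: "(\<Sum>k\<in>T - K. cmod (z k) * 1)\<^sup>2 \<le> (\<Sum>k\<in>T \<union> K. (cmod (z k))\<^sup>2) * N"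
    have N0: "0 \<le> N" by (rule order_trans[OF of_nat_0_le_iff T(2)])
    have "A * (\<Sum>k\<in>T - K. cmod (z k) * 1)\<^sup>2 \<le> A * ((\<Sum>k\<in>T \<union> K. (cmod (z k))\<^sup>2) * N)"
      using le A(1) by (intro mult_left_mono) auto
    also have "\<dots> = N * (A * (\<Sum>k\<in>T \<union> K. (cmod (z k))\<^sup>2))" by simp
    also have "\<dots> \<le> N * sq H" unfolding H_def using N0 by (intro mult_left_mono A(2))
    finally show ?thesis .
  qed
  define q where "q = (\<Sum>k\<in>T - K. cmod (z k) * 1)"
  have N0: "0 \<le> N" by (rule order_trans[OF of_nat_0_le_iff T(2)])
  \<comment> \<open>The mean inequality comes from (N s - A q)^2 / N \<ge> 0; N = 0, where q
    vanishes, is split off because of the division.\<close>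
  have "A * (2 * Re (ip F H)) \<le> N * s\<^sup>2 + A * sq H"
  proof (cases "N = 0")
    case True
    hence "A * q\<^sup>2 \<le> 0" using c2 by (simp add: q_def)
    hence "q = 0" using A(1) by (simp add: mult_le_0_iff)
    hence "Re (ip F H) \<le> 0" using c1 complex_Re_le_cmod[of "ip F H"] by (simp add: q_def)
    moreover have "0 \<le> sq H" by (intro avg_nonneg) auto
    ultimately show ?thesis using A(1) True by (simp add: mult_nonneg_nonpos order_trans[of _ 0])
  next
    case False
    hence N: "0 < N" using N0 by simp
    have "A * (2 * Re (ip F H)) \<le> A * (2 * (s * q))"
      using c1 complex_Re_le_cmod[of "ip F H"] A(1) by (simp add: q_def)
    also have "\<dots> \<le> N * s\<^sup>2 + A * (A * q\<^sup>2 / N)"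
    proof -
      have "0 \<le> (N * s - A * q)\<^sup>2 / N" using N by simp
      also have "\<dots> = N * s\<^sup>2 + A * (A * q\<^sup>2 / N) - A * (2 * (s * q))"
        using N by (simp add: power2_eq_square field_simps)
      finally show ?thesis by simp
    qed
    also have "A * q\<^sup>2 / N \<le> sq H" using c2 N by (simp add: q_def field_simps)
    hence "N * s\<^sup>2 + A * (A * q\<^sup>2 / N) \<le> N * s\<^sup>2 + A * sq H"
      using A(1) by (intro add_left_mono mult_left_mono) auto
    finally show ?thesis .
  qed
  moreover have "sq (\<lambda>x. f x - G x) = sq F" by (simp add: F_def)
  ultimately show ?thesis unfolding expand by (simp add: algebra_simps)
qed

section \<open>Contraction of the residual along a run\<close>

lemma womp_residual_proj:
  assumes run: "womp_run (empirical_measure \<xi>) \<psi> Q t f0 s \<kappa> f" and n: "n \<le> s"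
  shows "\<exists>G. is_orth_proj (empirical_measure \<xi>) (range (lin_comb \<psi> (\<kappa> ` {1..n}))) f0 G \<and> f n = (\<lambda>x. f0 x - G x)"
proof (cases "n = 0")
  case True
  have "lin_comb \<psi> {} = (\<lambda>_ _. 0)" by (auto simp: lin_comb_def)
  hence "is_orth_proj (empirical_measure \<xi>) (range (lin_comb \<psi> {})) f0 (\<lambda>x. 0)"
    by (auto simp: is_orth_proj_def L2_inner_def)
  thus ?thesis using True run by (intro exI[of _ "\<lambda>x. 0"]) (simp add: womp_run_def)
next
  case False
  thus ?thesis using run n by (auto simp: womp_run_def)
qed

text \<open>By the selection rule the gain is at least t^2 \<sigma>^2 for the largest correlation
  \<sigma>, and \<sigma>^2 is at least A / N times the excess over e. Monotonicity is recorded
  separately because the contraction may be void once the residual is below e.\<close>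

lemma womp_step:
  assumes run: "womp_run (empirical_measure \<xi>) \<psi> Q t f0 s \<kappa> f" and n: "n < s" and t: "0 < t"
    and Q: "finite Q" "\<And>k. k \<in> Q \<Longrightarrow> sq (\<psi> k) \<le> 1"
    and T: "T \<subseteq> Q" "real (card T) \<le> N" "0 < N"
    and A: "0 < A" "\<And>U z. U \<subseteq> Q \<Longrightarrow> card U \<le> u \<Longrightarrow> A * (\<Sum>k\<in>U. (cmod (z k))\<^sup>2) \<le> sq (lin_comb \<psi> U z)"
    and u: "card T + s \<le> u"
    and e: "sq (\<lambda>x. f0 x - lin_comb \<psi> T c x) \<le> e"
  shows "sq (f (Suc n)) \<le> sq (f n)" "sq (f (Suc n)) - e \<le> (1 - t\<^sup>2 * A / N) * (sq (f n) - e)"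
proof -
  let ?K = "\<kappa> ` {1..n}"
  obtain G where G: "is_orth_proj (empirical_measure \<xi>) (range (lin_comb \<psi> ?K)) f0 G" "f n = (\<lambda>x. f0 x - G x)"
    using womp_residual_proj[OF run, of n] n by auto
  have "\<kappa> ` {1..Suc n} = insert (\<kappa> (Suc n)) ?K" by (simp add: atLeastAtMostSuc_conv)
  then obtain G' where G': "is_orth_proj (empirical_measure \<xi>) (range (lin_comb \<psi> (insert (\<kappa> (Suc n)) ?K))) f0 G'"
     "f (Suc n) = (\<lambda>x. f0 x - G' x)"
    using womp_residual_proj[OF run, of "Suc n"] n by auto
  have \<kappa>Q: "\<kappa> j \<in> Q" if "j \<in> {1..s}" for j using run that by (auto simp: womp_run_def)
  define \<sigma> where "\<sigma> = (SUP k\<in>Q. cmod (ip (f n) (\<psi> k)))"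
  have \<sigma>: "cmod (ip (f n) (\<psi> k)) \<le> \<sigma>" if "k \<in> Q" for k
    unfolding \<sigma>_def using that Q(1) by (intro cSUP_upper) auto
  have pick: "t * \<sigma> \<le> cmod (ip (f n) (\<psi> (\<kappa> (Suc n))))"
    using run n by (auto simp: womp_run_def \<sigma>_def dest!: bspec[where x = "Suc n"])
  have Suc_Q: "\<kappa> (Suc n) \<in> Q" using \<kappa>Q n by simp
  have \<sigma>0: "0 \<le> \<sigma>" using \<sigma>[OF Suc_Q] norm_ge_zero order_trans by blast
  have gain: "sq (f (Suc n)) \<le> sq (f n) - (cmod (ip (f n) (\<psi> (\<kappa> (Suc n)))))\<^sup>2"
    using greedy_step_gain[OF G(1) G'(1) _ Q(2)[OF Suc_Q]] unfolding G(2) G'(2) by simp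
  thus "sq (f (Suc n)) \<le> sq (f n)" by (rule order_trans) simp
  have "(t * \<sigma>)\<^sup>2 \<le> (cmod (ip (f n) (\<psi> (\<kappa> (Suc n)))))\<^sup>2" using pick t \<sigma>0 by (intro power_mono) auto
  with gain have g1: "sq (f (Suc n)) \<le> sq (f n) - t\<^sup>2 * \<sigma>\<^sup>2" by (simp add: power_mult_distrib)
  have finT: "finite T" using T(1) Q(1) finite_subset by blast
  have "A * (sq (f n) - sq (\<lambda>x. f0 x - lin_comb \<psi> T c x)) \<le> N * \<sigma>\<^sup>2"
    unfolding G(2)
  proof (rule greedy_correlation_bound[OF G(1) _ finT T(2) A(1)])
    show "A * (\<Sum>k\<in>T \<union> ?K. (cmod (z k))\<^sup>2) \<le> sq (lin_comb \<psi> (T \<union> ?K) z)" for z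
    proof (rule A(2))
      show "T \<union> ?K \<subseteq> Q" using T(1) \<kappa>Q n by auto
      have "card (T \<union> ?K) \<le> card T + card ?K" by (rule card_Un_le)
      also have "card ?K \<le> n" using card_image_le[of "{1..n}" \<kappa>] by simp
      finally show "card (T \<union> ?K) \<le> u" using u n by simp
    qed
    show "cmod (ip (\<lambda>x. f0 x - G x) (\<psi> k)) \<le> \<sigma>" if "k \<in> T" for k using \<sigma>[of k] that T(1) unfolding G(2) by auto
  qed (use \<sigma>0 in auto)
  moreover have "A * (sq (f n) - e) \<le> A * (sq (f n) - sq (\<lambda>x. f0 x - lin_comb \<psi> T c x))"
    using e A(1) by simp
  ultimately have "A / N * (sq (f n) - e) \<le> \<sigma>\<^sup>2" using T(3) by (simp add: field_simps)
  hence "t\<^sup>2 * (A / N * (sq (f n) - e)) \<le> t\<^sup>2 * \<sigma>\<^sup>2" by (intro mult_left_mono) auto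
  with g1 show "sq (f (Suc n)) - e \<le> (1 - t\<^sup>2 * A / N) * (sq (f n) - e)" by (simp add: algebra_simps)
qed

lemma womp_iterate:
  assumes run: "womp_run (empirical_measure \<xi>) \<psi> Q t f0 s \<kappa> f" and n: "n + r \<le> s" and t: "0 < t"
    and Q: "finite Q" "\<And>k. k \<in> Q \<Longrightarrow> sq (\<psi> k) \<le> 1"
    and T: "T \<subseteq> Q" "real (card T) \<le> N" "0 < N"
    and A: "0 < A" "\<And>U z. U \<subseteq> Q \<Longrightarrow> card U \<le> u \<Longrightarrow> A * (\<Sum>k\<in>U. (cmod (z k))\<^sup>2) \<le> sq (lin_comb \<psi> U z)"
    and u: "card T + s \<le> u"
    and e: "sq (\<lambda>x. f0 x - lin_comb \<psi> T c x) \<le> e"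
  shows "sq (f (n + r)) \<le> e + exp (- (t\<^sup>2 * A / N) * real r) * sq (f n)"
proof -
  let ?q = "t\<^sup>2 * A / N"
  have e0: "0 \<le> e" using e by (rule order_trans[rotated]) (auto intro: avg_nonneg)
  have sq0: "0 \<le> sq g" for g by (intro avg_nonneg) auto
  have "sq (f (n + r)) - e \<le> exp (- ?q * real r) * sq (f n)" using n
  proof (induction r)
    case (Suc r)
    note step = womp_step[OF run _ t Q T A u e, of "n + r"]
    show ?case
    proof (cases "sq (f (n + r)) \<le> e")
      case True
      hence "sq (f (n + Suc r)) - e \<le> 0" using step(1) Suc.prems by simp
      also have "\<dots> \<le> exp (- ?q * real (Suc r)) * sq (f n)" using sq0 by simp
      finally show ?thesis .
    next
      case False
      have "sq (f (n + Suc r)) - e \<le> (1 - ?q) * (sq (f (n + r)) - e)" using step(2) Suc.prems by simp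
      also have "\<dots> \<le> exp (- ?q) * (sq (f (n + r)) - e)"
        using False exp_ge_add_one_self[of "- ?q"] by (intro mult_right_mono) auto
      also have "\<dots> \<le> exp (- ?q) * (exp (- ?q * real r) * sq (f n))" using Suc by (intro mult_left_mono) auto
      also have "\<dots> = exp (- ?q * real (Suc r)) * sq (f n)"
      proof -
        have "- ?q * real (Suc r) = - ?q + - ?q * real r" by (simp add: distrib_left)
        thus ?thesis by (simp only: exp_add mult.assoc)
      qed
      finally show ?thesis .
    qed
  qed (use e0 in simp)
  thus ?thesis by simp
qed

text \<open>Stage \<open>i\<close> spends \<open>N0 2^i\<close> iterations competing with the \<open>2^i\<close>-sparse approximant; since
  consecutive approximation errors differ by a bounded factor, the total number of iterations
  stays proportional to the final sparsity and no logarithm is lost.\<close>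

lemma womp_stages:
  assumes run: "womp_run (empirical_measure \<xi>) \<psi> Q t f0 (N0 * (2 ^ Suc l - 2)) \<kappa> f" and t: "0 < t"
    and Q: "finite Q" "\<And>k. k \<in> Q \<Longrightarrow> sq (\<psi> k) \<le> 1"
    and A: "0 < A" "\<And>U z. U \<subseteq> Q \<Longrightarrow> card U \<le> u \<Longrightarrow> A * (\<Sum>k\<in>U. (cmod (z k))\<^sup>2) \<le> sq (lin_comb \<psi> U z)"
    and T: "\<And>i. i \<le> l \<Longrightarrow> T i \<subseteq> Q" "\<And>i. i \<le> l \<Longrightarrow> real (card (T i)) \<le> B * 2 ^ i" "0 < B"
    and u: "\<And>i. i \<le> l \<Longrightarrow> card (T i) + N0 * (2 ^ Suc l - 2) \<le> u"
    and e: "\<And>i. i \<le> l \<Longrightarrow> sq (\<lambda>x. f0 x - lin_comb \<psi> (T i) c x) \<le> e i" "sq f0 \<le> 2 * e 0"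
    and decay: "\<And>i. i < l \<Longrightarrow> exp (- (t\<^sup>2 * A / B) * real N0) * (2 * e i) \<le> e (Suc i)"
  shows "sq (f (N0 * (2 ^ Suc l - 2))) \<le> 2 * e l"
proof -
  \<comment> \<open>N0 (2^(i+1) - 2) is the sum of N0 2^j over 1 \<le> j \<le> i: stage 0 takes no
    iteration, its bound being the assumption \<open>sq f0 \<le> 2 * e 0\<close>.\<close>
  have "sq (f (N0 * (2 ^ Suc i - 2))) \<le> 2 * e i" if "i \<le> l" for i using that
  proof (induction i)
    case 0
    thus ?case using e(2) run by (simp add: womp_run_def)
  next
    case (Suc i)
    have ge2: "(2::nat) \<le> 2 ^ Suc i" by simp
    have eq: "N0 * (2 ^ Suc i - 2) + N0 * 2 ^ Suc i = N0 * (2 ^ Suc (Suc i) - 2)"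
      using ge2 by (simp only: distrib_left[symmetric]) simp
    have "(2::nat) ^ Suc (Suc i) \<le> 2 ^ Suc l" using Suc.prems by (intro power_increasing) auto
    hence le: "N0 * (2 ^ Suc i - 2) + N0 * 2 ^ Suc i \<le> N0 * (2 ^ Suc l - 2)"
      unfolding eq by (intro mult_le_mono2 diff_le_mono)
    have "sq (f (N0 * (2 ^ Suc i - 2) + N0 * 2 ^ Suc i))
       \<le> e (Suc i) + exp (- (t\<^sup>2 * A / (B * 2 ^ Suc i)) * real (N0 * 2 ^ Suc i)) * sq (f (N0 * (2 ^ Suc i - 2)))"
      using T(3) by (intro womp_iterate[OF run le t Q T(1)[OF Suc.prems] T(2)[OF Suc.prems] _ A u[OF Suc.prems] e(1)[OF Suc.prems]]) auto
    \<comment> \<open>The length of the stage cancels the sparsity in the contraction rate, so every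
      stage gains the same factor.\<close>
    also have "- (t\<^sup>2 * A / (B * 2 ^ Suc i)) * real (N0 * 2 ^ Suc i) = - (t\<^sup>2 * A / B) * real N0"
      by simp
    also have "exp (- (t\<^sup>2 * A / B) * real N0) * sq (f (N0 * (2 ^ Suc i - 2))) \<le> exp (- (t\<^sup>2 * A / B) * real N0) * (2 * e i)"
      using Suc by (intro mult_left_mono) auto
    also have "\<dots> \<le> e (Suc i)" using Suc.prems by (intro decay) auto
    finally show ?case unfolding eq by simp
  qed
  thus ?thesis by blast
qed

end

section \<open>Recovery from samples\<close>

lemma has_sum_minus_finite_sum_le:
  fixes g :: "'k \<Rightarrow> complex"
  assumes "(g has_sum s) UNIV" "finite Q" "\<And>F. finite F \<Longrightarrow> F \<inter> Q = {} \<Longrightarrow> (\<Sum>k\<in>F. cmod (g k)) \<le> B"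
  shows "cmod (s - (\<Sum>k\<in>Q. g k)) \<le> B"
proof -
  have "((\<lambda>F. (\<Sum>k\<in>F. g k) - (\<Sum>k\<in>Q. g k)) \<longlongrightarrow> s - (\<Sum>k\<in>Q. g k)) (finite_subsets_at_top UNIV)"
    using assms(1) unfolding has_sum_def by (intro tendsto_intros)
  hence lim: "((\<lambda>F. cmod ((\<Sum>k\<in>F. g k) - (\<Sum>k\<in>Q. g k))) \<longlongrightarrow> cmod (s - (\<Sum>k\<in>Q. g k))) (finite_subsets_at_top UNIV)"
    by (rule tendsto_norm)
  have "\<forall>\<^sub>F F in finite_subsets_at_top UNIV. cmod ((\<Sum>k\<in>F. g k) - (\<Sum>k\<in>Q. g k)) \<le> B"
    unfolding eventually_finite_subsets_at_top
  proof (intro exI[of _ Q] conjI allI impI)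
    fix F :: "'k set" assume F: "finite F \<and> Q \<subseteq> F \<and> F \<subseteq> UNIV"
    have "(\<Sum>k\<in>F. g k) - (\<Sum>k\<in>Q. g k) = (\<Sum>k\<in>F - Q. g k)" using F by (simp add: sum_diff)
    also have "cmod \<dots> \<le> (\<Sum>k\<in>F - Q. cmod (g k))" by (rule norm_sum)
    also have "\<dots> \<le> B" using F by (intro assms(3)) auto
    finally show "cmod ((\<Sum>k\<in>F. g k) - (\<Sum>k\<in>Q. g k)) \<le> B" .
  qed (use assms(2) in auto)
  thus ?thesis by (intro tendsto_upperbound[OF lim]) auto
qed

text \<open>Interpolation |f|^p \<le> B^(p-2) |f|^2, where F is measured in mean square and the
  remainder \<rho> pointwise.\<close>

lemma (in prob_space) Lp_norm_le_of_bounds: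
  fixes f F \<rho> :: "'a \<Rightarrow> complex"
  assumes p: "2 \<le> p" and f: "\<And>x. x \<in> space M \<Longrightarrow> f x = F x + \<rho> x"
    and B: "\<And>x. x \<in> space M \<Longrightarrow> cmod (f x) \<le> B" and e: "\<And>x. x \<in> space M \<Longrightarrow> cmod (\<rho> x) \<le> e"
    and F: "integrable M (\<lambda>x. (cmod (F x))\<^sup>2)"
  shows "Lp_norm p M f \<le> (B powr (p - 2) * (2 * (LINT x|M. (cmod (F x))\<^sup>2) + 2 * e\<^sup>2)) powr (1 / p)"
proof -
  have "(LINT x|M. cmod (f x) powr p) \<le> (LINT x|M. B powr (p - 2) * (2 * (cmod (F x))\<^sup>2 + 2 * e\<^sup>2))"
  \<comment> \<open>This rule asks for integrability of the majorant only: a left-hand side that is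
    not integrable has integral 0.\<close>
  proof (rule integral_mono')
    show "integrable M (\<lambda>x. B powr (p - 2) * (2 * (cmod (F x))\<^sup>2 + 2 * e\<^sup>2))" using F by auto
    fix x assume x: "x \<in> space M"
    show "cmod (f x) powr p \<le> B powr (p - 2) * (2 * (cmod (F x))\<^sup>2 + 2 * e\<^sup>2)"
    proof (cases "f x = 0")
      case False
      have "cmod (f x) powr ((p - 2) + 2) = cmod (f x) powr (p - 2) * cmod (f x) powr 2" by (rule powr_add)
      hence "cmod (f x) powr p = cmod (f x) powr (p - 2) * (cmod (f x))\<^sup>2" using False by simp
      also have "\<dots> \<le> B powr (p - 2) * (2 * (cmod (F x))\<^sup>2 + 2 * e\<^sup>2)"
      proof (intro mult_mono powr_mono2)
        have "(cmod (f x))\<^sup>2 \<le> (cmod (F x) + cmod (\<rho> x))\<^sup>2" unfolding f[OF x] by (intro power_mono norm_triangle_ineq) auto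
        also have "\<dots> \<le> (cmod (F x) + e)\<^sup>2" using e[OF x] by (intro power_mono) auto
        also have "\<dots> \<le> 2 * (cmod (F x))\<^sup>2 + 2 * e\<^sup>2"
          using zero_le_power2[of "cmod (F x) - e"] by (simp add: power2_eq_square algebra_simps)
        finally show "(cmod (f x))\<^sup>2 \<le> 2 * (cmod (F x))\<^sup>2 + 2 * e\<^sup>2" .
      qed (use p B[OF x] in auto)
      finally show ?thesis .
    qed auto
  qed auto
  also have "\<dots> = B powr (p - 2) * (2 * (LINT x|M. (cmod (F x))\<^sup>2) + 2 * e\<^sup>2)" using F by (simp add: prob_space)
  finally show ?thesis unfolding Lp_norm_def using p by (intro powr_mono2) auto
qed

lemma sum_squares_le:
  fixes c :: "'k \<Rightarrow> complex"
  assumes "\<And>k. k \<in> S \<Longrightarrow> cmod (c k) \<le> B" "(\<Sum>k\<in>S. cmod (c k)) \<le> A" "0 \<le> B"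
  shows "(\<Sum>k\<in>S. (cmod (c k))\<^sup>2) \<le> B * A"
proof -
  have "(\<Sum>k\<in>S. (cmod (c k))\<^sup>2) \<le> (\<Sum>k\<in>S. B * cmod (c k))"
    unfolding power2_eq_square by (intro sum_mono mult_right_mono assms(1)) auto
  also have "\<dots> = B * (\<Sum>k\<in>S. cmod (c k))" by (simp add: sum_distrib_left)
  also have "\<dots> \<le> B * A" using assms by (intro mult_left_mono)
  finally show ?thesis .
qed

lemma lin_comb_restrict:
  assumes "finite Q" "U \<subseteq> Q"
  shows "lin_comb \<psi> U z = lin_comb \<psi> Q (\<lambda>k. if k \<in> U then z k else 0)"
  unfolding lin_comb_def using assms by (intro ext sum.mono_neutral_cong_left) auto

text \<open>102 = 2 * 51: the remainder inside \<open>Q\<close> contributes 51 R2^2 and the tail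
  outside \<open>Q\<close> contributes 1; squaring the sum doubles both.\<close>

definition approx_const :: "real \<Rightarrow> real \<Rightarrow> real" where
  "approx_const R2 C = C\<^sup>2 * (102 * R2\<^sup>2 + 2)"

text \<open>The constant of the supremum bound to the power p - 2 times that of the mean-square
  bound, as they arise in \<open>Lp_error_le\<close>. Its dependence on R1, R2 and K is removed
  later by \<open>absorb_constant\<close>.\<close>

definition recovery_const :: "real \<Rightarrow> real \<Rightarrow> real \<Rightarrow> real \<Rightarrow> real \<Rightarrow> real" where
  "recovery_const R1 R2 K C p =
     ((2 * C + sqrt (600 * K * approx_const R2 C) / R1) powr (p - 2) *
      (R2\<^sup>2 * (4 * C\<^sup>2 + 2400 * approx_const R2 C / R1\<^sup>2) + 2 * C\<^sup>2)) powr (1 / p)"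

text \<open>K V is the sparsity up to which samples determine coefficients stably; it must hold the
  support of the recovered function together with that of an approximant. The condition on
  \<epsilon> leaves half of the lower Riesz bound.\<close>

locale sampled_riesz_system = prob_space \<mu>
  for \<mu> :: "'x::topological_space measure" +
  fixes \<Omega> :: "'x set" and \<psi> :: "'k \<Rightarrow> 'x \<Rightarrow> complex" and \<xi> :: "'x list" and Q :: "'k set"
    and R1 R2 \<epsilon> K V C :: real and r :: "real \<Rightarrow> real"
  assumes sets_\<mu>: "sets \<mu> = sets (restrict_space borel \<Omega>)"
    and riesz: "bounded_riesz_system R1 R2 \<Omega> \<mu> \<psi>" and R: "0 < R1" "R1 \<le> R2"
    and Q: "finite Q" and \<xi>: "\<xi> \<noteq> []" "set \<xi> \<subseteq> \<Omega>"
    and upper: "\<And>z. avg \<xi> (\<lambda>x. (cmod (lin_comb \<psi> Q z x))\<^sup>2)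
           \<le> 50 * (LINT x|\<mu>. (cmod (lin_comb \<psi> Q z x))\<^sup>2) + \<epsilon> * (\<Sum>k\<in>Q. cmod (z k))\<^sup>2"
    and lower: "\<And>z. (LINT x|\<mu>. (cmod (lin_comb \<psi> Q z x))\<^sup>2)
           \<le> 50 * avg \<xi> (\<lambda>x. (cmod (lin_comb \<psi> Q z x))\<^sup>2) + \<epsilon> * (\<Sum>k\<in>Q. cmod (z k))\<^sup>2"
    and \<epsilon>: "0 \<le> \<epsilon>" "\<epsilon> * (K * V) \<le> R1\<^sup>2 / 2" and K: "1 \<le> K" and V: "1 \<le> V" and C: "1 \<le> C"
    and r: "\<And>w. 1 \<le> w \<Longrightarrow> 0 < r w"
begin

lemma space_\<mu>: "space \<mu> = \<Omega>"
  using sets_eq_imp_space_eq[OF sets_\<mu>] by (simp add: space_restrict_space)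

lemma \<psi>_measurable: "\<psi> k \<in> borel_measurable \<mu>"
proof -
  have "\<psi> k \<in> borel_measurable (restrict_space borel \<Omega>)"
    using riesz by (intro borel_measurable_continuous_on_restrict) (simp add: bounded_riesz_system_def)
  thus ?thesis using measurable_cong_sets[OF sets_\<mu> refl] by blast
qed

lemma \<psi>_bounded: "x \<in> \<Omega> \<Longrightarrow> cmod (\<psi> k x) \<le> 1"
  using riesz by (simp add: bounded_riesz_system_def)

lemma lin_comb_measurable [measurable]: "lin_comb \<psi> U z \<in> borel_measurable \<mu>"
  unfolding lin_comb_def using \<psi>_measurable by auto

lemma lin_comb_bounded: "x \<in> \<Omega> \<Longrightarrow> cmod (lin_comb \<psi> U z x) \<le> (\<Sum>k\<in>U. cmod (z k))"
  unfolding lin_comb_def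
  by (rule order_trans[OF norm_sum]) (auto simp: norm_mult intro!: sum_mono mult_left_le \<psi>_bounded)

lemma integrable_lin_comb_powr: "0 \<le> q \<Longrightarrow> integrable \<mu> (\<lambda>x. cmod (lin_comb \<psi> U z x) powr q)"
  using lin_comb_bounded[of _ U z]
  by (intro integrable_const_bound[of _ "(\<Sum>k\<in>U. cmod (z k)) powr q"] AE_I2) (auto simp: space_\<mu> intro!: powr_mono2)

lemma cmod_powr_2: "cmod z powr 2 = (cmod z)\<^sup>2"
  by (cases "z = 0") simp_all

lemma integrable_lin_comb: "integrable \<mu> (\<lambda>x. (cmod (lin_comb \<psi> U z x))\<^sup>2)"
  using integrable_lin_comb_powr[of 2 U z] by (simp only: cmod_powr_2)

lemma riesz_squares:
  assumes "finite U"
  shows "R1\<^sup>2 * (\<Sum>k\<in>U. (cmod (z k))\<^sup>2) \<le> (LINT x|\<mu>. (cmod (lin_comb \<psi> U z x))\<^sup>2)"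
    "(LINT x|\<mu>. (cmod (lin_comb \<psi> U z x))\<^sup>2) \<le> R2\<^sup>2 * (\<Sum>k\<in>U. (cmod (z k))\<^sup>2)"
proof -
  let ?S = "\<Sum>k\<in>U. (cmod (z k))\<^sup>2" and ?I = "LINT x|\<mu>. (cmod (lin_comb \<psi> U z x))\<^sup>2"
  have S: "0 \<le> ?S" by (intro sum_nonneg) auto
  have I: "0 \<le> ?I" by simp
  have "Lp_norm 2 \<mu> (lin_comb \<psi> U z) = sqrt ?I"
    unfolding Lp_norm_def cmod_powr_2 using I by (simp add: powr_half_sqrt)
  hence *: "R1 * sqrt ?S \<le> sqrt ?I" "sqrt ?I \<le> R2 * sqrt ?S"
    using riesz assms unfolding bounded_riesz_system_def by metis+
  have "(R1 * sqrt ?S)\<^sup>2 \<le> (sqrt ?I)\<^sup>2" using * R S by (intro power_mono) auto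
  thus "R1\<^sup>2 * ?S \<le> ?I" using S I by (simp add: power_mult_distrib)
  have "(sqrt ?I)\<^sup>2 \<le> (R2 * sqrt ?S)\<^sup>2" using * I by (intro power_mono) auto
  thus "?I \<le> R2\<^sup>2 * ?S" using S I by (simp add: power_mult_distrib)
qed

text \<open>For K V-sparse vectors the squared l1 norm is at most K V times the squared l2 norm, so
  the additive error consumes at most half of the Riesz bound; the other half divided by 50 gives
  R1^2 / 100.\<close>

lemma empirical_lower:
  assumes U: "U \<subseteq> Q" "real (card U) \<le> K * V"
  shows "R1\<^sup>2 / 100 * (\<Sum>k\<in>U. (cmod (z k))\<^sup>2) \<le> sq \<xi> (lin_comb \<psi> U z)"
proof -
  let ?z = "\<lambda>k. if k \<in> U then z k else 0"
  let ?S = "\<Sum>k\<in>U. (cmod (z k))\<^sup>2"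
  have finU: "finite U" using U Q finite_subset by blast
  have S: "0 \<le> ?S" by (intro sum_nonneg) auto
  have eq: "(\<Sum>k\<in>Q. cmod (?z k)) = (\<Sum>k\<in>U. cmod (z k) * 1)" using U Q by (intro sum.mono_neutral_cong_right) auto
  have "(\<Sum>k\<in>U. cmod (z k) * 1)\<^sup>2 \<le> ?S * (\<Sum>k\<in>U. 1\<^sup>2)" by (rule Cauchy_Schwarz_ineq_sum)
  also have "\<dots> \<le> ?S * (K * V)" using U S by (intro mult_left_mono) auto
  finally have "(\<Sum>k\<in>Q. cmod (?z k))\<^sup>2 \<le> ?S * (K * V)" unfolding eq .
  hence "\<epsilon> * (\<Sum>k\<in>Q. cmod (?z k))\<^sup>2 \<le> \<epsilon> * (?S * (K * V))" using \<epsilon> by (intro mult_left_mono)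
  also have "\<dots> = \<epsilon> * (K * V) * ?S" by simp
  also have "\<dots> \<le> R1\<^sup>2 / 2 * ?S" using \<epsilon> S by (intro mult_right_mono)
  finally have "R1\<^sup>2 * ?S \<le> 50 * sq \<xi> (lin_comb \<psi> U z) + R1\<^sup>2 / 2 * ?S"
    using lower[of ?z] riesz_squares(1)[OF finU, of z] lin_comb_restrict[OF Q U(1), of \<psi> z] by simp
  thus ?thesis by simp
qed

lemma residual_tail:
  assumes c: "sparse_tails C r Q V c" and f: "\<And>x. x \<in> \<Omega> \<Longrightarrow> ((\<lambda>k. c k * \<psi> k x) has_sum f x) UNIV"
    and w: "1 \<le> w" "w \<le> V" and x: "x \<in> \<Omega>"
  shows "cmod (f x - lin_comb \<psi> Q c x) \<le> C * r w"
  unfolding lin_comb_def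
proof (rule has_sum_minus_finite_sum_le[OF f[OF x] Q])
  fix F :: "'k set" assume F: "finite F" "F \<inter> Q = {}"
  have "(\<Sum>k\<in>F. cmod (c k * \<psi> k x)) \<le> (\<Sum>k\<in>F. cmod (c k))"
    using \<psi>_bounded[OF x] by (intro sum_mono) (simp add: norm_mult mult_left_le)
  also have "\<dots> \<le> C * r w" using c w F unfolding sparse_tails_def by blast
  finally show "(\<Sum>k\<in>F. cmod (c k * \<psi> k x)) \<le> C * r w" .
qed

lemma function_bound:
  assumes c: "sparse_tails C r Q V c" and f: "\<And>x. x \<in> \<Omega> \<Longrightarrow> ((\<lambda>k. c k * \<psi> k x) has_sum f x) UNIV"
    and x: "x \<in> \<Omega>"
  shows "cmod (f x) \<le> C * r 1"
proof -
  have "cmod (f x - (\<Sum>k\<in>{}. c k * \<psi> k x)) \<le> C * r 1"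
  proof (rule has_sum_minus_finite_sum_le[OF f[OF x]])
    fix F :: "'k set" assume F: "finite F" "F \<inter> {} = {}"
    have "(\<Sum>k\<in>F. cmod (c k * \<psi> k x)) \<le> (\<Sum>k\<in>F. cmod (c k))"
      using \<psi>_bounded[OF x] by (intro sum_mono) (simp add: norm_mult mult_left_le)
    also have "\<dots> \<le> C * r 1" using c F unfolding sparse_tails_def by blast
    finally show "(\<Sum>k\<in>F. cmod (c k * \<psi> k x)) \<le> C * r 1" .
  qed simp
  thus ?thesis by simp
qed

abbreviation (input) "M0 \<equiv> approx_const R2 C"

lemma M0_ge: "C\<^sup>2 \<le> M0"
proof -
  have "C\<^sup>2 * 1 \<le> C\<^sup>2 * (102 * R2\<^sup>2 + 2)" by (intro mult_left_mono) auto
  thus ?thesis by (simp add: approx_const_def)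
qed

lemma M0_pos: "0 < M0"
proof -
  have "0 < C\<^sup>2" using C by simp
  thus ?thesis using M0_ge by (rule less_le_trans)
qed

lemma avg_mono_\<Omega>: "(\<And>x. x \<in> \<Omega> \<Longrightarrow> F x \<le> G x) \<Longrightarrow> avg \<xi> F \<le> avg \<xi> G"
  using \<xi> by (intro avg_mono) auto

lemma empirical_start:
  assumes c: "sparse_tails C r Q V c" and f: "\<And>x. x \<in> \<Omega> \<Longrightarrow> ((\<lambda>k. c k * \<psi> k x) has_sum f x) UNIV"
  shows "sq \<xi> f \<le> M0 * (r 1)\<^sup>2"
proof -
  have "sq \<xi> f \<le> avg \<xi> (\<lambda>x. (C * r 1)\<^sup>2)" using function_bound[OF c f] by (intro avg_mono_\<Omega> power_mono) auto
  also have "\<dots> = C\<^sup>2 * (r 1)\<^sup>2" using \<xi> by (simp add: avg_const power_mult_distrib)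
  also have "\<dots> \<le> M0 * (r 1)\<^sup>2" using M0_ge by (intro mult_right_mono) auto
  finally show ?thesis .
qed

text \<open>The remainder splits into a part in \<open>Q\<close>, to which the upper l1 comparison
  applies although it is not sparse, and a tail outside \<open>Q\<close>, bounded pointwise. As
  \<epsilon> w \<le> R2^2, the l1 term is of the same order w r(w)^2 as the mean-square
  term.\<close>

lemma empirical_approximation:
  assumes c: "sparse_tails C r Q V c" and f: "\<And>x. x \<in> \<Omega> \<Longrightarrow> ((\<lambda>k. c k * \<psi> k x) has_sum f x) UNIV"
    and w: "1 \<le> w" "w \<le> V"
  shows "\<exists>T\<subseteq>Q. real (card T) \<le> C * w \<and> sq \<xi> (\<lambda>x. f x - lin_comb \<psi> T c x) \<le> M0 * w * (r w)\<^sup>2 \<and>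
     (\<Sum>k\<in>Q - T. cmod (c k)) \<le> C * w * r w \<and> (\<Sum>k\<in>Q - T. (cmod (c k))\<^sup>2) \<le> C\<^sup>2 * w * (r w)\<^sup>2"
proof -
  have "\<exists>T\<subseteq>Q. real (card T) \<le> C * w \<and>
           (\<forall>F. finite F \<and> F \<inter> T = {} \<longrightarrow> (\<Sum>k\<in>F. cmod (c k)) \<le> C * w * r w) \<and>
           (\<forall>k. k \<notin> T \<longrightarrow> cmod (c k) \<le> C * r w)"
    using c w unfolding sparse_tails_def by blast
  then obtain T where T: "T \<subseteq> Q" "real (card T) \<le> C * w"
     "\<And>F. finite F \<Longrightarrow> F \<inter> T = {} \<Longrightarrow> (\<Sum>k\<in>F. cmod (c k)) \<le> C * w * r w"
     "\<And>k. k \<notin> T \<Longrightarrow> cmod (c k) \<le> C * r w" by metis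
  have r0: "0 < r w" using r w by simp
  have l1: "(\<Sum>k\<in>Q - T. cmod (c k)) \<le> C * w * r w" using Q by (intro T(3)) auto
  have l1': "0 \<le> (\<Sum>k\<in>Q - T. cmod (c k))" by (intro sum_nonneg) auto
  have "(\<Sum>k\<in>Q - T. (cmod (c k))\<^sup>2) \<le> (C * r w) * (C * w * r w)"
    using T(4) l1 C r0 by (intro sum_squares_le) auto
  hence l2: "(\<Sum>k\<in>Q - T. (cmod (c k))\<^sup>2) \<le> C\<^sup>2 * w * (r w)\<^sup>2" by (simp add: power2_eq_square mult_ac)
  define z where "z = (\<lambda>k. if k \<in> Q - T then c k else 0)"
  have zF: "lin_comb \<psi> Q z = lin_comb \<psi> (Q - T) c" unfolding z_def using Q by (subst lin_comb_restrict) auto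
  have z1: "(\<Sum>k\<in>Q. cmod (z k)) = (\<Sum>k\<in>Q - T. cmod (c k))"
    unfolding z_def using Q by (intro sum.mono_neutral_cong_right) auto
  have split: "lin_comb \<psi> Q c x = lin_comb \<psi> T c x + lin_comb \<psi> Q z x" for x
    unfolding zF unfolding lin_comb_def by (subst sum.subset_diff[OF T(1) Q]) simp
  have "sq \<xi> (lin_comb \<psi> Q z) \<le> 50 * (R2\<^sup>2 * (\<Sum>k\<in>Q - T. (cmod (c k))\<^sup>2)) + \<epsilon> * (\<Sum>k\<in>Q - T. cmod (c k))\<^sup>2"
    using upper[of z] riesz_squares(2)[of "Q - T" c] Q unfolding z1 zF by simp
  also have "\<dots> \<le> 50 * (R2\<^sup>2 * (C\<^sup>2 * w * (r w)\<^sup>2)) + \<epsilon> * (C * w * r w)\<^sup>2"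
    using l1 l1' l2 \<epsilon> by (intro add_mono mult_left_mono power_mono) auto
  also have "\<epsilon> * (C * w * r w)\<^sup>2 = (\<epsilon> * w) * (C\<^sup>2 * w * (r w)\<^sup>2)" by (simp add: power2_eq_square mult_ac)
  also have "\<dots> \<le> (R2\<^sup>2) * (C\<^sup>2 * w * (r w)\<^sup>2)"
  proof (intro mult_right_mono)
    have "1 * w \<le> K * V" using w K by (intro mult_mono) auto
    hence "\<epsilon> * w \<le> \<epsilon> * (K * V)" using \<epsilon> by (intro mult_left_mono) auto
    also have "\<dots> \<le> R1\<^sup>2 / 2" by (rule \<epsilon>)
    also have "\<dots> \<le> R1\<^sup>2" by simp
    also have "\<dots> \<le> R2\<^sup>2" using R by (intro power_mono) auto
    finally show "\<epsilon> * w \<le> R2\<^sup>2" .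
  qed (use w in auto)
  finally have zb: "sq \<xi> (lin_comb \<psi> Q z) \<le> 51 * R2\<^sup>2 * (C\<^sup>2 * w * (r w)\<^sup>2)" by (simp add: mult_ac)
  have "sq \<xi> (\<lambda>x. f x - lin_comb \<psi> T c x) \<le> avg \<xi> (\<lambda>x. 2 * (cmod (lin_comb \<psi> Q z x))\<^sup>2 + 2 * (C * r w)\<^sup>2)"
  proof (rule avg_mono_\<Omega>)
    fix x assume x: "x \<in> \<Omega>"
    let ?a = "cmod (lin_comb \<psi> Q z x)" and ?b = "cmod (f x - lin_comb \<psi> Q c x)"
    have "cmod (f x - lin_comb \<psi> T c x) = cmod (lin_comb \<psi> Q z x + (f x - lin_comb \<psi> Q c x))" by (simp add: split)
    also have "\<dots> \<le> ?a + ?b" by (rule norm_triangle_ineq)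
    also have "\<dots> \<le> ?a + C * r w" using residual_tail[OF c f w x] by simp
    finally have "(cmod (f x - lin_comb \<psi> T c x))\<^sup>2 \<le> (?a + C * r w)\<^sup>2" by (intro power_mono) auto
    also have "\<dots> \<le> 2 * ?a\<^sup>2 + 2 * (C * r w)\<^sup>2"
      using zero_le_power2[of "?a - C * r w"] by (simp add: power2_eq_square algebra_simps)
    finally show "(cmod (f x - lin_comb \<psi> T c x))\<^sup>2 \<le> 2 * ?a\<^sup>2 + 2 * (C * r w)\<^sup>2" .
  qed
  also have "\<dots> = 2 * sq \<xi> (lin_comb \<psi> Q z) + 2 * (C * r w)\<^sup>2" using \<xi> by (simp add: avg_add avg_cmult avg_const)
  also have "\<dots> \<le> 2 * (51 * R2\<^sup>2 * (C\<^sup>2 * w * (r w)\<^sup>2)) + 2 * (w * (C * r w)\<^sup>2)"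
    using zb w by (intro add_mono mult_left_mono) (auto simp: mult_le_cancel_right1)
  also have "\<dots> = M0 * w * (r w)\<^sup>2" by (simp add: approx_const_def power_mult_distrib algebra_simps)
  finally show ?thesis using T l1 l2 by blast
qed

text \<open>Two sparse combinations that are both close to f at the samples have close coefficients
  by \<open>empirical_lower\<close>. Comparison with the approximant on T therefore turns an
  empirical error into l1 and l2 bounds for coefficients, hence into bounds for the supremum and for
  the L_2 norm under \<mu>.\<close>

lemma Lp_error_le:
  assumes p: "2 \<le> p" and c: "sparse_tails C r Q V c"
    and f: "\<And>x. x \<in> \<Omega> \<Longrightarrow> ((\<lambda>k. c k * \<psi> k x) has_sum f x) UNIV"
    and U: "U \<subseteq> Q" "real (card U) + C * V \<le> K * V"
    and G: "sq \<xi> (\<lambda>x. f x - lin_comb \<psi> U g x) \<le> 2 * (M0 * V * (r V)\<^sup>2)"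
  shows "Lp_norm p \<mu> (\<lambda>x. f x - lin_comb \<psi> U g x) \<le> recovery_const R1 R2 K C p * V powr (1 - 1 / p) * r V"
proof -
  define E where "E = r V"
  have E: "0 < E" using r V by (simp add: E_def)
  note M0 = M0_pos
  obtain T where T: "T \<subseteq> Q" "real (card T) \<le> C * V" "sq \<xi> (\<lambda>x. f x - lin_comb \<psi> T c x) \<le> M0 * V * E\<^sup>2"
    "(\<Sum>k\<in>Q - T. cmod (c k)) \<le> C * V * E" "(\<Sum>k\<in>Q - T. (cmod (c k))\<^sup>2) \<le> C\<^sup>2 * V * E\<^sup>2"
    using empirical_approximation[OF c f V order_refl] unfolding E_def by blast
  define z' where "z' = (\<lambda>k. (if k \<in> T then c k else 0) - (if k \<in> U then g k else 0))"
  define z where "z = (\<lambda>k. (if k \<in> Q - T then c k else 0) + (if k \<in> T \<union> U then z' k else 0))"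
  have TU: "T \<union> U \<subseteq> Q" using T U by auto
  have finTU: "finite (T \<union> U)" using TU Q finite_subset by blast
  have diff: "lin_comb \<psi> (T \<union> U) z' x = lin_comb \<psi> T c x - lin_comb \<psi> U g x" for x
  proof -
    have "lin_comb \<psi> T c x = (\<Sum>k\<in>T \<union> U. (if k \<in> T then c k else 0) * \<psi> k x)"
      "lin_comb \<psi> U g x = (\<Sum>k\<in>T \<union> U. (if k \<in> U then g k else 0) * \<psi> k x)"
      unfolding lin_comb_def using finTU by (auto intro!: sum.mono_neutral_cong_left)
    thus ?thesis by (simp add: lin_comb_def z'_def left_diff_distrib sum_subtractf)
  qed
  have "sq \<xi> (lin_comb \<psi> (T \<union> U) z') \<le> avg \<xi> (\<lambda>x. 2 * (cmod (f x - lin_comb \<psi> U g x))\<^sup>2 + 2 * (cmod (f x - lin_comb \<psi> T c x))\<^sup>2)"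
  proof (rule avg_mono_\<Omega>)
    fix x
    let ?a = "f x - lin_comb \<psi> U g x" and ?b = "f x - lin_comb \<psi> T c x"
    have "(cmod (lin_comb \<psi> (T \<union> U) z' x))\<^sup>2 = (cmod (?a - ?b))\<^sup>2" by (simp add: diff)
    also have "\<dots> \<le> (cmod ?a + cmod ?b)\<^sup>2" by (intro power_mono norm_triangle_ineq4) auto
    also have "\<dots> \<le> 2 * (cmod ?a)\<^sup>2 + 2 * (cmod ?b)\<^sup>2"
      using zero_le_power2[of "cmod ?a - cmod ?b"] by (simp add: power2_eq_square algebra_simps)
    finally show "(cmod (lin_comb \<psi> (T \<union> U) z' x))\<^sup>2 \<le> 2 * (cmod ?a)\<^sup>2 + 2 * (cmod ?b)\<^sup>2" .
  qed
  \<comment> \<open>6 = 2 * 2 + 2 * 1 from the two empirical errors; with the factor 100 of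
    \<open>empirical_lower\<close> it becomes the 600 below.\<close>
  also have "\<dots> \<le> 6 * (M0 * V * E\<^sup>2)" using G T(3) unfolding avg_add avg_cmult E_def by linarith
  finally have sq6: "sq \<xi> (lin_comb \<psi> (T \<union> U) z') \<le> 6 * (M0 * V * E\<^sup>2)" .
  have "real (card (T \<union> U)) \<le> real (card T) + real (card U)" using card_Un_le[of T U] by linarith
  hence cardTU: "real (card (T \<union> U)) \<le> K * V" using T(2) U(2) by linarith
  let ?S = "\<Sum>k\<in>T \<union> U. (cmod (z' k))\<^sup>2"
  have S0: "0 \<le> ?S" by (intro sum_nonneg) auto
  have "R1\<^sup>2 / 100 * ?S \<le> 6 * (M0 * V * E\<^sup>2)" using empirical_lower[OF TU cardTU, of z'] sq6 by linarith
  hence S: "?S \<le> 600 * M0 / R1\<^sup>2 * (V * E\<^sup>2)" using R by (simp add: field_simps)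
  have "(\<Sum>k\<in>T \<union> U. cmod (z' k) * 1)\<^sup>2 \<le> ?S * (\<Sum>k\<in>T \<union> U. 1\<^sup>2)" by (rule Cauchy_Schwarz_ineq_sum)
  also have "\<dots> \<le> (600 * M0 / R1\<^sup>2 * (V * E\<^sup>2)) * (K * V)" using S S0 cardTU by (intro mult_mono) auto
  also have "\<dots> = (sqrt (600 * K * M0) / R1 * (V * E))\<^sup>2"
    using K M0 by (simp add: power_mult_distrib power_divide) (simp add: power2_eq_square mult_ac)
  finally have l1z': "(\<Sum>k\<in>T \<union> U. cmod (z' k)) \<le> sqrt (600 * K * M0) / R1 * (V * E)"
    using R V E K M0 by (intro power2_le_imp_le[of "\<Sum>k\<in>T \<union> U. cmod (z' k)"]) (auto intro!: mult_nonneg_nonneg divide_nonneg_nonneg)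
  have zsplit: "lin_comb \<psi> Q z x = lin_comb \<psi> (Q - T) c x + lin_comb \<psi> (T \<union> U) z' x" for x
    unfolding z_def lin_comb_restrict[OF Q TU] lin_comb_restrict[OF Q Diff_subset[of Q T]]
    by (simp add: lin_comb_def distrib_right sum.distrib)
  have cQ: "lin_comb \<psi> Q c x = lin_comb \<psi> T c x + lin_comb \<psi> (Q - T) c x" for x
    unfolding lin_comb_def by (subst sum.subset_diff[OF T(1) Q]) simp
  have decomp: "f x - lin_comb \<psi> U g x = lin_comb \<psi> Q z x + (f x - lin_comb \<psi> Q c x)" for x
    by (simp add: zsplit diff cQ)
  have tail: "cmod (f x - lin_comb \<psi> Q c x) \<le> C * E" if "x \<in> \<Omega>" for x
    using residual_tail[OF c f V order_refl that] by (simp add: E_def)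
  have l1z: "(\<Sum>k\<in>Q. cmod (z k)) \<le> (C + sqrt (600 * K * M0) / R1) * (V * E)"
  proof -
    have "(\<Sum>k\<in>Q. cmod (z k)) \<le> (\<Sum>k\<in>Q. cmod (if k \<in> Q - T then c k else 0) + cmod (if k \<in> T \<union> U then z' k else 0))"
      unfolding z_def by (intro sum_mono norm_triangle_ineq)
    also have "\<dots> = (\<Sum>k\<in>Q - T. cmod (c k)) + (\<Sum>k\<in>T \<union> U. cmod (z' k))"
      unfolding sum.distrib using Q TU by (intro arg_cong2[where f = "(+)"] sum.mono_neutral_cong_right) auto
    finally show ?thesis using T(4) l1z' unfolding distrib_right mult.assoc by linarith
  qed
  have l2z: "(\<Sum>k\<in>Q. (cmod (z k))\<^sup>2) \<le> (2 * C\<^sup>2 + 1200 * M0 / R1\<^sup>2) * (V * E\<^sup>2)"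
  proof -
    have "(\<Sum>k\<in>Q. (cmod (z k))\<^sup>2) \<le> (\<Sum>k\<in>Q. 2 * (cmod (if k \<in> Q - T then c k else 0))\<^sup>2 + 2 * (cmod (if k \<in> T \<union> U then z' k else 0))\<^sup>2)"
    proof (intro sum_mono)
      fix k
      let ?a = "if k \<in> Q - T then c k else 0" and ?b = "if k \<in> T \<union> U then z' k else 0"
      have "(cmod (?a + ?b))\<^sup>2 \<le> (cmod ?a + cmod ?b)\<^sup>2" by (intro power_mono norm_triangle_ineq) auto
      also have "\<dots> \<le> 2 * (cmod ?a)\<^sup>2 + 2 * (cmod ?b)\<^sup>2"
        using zero_le_power2[of "cmod ?a - cmod ?b"] by (simp only: power2_eq_square algebra_simps)
      finally show "(cmod (z k))\<^sup>2 \<le> 2 * (cmod ?a)\<^sup>2 + 2 * (cmod ?b)\<^sup>2" unfolding z_def .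
    qed
    also have "\<dots> = 2 * (\<Sum>k\<in>Q. (cmod (if k \<in> Q - T then c k else 0))\<^sup>2) + 2 * (\<Sum>k\<in>Q. (cmod (if k \<in> T \<union> U then z' k else 0))\<^sup>2)"
      by (simp only: sum.distrib sum_distrib_left)
    also have "(\<Sum>k\<in>Q. (cmod (if k \<in> Q - T then c k else 0))\<^sup>2) = (\<Sum>k\<in>Q - T. (cmod (c k))\<^sup>2)"
      using Q by (intro sum.mono_neutral_cong_right) auto
    also have "(\<Sum>k\<in>Q. (cmod (if k \<in> T \<union> U then z' k else 0))\<^sup>2) = ?S"
      using Q TU by (intro sum.mono_neutral_cong_right) auto
    finally have "(\<Sum>k\<in>Q. (cmod (z k))\<^sup>2) \<le> 2 * (C\<^sup>2 * V * E\<^sup>2) + 2 * (600 * M0 / R1\<^sup>2 * (V * E\<^sup>2))"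
      using T(5) S by linarith
    thus ?thesis by (simp add: algebra_simps)
  qed
  have int: "(LINT x|\<mu>. (cmod (lin_comb \<psi> Q z x))\<^sup>2) \<le> R2\<^sup>2 * ((2 * C\<^sup>2 + 1200 * M0 / R1\<^sup>2) * (V * E\<^sup>2))"
    by (rule order_trans[OF riesz_squares(2)[OF Q] mult_left_mono[OF l2z zero_le_power2]])
  define B where "B = (2 * C + sqrt (600 * K * M0) / R1) * (V * E)"
  define c2 where "c2 = R2\<^sup>2 * (4 * C\<^sup>2 + 2400 * M0 / R1\<^sup>2) + 2 * C\<^sup>2"
  have sup: "cmod (f x - lin_comb \<psi> U g x) \<le> B" if x: "x \<in> \<Omega>" for x
  proof -
    have "cmod (f x - lin_comb \<psi> U g x) \<le> (\<Sum>k\<in>Q. cmod (z k)) + C * E"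
      unfolding decomp using lin_comb_bounded[OF x, of Q z] tail[OF x]
      by (intro order_trans[OF norm_triangle_ineq] add_mono)
    also have "C * E \<le> C * (V * E)" using C V E by simp
    finally show ?thesis using l1z by (simp add: B_def algebra_simps)
  qed
  have "Lp_norm p \<mu> (\<lambda>x. f x - lin_comb \<psi> U g x)
     \<le> (B powr (p - 2) * (2 * (LINT x|\<mu>. (cmod (lin_comb \<psi> Q z x))\<^sup>2) + 2 * (C * E)\<^sup>2)) powr (1 / p)"
    by (rule Lp_norm_le_of_bounds[OF p decomp _ _ integrable_lin_comb]) (simp_all add: sup tail space_\<mu>)
  also have "\<dots> \<le> (B powr (p - 2) * (c2 * (V * E\<^sup>2))) powr (1 / p)"
  proof (intro powr_mono2 mult_left_mono)
    have "C\<^sup>2 * (1 * E\<^sup>2) \<le> C\<^sup>2 * (V * E\<^sup>2)" using V by (intro mult_left_mono mult_right_mono) auto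
    hence "(C * E)\<^sup>2 \<le> C\<^sup>2 * (V * E\<^sup>2)" by (simp add: power_mult_distrib)
    moreover have "c2 * (V * E\<^sup>2) = 2 * (R2\<^sup>2 * ((2 * C\<^sup>2 + 1200 * M0 / R1\<^sup>2) * (V * E\<^sup>2))) + 2 * (C\<^sup>2 * (V * E\<^sup>2))"
      by (simp add: c2_def algebra_simps)
    ultimately show "2 * (LINT x|\<mu>. (cmod (lin_comb \<psi> Q z x))\<^sup>2) + 2 * (C * E)\<^sup>2 \<le> c2 * (V * E\<^sup>2)"
      using int by linarith
    show "0 \<le> 1 / p" using p by simp
  qed auto
  \<comment> \<open>V^(p-2) V = V^(p-1) and E^(p-2) E^2 = E^p, so the p-th root leaves V^(1 - 1/p)
    E.\<close>
  also have "\<dots> = recovery_const R1 R2 K C p * V powr (1 - 1 / p) * E"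
  proof -
    have b: "0 < 2 * C + sqrt (600 * K * M0) / R1" using C R K M0 by (intro add_pos_nonneg) auto
    have c2: "0 \<le> c2" using R M0 by (auto simp: c2_def intro!: add_nonneg_nonneg mult_nonneg_nonneg)
    have e1: "B powr (p - 2) = (2 * C + sqrt (600 * K * M0) / R1) powr (p - 2) * (V powr (p - 2) * E powr (p - 2))"
      unfolding B_def using b V E by (simp add: powr_mult)
    have e2: "V powr (p - 2) * V = V powr (p - 1)"
    proof -
      have "V powr (p - 2) * V powr 1 = V powr (p - 1)" by (simp only: powr_add[symmetric]) simp
      thus ?thesis using V by simp
    qed
    have e3: "E powr (p - 2) * E\<^sup>2 = E powr p"
    proof -
      have "E powr (p - 2) * E powr 2 = E powr p" by (simp only: powr_add[symmetric]) simp
      thus ?thesis using E by simp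
    qed
    have e4: "B powr (p - 2) * (c2 * (V * E\<^sup>2))
       = ((2 * C + sqrt (600 * K * M0) / R1) powr (p - 2) * c2) * (V powr (p - 1) * E powr p)"
      unfolding e1 e2[symmetric] e3[symmetric] by (simp only: mult_ac)
    have "(B powr (p - 2) * (c2 * (V * E\<^sup>2))) powr (1 / p)
       = recovery_const R1 R2 K C p * ((V powr (p - 1)) powr (1 / p) * (E powr p) powr (1 / p))"
      unfolding e4 unfolding powr_mult recovery_const_def c2_def by (simp only: mult.assoc)
    moreover have "(V powr (p - 1)) powr (1 / p) = V powr (1 - 1 / p)" "(E powr p) powr (1 / p) = E"
      using p E by (simp_all add: powr_powr diff_divide_distrib)
    ultimately show ?thesis by simp
  qed
  finally show ?thesis by (simp add: E_def)
qed

text \<open>Positivity is \<open>empirical_lower\<close> for a single index; it guarantees that no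
  dictionary element vanishes on the sample.\<close>

lemma \<psi>_empirical_norm:
  "sq \<xi> (\<psi> k) \<le> 1" "k \<in> Q \<Longrightarrow> 0 < sq \<xi> (\<psi> k)"
proof -
  have "sq \<xi> (\<psi> k) \<le> avg \<xi> (\<lambda>x. 1)"
    using \<psi>_bounded by (intro avg_mono_\<Omega>) (simp add: power_le_one)
  thus "sq \<xi> (\<psi> k) \<le> 1" using \<xi> by (simp add: avg_const)
  assume k: "k \<in> Q"
  have "1 * 1 \<le> K * V" using K V by (intro mult_mono) auto
  hence "R1\<^sup>2 / 100 * (\<Sum>j\<in>{k}. (cmod 1)\<^sup>2) \<le> sq \<xi> (lin_comb \<psi> {k} (\<lambda>_. 1))"
    using k by (intro empirical_lower) auto
  moreover have "lin_comb \<psi> {k} (\<lambda>_. 1) = \<psi> k" by (simp add: lin_comb_def)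
  moreover have "0 < R1\<^sup>2" using R by simp
  ultimately have "0 < R1\<^sup>2" "R1\<^sup>2 / 100 \<le> sq \<xi> (\<psi> k)" by simp_all
  thus "0 < sq \<xi> (\<psi> k)" by linarith
qed

lemma empirical_dictionary:
  assumes "Q \<noteq> {}"
  shows "is_dictionary (empirical_measure \<xi>) \<psi> Q"
proof -
  have norm: "Lp_norm 2 (empirical_measure \<xi>) (\<psi> k) = sqrt (sq \<xi> (\<psi> k))" for k
    unfolding Lp_norm_def cmod_powr_2 using \<xi> by (simp add: integral_empirical_measure_avg powr_half_sqrt avg_nonneg)
  have "\<psi> k \<in> Lp_space 2 (empirical_measure \<xi>)" for k
    using \<xi> by (auto simp: Lp_space_def empirical_measure_def intro!: integrable_measure_pmf_finite)
  thus ?thesis unfolding is_dictionary_def norm using assms \<psi>_empirical_norm by auto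
qed

text \<open>Optimal recovery asks for distinct points, whereas the sample may repeat some, so
  \<Omega> must have points to spare. On a finite set, infinitely many functions bounded by 1 share
  finitely many cells, and two in one cell are closer in L_2 than the lower Riesz bound
  permits.\<close>

lemma infinite_\<Omega>:
  assumes "infinite (UNIV :: 'k set)"
  shows "infinite \<Omega>"
proof
  assume fin: "finite \<Omega>"
  \<comment> \<open>Any \<delta> below R1 would do: functions in one cell differ by at most sqrt 2
    \<delta>, against a distance of at least sqrt 2 R1 in L_2.\<close>
  define \<delta> where "\<delta> = R1 / 4"
  have \<delta>: "0 < \<delta>" using R by (simp add: \<delta>_def)
  define N where "N = \<lceil>1 / \<delta>\<rceil> + 1"
  define cell where "cell = (\<lambda>k. restrict (\<lambda>x. (\<lfloor>Re (\<psi> k x) / \<delta>\<rfloor>, \<lfloor>Im (\<psi> k x) / \<delta>\<rfloor>)) \<Omega>)"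
  have bnd: "\<lfloor>y / \<delta>\<rfloor> \<in> {- N..N}" if "\<bar>y\<bar> \<le> 1" for y
  proof -
    have "- (1 / \<delta>) \<le> y / \<delta>" "y / \<delta> \<le> 1 / \<delta>"
      using that \<delta> divide_right_mono[of "-1" y \<delta>] divide_right_mono[of y 1 \<delta>] by auto
    thus ?thesis unfolding N_def atLeastAtMost_iff by linarith
  qed
  have "range cell \<subseteq> (\<Omega> \<rightarrow>\<^sub>E {- N..N} \<times> {- N..N})"
  proof
    fix h assume "h \<in> range cell"
    then obtain k where h: "h = cell k" by blast
    have "\<bar>Re (\<psi> k x)\<bar> \<le> 1" "\<bar>Im (\<psi> k x)\<bar> \<le> 1" if "x \<in> \<Omega>" for x
      using \<psi>_bounded[OF that, of k] abs_Re_le_cmod[of "\<psi> k x"] abs_Im_le_cmod[of "\<psi> k x"] by linarith+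
    thus "h \<in> (\<Omega> \<rightarrow>\<^sub>E {- N..N} \<times> {- N..N})" using bnd by (auto simp: h cell_def simp del: atLeastAtMost_iff)
  qed
  hence "finite (range cell)" by (rule finite_subset) (use fin in \<open>intro finite_PiE; auto\<close>)
  hence "\<not> inj cell" using assms finite_imageD by blast
  then obtain k k' where kk: "k \<noteq> k'" "cell k = cell k'" by (auto simp: inj_def)
  define z where "z = (\<lambda>j. if j = k then 1 else -1 :: complex)"
  have diff: "lin_comb \<psi> {k, k'} z x = \<psi> k x - \<psi> k' x" for x
    using kk(1) by (simp add: lin_comb_def z_def)
  have close: "\<bar>y - y'\<bar> \<le> \<delta>" if "\<lfloor>y / \<delta>\<rfloor> = \<lfloor>y' / \<delta>\<rfloor>" for y y'
  proof -
    have "\<bar>y / \<delta> - y' / \<delta>\<bar> \<le> 1" using that by linarith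
    thus ?thesis using \<delta> by (simp add: diff_divide_distrib[symmetric] divide_le_eq)
  qed
  have "(cmod (lin_comb \<psi> {k, k'} z x))\<^sup>2 \<le> 2 * \<delta>\<^sup>2" if x: "x \<in> \<Omega>" for x
  proof -
    have "\<lfloor>Re (\<psi> k x) / \<delta>\<rfloor> = \<lfloor>Re (\<psi> k' x) / \<delta>\<rfloor>" "\<lfloor>Im (\<psi> k x) / \<delta>\<rfloor> = \<lfloor>Im (\<psi> k' x) / \<delta>\<rfloor>"
      using fun_cong[OF kk(2), of x] x by (simp_all add: cell_def)
    hence "\<bar>Re (\<psi> k x - \<psi> k' x)\<bar> \<le> \<delta>" "\<bar>Im (\<psi> k x - \<psi> k' x)\<bar> \<le> \<delta>" using close by auto
    hence "\<bar>Re (\<psi> k x - \<psi> k' x)\<bar>\<^sup>2 \<le> \<delta>\<^sup>2" "\<bar>Im (\<psi> k x - \<psi> k' x)\<bar>\<^sup>2 \<le> \<delta>\<^sup>2"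
      by (intro power_mono; simp)+
    thus ?thesis unfolding diff cmod_power2 by simp
  qed
  hence "(LINT x|\<mu>. (cmod (lin_comb \<psi> {k, k'} z x))\<^sup>2) \<le> (LINT x|\<mu>. 2 * \<delta>\<^sup>2)"
    using integrable_lin_comb by (intro integral_mono) (auto simp: space_\<mu>)
  moreover have "R1\<^sup>2 * (\<Sum>j\<in>{k, k'}. (cmod (z j))\<^sup>2) \<le> (LINT x|\<mu>. (cmod (lin_comb \<psi> {k, k'} z x))\<^sup>2)"
    by (rule riesz_squares) simp
  ultimately have "R1\<^sup>2 * 2 \<le> 2 * \<delta>\<^sup>2" using kk(1) by (simp add: z_def prob_space)
  moreover have "0 < R1\<^sup>2" using R by simp
  ultimately show False by (simp add: \<delta>_def power_divide)
qed

text \<open>The condition on \<open>N0\<close> turns the doubling property of r into the decay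
  required between stages. The condition on K makes room for the at most 2 N0 V selected indices and
  the C V indices of an approximant.\<close>

lemma womp_error:
  assumes p: "2 \<le> p" and t: "0 < t" and c: "sparse_tails C r Q V c"
    and f: "\<And>x. x \<in> \<Omega> \<Longrightarrow> ((\<lambda>k. c k * \<psi> k x) has_sum f x) UNIV"
    and V_eq: "V = 2 ^ l" and K_ge: "2 * real N0 + C \<le> K"
    and dbl: "\<And>w. 1 \<le> w \<Longrightarrow> r w \<le> C4 * r (2 * w)"
    and N0: "exp (- (t\<^sup>2 * (R1\<^sup>2 / 100) / C) * real N0) * C4\<^sup>2 \<le> 1"
    and run: "womp_run (empirical_measure \<xi>) \<psi> Q t f (N0 * (2 ^ Suc l - 2)) \<kappa> g"
  shows "Lp_norm p \<mu> (g (N0 * (2 ^ Suc l - 2))) \<le> recovery_const R1 R2 K C p * V powr (1 - 1 / p) * r V"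
proof -
  define s where "s = N0 * (2 ^ Suc l - 2)"
  define u where "u = nat \<lfloor>K * V\<rfloor>"
  have u: "n \<le> u" if "real n \<le> K * V" for n using that unfolding u_def by linarith
  have u': "real n \<le> K * V" if "n \<le> u" for n
  proof -
    have "0 \<le> K * V" using K V by simp
    thus ?thesis using that unfolding u_def by linarith
  qed
  have "real s \<le> real (N0 * 2 ^ Suc l)" unfolding s_def by (simp only: of_nat_le_iff mult_le_mono2 diff_le_self)
  hence s: "real s \<le> 2 * real N0 * V" by (simp add: V_eq)
  have wi: "1 \<le> (2::real) ^ i" "2 ^ i \<le> V" if "i \<le> l" for i
    using that by (auto simp: V_eq intro!: power_increasing)
  have "\<exists>T. \<forall>i\<le>l. T i \<subseteq> Q \<and> real (card (T i)) \<le> C * 2 ^ i \<and>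
     sq \<xi> (\<lambda>x. f x - lin_comb \<psi> (T i) c x) \<le> M0 * 2 ^ i * (r (2 ^ i))\<^sup>2"
    using empirical_approximation[OF c f wi] by (intro choice) meson
  then obtain T where T: "\<And>i. i \<le> l \<Longrightarrow> T i \<subseteq> Q" "\<And>i. i \<le> l \<Longrightarrow> real (card (T i)) \<le> C * 2 ^ i"
     "\<And>i. i \<le> l \<Longrightarrow> sq \<xi> (\<lambda>x. f x - lin_comb \<psi> (T i) c x) \<le> M0 * 2 ^ i * (r (2 ^ i))\<^sup>2" by blast
  note M0 = M0_pos
  have "sq \<xi> (g s) \<le> 2 * (M0 * 2 ^ l * (r (2 ^ l))\<^sup>2)"
    unfolding s_def
  proof (rule womp_stages[OF \<xi>(1) run t Q \<psi>_empirical_norm(1) _ _ T(1,2) _ _ T(3)])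
    show "0 < R1\<^sup>2 / 100" using R by simp
    show "R1\<^sup>2 / 100 * (\<Sum>k\<in>U. (cmod (z k))\<^sup>2) \<le> sq \<xi> (lin_comb \<psi> U z)" if "U \<subseteq> Q" "card U \<le> u" for U z
      using that u' by (intro empirical_lower) auto
    show "0 < C" using C by simp
    show "card (T i) + N0 * (2 ^ Suc l - 2) \<le> u" if i: "i \<le> l" for i
    proof (rule u)
      have "C * 2 ^ i \<le> C * V" using wi[OF i] C by (intro mult_left_mono) auto
      hence "real (card (T i) + s) \<le> C * V + 2 * real N0 * V" using T(2)[OF i] s by simp
      also have "\<dots> = (2 * real N0 + C) * V" by (simp add: algebra_simps)
      also have "\<dots> \<le> K * V" using K_ge V by (intro mult_right_mono) auto
      finally show "real (card (T i) + N0 * (2 ^ Suc l - 2)) \<le> K * V" unfolding s_def .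
    qed
    have "0 \<le> M0 * (r 1)\<^sup>2" using M0 by simp
    hence "sq \<xi> f \<le> 2 * (M0 * (r 1)\<^sup>2)" using empirical_start[OF c f] by linarith
    thus "sq \<xi> f \<le> 2 * (M0 * 2 ^ 0 * (r (2 ^ 0))\<^sup>2)" by simp
    show "exp (- (t\<^sup>2 * (R1\<^sup>2 / 100) / C) * real N0) * (2 * (M0 * 2 ^ i * (r (2 ^ i))\<^sup>2)) \<le> M0 * 2 ^ Suc i * (r (2 ^ Suc i))\<^sup>2"
      if i: "i < l" for i
    proof -
      let ?e = "exp (- (t\<^sup>2 * (R1\<^sup>2 / 100) / C) * real N0)"
      have "(r (2 ^ i))\<^sup>2 \<le> (C4 * r (2 ^ Suc i))\<^sup>2"
        using dbl[of "2 ^ i"] r[of "2 ^ i"] by (intro power_mono) (auto simp: less_imp_le)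
      hence "?e * (M0 * 2 ^ Suc i * (r (2 ^ i))\<^sup>2) \<le> ?e * (M0 * 2 ^ Suc i * (C4 * r (2 ^ Suc i))\<^sup>2)"
        using M0 by (intro mult_left_mono) auto
      also have "\<dots> = (?e * C4\<^sup>2) * (M0 * 2 ^ Suc i * (r (2 ^ Suc i))\<^sup>2)" by (simp only: power_mult_distrib mult_ac)
      also have "\<dots> \<le> 1 * (M0 * 2 ^ Suc i * (r (2 ^ Suc i))\<^sup>2)" using N0 M0 by (intro mult_right_mono) auto
      finally show ?thesis by (simp add: mult_ac)
    qed
  qed auto
  moreover obtain G where G: "is_orth_proj (empirical_measure \<xi>) (range (lin_comb \<psi> (\<kappa> ` {1..s}))) f G" "g s = (\<lambda>x. f x - G x)"
    using womp_residual_proj[OF \<xi>(1) run order_refl] unfolding s_def by blast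
  then obtain q where q: "G = lin_comb \<psi> (\<kappa> ` {1..s}) q" unfolding is_orth_proj_def by blast
  ultimately have le: "sq \<xi> (\<lambda>x. f x - lin_comb \<psi> (\<kappa> ` {1..s}) q x) \<le> 2 * (M0 * V * (r V)\<^sup>2)"
    using G(2) by (simp add: V_eq)
  have "card (\<kappa> ` {1..s}) \<le> s" using card_image_le[of "{1..s}" \<kappa>] by simp
  hence "real (card (\<kappa> ` {1..s})) + C * V \<le> 2 * real N0 * V + C * V" using s by linarith
  also have "\<dots> = (2 * real N0 + C) * V" by (simp add: algebra_simps)
  also have "\<dots> \<le> K * V" using K_ge V by (intro mult_right_mono) auto
  finally have "Lp_norm p \<mu> (\<lambda>x. f x - lin_comb \<psi> (\<kappa> ` {1..s}) q x) \<le> recovery_const R1 R2 K C p * V powr (1 - 1 / p) * r V"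
    using run by (intro Lp_error_le[OF p c f _ _ le]) (auto simp: womp_run_def s_def)
  thus ?thesis using G(2) q unfolding s_def by simp
qed

text \<open>The decoder picks any sparse combination that fits the data as well as an approximant is
  known to do, and \<open>Lp_error_le\<close> applies to whichever is picked. The sample is replaced
  by its distinct points, padded from \<Omega>; the values at the padding are ignored.\<close>

lemma optimal_recovery_le:
  assumes p: "2 \<le> p" and K_ge: "2 * C \<le> K" and inf: "infinite (UNIV :: 'k set)" and m: "length \<xi> = m"
    and F: "\<And>f. f \<in> F \<Longrightarrow> \<exists>c. sparse_tails C r Q V c \<and> (\<forall>x\<in>\<Omega>. ((\<lambda>k. c k * \<psi> k x) has_sum f x) UNIV)"
  shows "optimal_recovery m F p \<Omega> \<mu> \<le> ennreal (recovery_const R1 R2 K C p * V powr (1 - 1 / p) * r V)"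
proof -
  have "infinite (\<Omega> - set \<xi>)" using infinite_\<Omega>[OF inf] by simp
  then obtain B where B: "finite B" "card B = m - card (set \<xi>)" "B \<subseteq> \<Omega> - set \<xi>"
    using infinite_arbitrarily_large by blast
  obtain \<xi>' where \<xi>': "set \<xi>' = set \<xi> \<union> B" "distinct \<xi>'"
    using finite_distinct_list[of "set \<xi> \<union> B"] B by auto
  have "card (set \<xi> \<union> B) = card (set \<xi>) + card B" using B by (intro card_Un_disjoint) auto
  also have "\<dots> = m" using B(2) card_length[of \<xi>] m by simp
  finally have len: "length \<xi>' = m" using \<xi>' distinct_card by metis
  have sub: "set \<xi>' \<subseteq> \<Omega>" using \<xi>' B \<xi> by auto
  \<comment> \<open>Data are read by point and not by position, so the average over the original
    list, repetitions included, can be formed from the distinct points.\<close>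
  define val where "val = (\<lambda>y x. the (map_of (zip \<xi>' y) x) :: complex)"
  have val: "val (map f \<xi>') x = f x" if "x \<in> set \<xi>" for f x
    using that \<xi>'(1) by (simp add: val_def map_of_zip_map)
  define ok where "ok = (\<lambda>y (U, g). U \<subseteq> Q \<and> real (card U) \<le> C * V \<and>
     sq \<xi> (\<lambda>x. val y x - lin_comb \<psi> U g x) \<le> 2 * (M0 * V * (r V)\<^sup>2))"
  define pick where "pick = (\<lambda>y. SOME Ug. ok y Ug)"
  define A where "A = (\<lambda>y. lin_comb \<psi> (fst (pick y)) (snd (pick y)))"
  have nsq_val: "sq \<xi> (\<lambda>x. val (map f \<xi>') x - h x) = sq \<xi> (\<lambda>x. f x - h x)" for f h
    using val by (intro antisym avg_mono) auto
  note M0 = M0_pos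
  have err: "Lp_norm p \<mu> (\<lambda>x. f x - A (map f \<xi>') x) \<le> recovery_const R1 R2 K C p * V powr (1 - 1 / p) * r V"
    if fF: "f \<in> F" for f
  proof -
    obtain c where c: "sparse_tails C r Q V c" "\<And>x. x \<in> \<Omega> \<Longrightarrow> ((\<lambda>k. c k * \<psi> k x) has_sum f x) UNIV"
      using F[OF fF] by blast
    obtain T where T: "T \<subseteq> Q" "real (card T) \<le> C * V" "sq \<xi> (\<lambda>x. f x - lin_comb \<psi> T c x) \<le> M0 * V * (r V)\<^sup>2"
      using empirical_approximation[OF c V order_refl] by blast
    have "0 \<le> M0 * V * (r V)\<^sup>2" using M0 V by simp
    hence "ok (map f \<xi>') (T, c)" using T by (simp add: ok_def nsq_val)
    hence "ok (map f \<xi>') (pick (map f \<xi>'))" unfolding pick_def by (rule someI)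
    moreover obtain U g where Ug: "pick (map f \<xi>') = (U, g)" by (cases "pick (map f \<xi>')")
    ultimately have U: "U \<subseteq> Q" "real (card U) \<le> C * V" "sq \<xi> (\<lambda>x. f x - lin_comb \<psi> U g x) \<le> 2 * (M0 * V * (r V)\<^sup>2)"
      by (simp_all add: ok_def nsq_val)
    have "2 * C * V \<le> K * V" using K_ge V by (intro mult_right_mono) auto
    hence "real (card U) + C * V \<le> K * V" using U(2) by simp
    from Lp_error_le[OF p c U(1) this U(3)] show ?thesis by (simp add: A_def Ug)
  qed
  have A_Lp: "A y \<in> Lp_space p \<mu>" for y
    using p unfolding A_def Lp_space_def by (auto intro!: integrable_lin_comb_powr)
  show ?thesis unfolding optimal_recovery_def
  proof (rule INF_lower2[where i = \<xi>'], use len \<xi>'(2) sub in simp, rule INF_lower2[where i = A])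
    show "A \<in> {A. \<forall>y. length y = m \<longrightarrow> A y \<in> Lp_space p \<mu>}" using A_Lp by simp
    show "(SUP f\<in>F. ennreal (Lp_norm p \<mu> (\<lambda>x. f x - A (map f \<xi>') x))) \<le> ennreal (recovery_const R1 R2 K C p * V powr (1 - 1 / p) * r V)"
      using err by (intro SUP_least ennreal_leI)
  qed
qed

end

section \<open>Choice of the parameters\<close>

lemma ln_card_hyperbolic_cross_le:
  "ln (4 * real (card (\<Union>j\<le>J. hyperbolic_layer j :: (int ^ 'd::finite) set)))
     \<le> 2 + real CARD('d) + (real CARD('d) + 1) * real J"
proof -
  let ?Q = "\<Union>j\<le>J. hyperbolic_layer j :: (int ^ 'd) set"
  define D where "D = CARD('d) - 1"
  have D: "CARD('d) = Suc D" by (simp add: D_def)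
  have "card ?Q \<le> (\<Sum>j\<le>J. card (hyperbolic_layer j :: (int ^ 'd) set))" by (rule card_UN_le) simp
  also have "\<dots> \<le> (\<Sum>j\<le>J. (J + 1) ^ D * 2 ^ (CARD('d) + J))"
  proof (intro sum_mono)
    fix j assume j: "j \<in> {..J}"
    have "card (hyperbolic_layer j :: (int ^ 'd) set) \<le> (j + 1) ^ D * 2 ^ (CARD('d) + j)"
      unfolding D_def by (rule card_hyperbolic_layer)
    also have "\<dots> \<le> (J + 1) ^ D * 2 ^ (CARD('d) + J)" using j by (intro mult_mono power_mono power_increasing) auto
    finally show "card (hyperbolic_layer j :: (int ^ 'd) set) \<le> (J + 1) ^ D * 2 ^ (CARD('d) + J)" .
  qed
  also have "\<dots> = (J + 1) ^ CARD('d) * 2 ^ (CARD('d) + J)" by (simp add: D algebra_simps)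
  finally have "real (card ?Q) \<le> real ((J + 1) ^ CARD('d) * 2 ^ (CARD('d) + J))" by (simp only: of_nat_le_iff)
  hence le: "4 * real (card ?Q) \<le> 4 * (real (J + 1) ^ CARD('d) * 2 ^ (CARD('d) + J))" by simp
  show ?thesis
  proof (cases "card ?Q = 0")
    case False
    have "ln (4 * real (card ?Q)) \<le> ln (2 ^ 2 * (real (J + 1) ^ CARD('d) * 2 ^ (CARD('d) + J)))"
      using le False by (subst ln_le_cancel_iff) auto
    also have "\<dots> = ln (2 ^ 2) + (ln (real (J + 1) ^ CARD('d)) + ln (2 ^ (CARD('d) + J)))"
      by (subst ln_mult_pos; simp add: ln_mult_pos)
    also have "\<dots> = 2 * ln 2 + (real CARD('d) * ln (real (J + 1)) + real (CARD('d) + J) * ln 2)"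
      by (simp only: ln_realpow of_nat_numeral)
    also have "\<dots> \<le> 2 * 1 + (real CARD('d) * (real (J + 1) - 1) + real (CARD('d) + J) * 1)"
      using ln_2_less_1 by (intro add_mono mult_left_mono ln_le_minus_one) auto
    finally show ?thesis by (simp add: algebra_simps)
  qed simp
qed

lemma power_of_two_between:
  fixes x :: real
  assumes "1 \<le> x"
  shows "\<exists>l. x \<le> 2 ^ l \<and> 2 ^ l \<le> 2 * x"
proof -
  define l where "l = (LEAST l. x \<le> 2 ^ l)"
  have "\<exists>l. x \<le> 2 ^ l" using real_arch_pow[of 2 x] by (auto intro: less_imp_le)
  hence l: "x \<le> 2 ^ l" unfolding l_def by (rule LeastI_ex)
  have "2 ^ l \<le> 2 * x"
  proof (cases l)
    case (Suc n)
    hence "\<not> x \<le> 2 ^ n" using not_less_Least[of n "\<lambda>l. x \<le> 2 ^ l"] by (simp add: l_def)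
    thus ?thesis using Suc by simp
  qed (use assms in simp)
  with l show ?thesis by blast
qed

lemma zero_in_hyperbolic_layer: "0 \<in> hyperbolic_layer 0"
proof -
  have "\<lfloor>2 powr (-1 :: real)\<rfloor> = 0" by (simp add: powr_minus_divide)
  hence "0 \<in> dyadic_block 0" by (simp add: dyadic_block_def)
  thus ?thesis unfolding hyperbolic_layer_def by (intro UN_I[of 0]) simp_all
qed

lemma infinite_UNIV_int_vec: "infinite (UNIV :: (int ^ 'd::finite) set)"
proof -
  have "inj (\<lambda>n :: nat. (\<chi> i. int n) :: int ^ 'd)" by (auto simp: inj_def vec_eq_iff)
  hence "infinite (range (\<lambda>n :: nat. (\<chi> i. int n) :: int ^ 'd))" by (rule range_inj_infinite)
  thus ?thesis by (rule infinite_super[OF subset_UNIV])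
qed

lemma W_class_coefficients:
  assumes "f \<in> W_class a b \<beta> \<Omega> (\<psi> :: int ^ 'd::finite \<Rightarrow> 'x \<Rightarrow> complex)"
  shows "\<exists>c. (\<forall>j. A_quasinorm \<beta> j c \<le> layer_weight a (real (CARD('d) - 1) * b) j) \<and>
    (\<forall>x\<in>\<Omega>. ((\<lambda>k. c k * \<psi> k x) has_sum f x) UNIV)"
proof -
  from assms obtain c where "\<forall>x\<in>\<Omega>. ((\<lambda>k. c k * \<psi> k x) has_sum f x) UNIV"
    "\<forall>j. A_quasinorm \<beta> j c \<le> 2 powr (- a * real j) * real (max j 1) powr (real (CARD('d) - 1) * b)"
    unfolding W_class_def by (elim CollectE exE conjE)
  thus ?thesis by (intro exI[of _ c]) (simp add: layer_weight_def)
qed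

text \<open>With e of order 1 / (K V), both L and log |Q| are at most of order log V, so V (log V)^3
  points suffice up to constants. \<open>cL\<close> and \<open>cN\<close> are the constants of these
  two logarithmic bounds.\<close>

lemma exists_sampled_system:
  fixes \<mu> :: "'x::topological_space measure" and \<psi> :: "int ^ 'd::finite \<Rightarrow> 'x \<Rightarrow> complex"
    and K R1 R2 C V :: real
  defines "cL \<equiv> 1 + 2 * (\<bar>ln (1024 * K / R1\<^sup>2)\<bar> + 2)"
    and "cN \<equiv> 2 * (2 + real CARD('d)) + (real CARD('d) + 1) * C"
  assumes \<mu>: "borel_prob_on \<Omega> \<mu>" and riesz: "bounded_riesz_system R1 R2 \<Omega> \<mu> \<psi>"
    and R: "0 < R1" "R1 \<le> R2" and K: "1 \<le> K" and V: "1 \<le> V" and C: "1 \<le> C" and r: "\<And>w. 1 \<le> w \<Longrightarrow> 0 < r w"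
    and J: "real J \<le> C * ln (2 * V)" and m: "1 \<le> m"
      "25600 * (8 * K * V / R1\<^sup>2) * cL\<^sup>2 * cN * ln (2 * V) ^ 3 \<le> real m"
  shows "\<exists>\<xi>. length \<xi> = m \<and>
     sampled_riesz_system \<mu> \<Omega> \<psi> \<xi> (\<Union>j\<le>J. hyperbolic_layer j) R1 R2 (R1\<^sup>2 / (2 * K * V)) K V C r"
proof -
  interpret prob_space \<mu> using \<mu> by (simp add: borel_prob_on_def)
  define Q :: "(int ^ 'd) set" where "Q = (\<Union>j\<le>J. hyperbolic_layer j)"
  \<comment> \<open>A quarter of the error in the conclusion, since \<open>l1_discretization\<close>
    yields 4 e.\<close>
  define e where "e = R1\<^sup>2 / (8 * K * V)"
  define L where "L = nat \<lceil>ln (128 / e)\<rceil> + 1"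
  have sets: "sets \<mu> = sets (restrict_space borel \<Omega>)" using \<mu> by (simp add: borel_prob_on_def)
  have space: "space \<mu> = \<Omega>" using sets_eq_imp_space_eq[OF sets] by (simp add: space_restrict_space)
  have e: "0 < e" using R K V by (simp add: e_def)
  have Q: "finite Q" "Q \<noteq> {}" unfolding Q_def using finite_hyperbolic_layer zero_in_hyperbolic_layer by auto
  have lnV: "1 / 2 \<le> ln (2 * V)"
  proof -
    have "ln 2 \<le> ln (2 * V)" using V by simp
    thus ?thesis using ln2_ge_two_thirds by linarith
  qed
  have \<psi>m: "\<psi> k \<in> borel_measurable \<mu>" for k
  proof -
    have "\<psi> k \<in> borel_measurable (restrict_space borel \<Omega>)"
      using riesz by (intro borel_measurable_continuous_on_restrict) (simp add: bounded_riesz_system_def)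
    thus ?thesis using measurable_cong_sets[OF sets refl] by blast
  qed
  have \<psi>b: "cmod (\<psi> k x) \<le> 1" if "x \<in> space \<mu>" for k x
    using riesz that by (simp add: bounded_riesz_system_def space)
  have L1: "1 \<le> L" by (simp add: L_def)
  have "ln (128 / e) \<le> real L" unfolding L_def by linarith
  hence "128 / e \<le> exp (real L)" 
    using e exp_le_cancel_iff[of "ln (128 / e)" "real L"] by simp
  hence L2: "128 * exp (- real L) \<le> e" using e by (simp add: exp_minus field_simps)
  have lnN0: "0 \<le> ln (4 * real (card Q))"
  proof (rule ln_ge_zero)
    have "0 < card Q" using Q by (simp add: card_gt_0_iff)
    thus "1 \<le> 4 * real (card Q)" by linarith
  qed
  have LcL: "real L \<le> cL * ln (2 * V)"
  proof -
    have eq: "128 / e = 1024 * K / R1\<^sup>2 * V" using R K V by (simp add: e_def field_simps)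
    have le: "ln (128 / e) = ln (1024 * K / R1\<^sup>2) + ln V"
      unfolding eq by (rule ln_mult_pos) (use R K V in auto)
    define q where "q = \<bar>ln (1024 * K / R1\<^sup>2)\<bar> + 2"
    have q: "ln (1024 * K / R1\<^sup>2) + 2 \<le> q" "2 \<le> q" by (auto simp: q_def)
    have "ln V \<le> ln (2 * V)" using V by simp
    moreover have "real L \<le> max 0 (ln (128 / e)) + 2" unfolding L_def by linarith
    ultimately have "real L \<le> ln (2 * V) + q" using le q lnV by linarith
    also have "q * 1 \<le> q * (2 * ln (2 * V))" using q lnV by (intro mult_left_mono) auto
    hence "ln (2 * V) + q \<le> cL * ln (2 * V)" by (simp add: cL_def q_def algebra_simps)
    finally show ?thesis .
  qed
  have NcN: "ln (4 * real (card Q)) \<le> cN * ln (2 * V)"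
  proof -
    have "ln (4 * real (card Q)) \<le> (2 + real CARD('d)) * 1 + (real CARD('d) + 1) * real J"
      unfolding Q_def using ln_card_hyperbolic_cross_le[where 'd = 'd, of J] by simp
    also have "\<dots> \<le> (2 + real CARD('d)) * (2 * ln (2 * V)) + (real CARD('d) + 1) * (C * ln (2 * V))"
      using lnV J by (intro add_mono mult_left_mono) auto
    finally show ?thesis by (simp add: cN_def algebra_simps)
  qed
  have "25600 * real L ^ 2 * ln (4 * real (card Q)) \<le> 25600 * (cL * ln (2 * V))\<^sup>2 * (cN * ln (2 * V))"
    using LcL NcN lnN0 by (intro mult_mono power_mono) auto
  also have "\<dots> = (25600 * (8 * K * V / R1\<^sup>2) * cL\<^sup>2 * cN * ln (2 * V) ^ 3) * e"
    using R K V by (simp add: e_def power2_eq_square power3_eq_cube)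
  also have "\<dots> \<le> real m * e" using m(2) e by (intro mult_right_mono) auto
  finally have m2: "25600 * real L ^ 2 * ln (4 * real (card Q)) \<le> real m * e" .
  have "\<exists>\<xi>. length \<xi> = m \<and> set \<xi> \<subseteq> space \<mu> \<and>
    (\<forall>c. avg \<xi> (\<lambda>x. (cmod (lin_comb \<psi> Q c x))\<^sup>2)
           \<le> 50 * (LINT x|\<mu>. (cmod (lin_comb \<psi> Q c x))\<^sup>2) + 4 * e * (\<Sum>k\<in>Q. cmod (c k))\<^sup>2 \<and>
         (LINT x|\<mu>. (cmod (lin_comb \<psi> Q c x))\<^sup>2)
           \<le> 50 * avg \<xi> (\<lambda>x. (cmod (lin_comb \<psi> Q c x))\<^sup>2) + 4 * e * (\<Sum>k\<in>Q. cmod (c k))\<^sup>2)"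
    by (rule l1_discretization[OF Q \<psi>m \<psi>b L1 L2 m(1) m2])
  then obtain \<xi> where \<xi>: "length \<xi> = m" "set \<xi> \<subseteq> space \<mu>" and
    disc: "\<And>c. avg \<xi> (\<lambda>x. (cmod (lin_comb \<psi> Q c x))\<^sup>2)
           \<le> 50 * (LINT x|\<mu>. (cmod (lin_comb \<psi> Q c x))\<^sup>2) + 4 * e * (\<Sum>k\<in>Q. cmod (c k))\<^sup>2 \<and>
         (LINT x|\<mu>. (cmod (lin_comb \<psi> Q c x))\<^sup>2)
           \<le> 50 * avg \<xi> (\<lambda>x. (cmod (lin_comb \<psi> Q c x))\<^sup>2) + 4 * e * (\<Sum>k\<in>Q. cmod (c k))\<^sup>2" by blast
  have e4: "4 * e = R1\<^sup>2 / (2 * K * V)" using K V by (simp add: e_def)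
  have "sampled_riesz_system \<mu> \<Omega> \<psi> \<xi> Q R1 R2 (4 * e) K V C r"
  proof
    show "4 * e * (K * V) \<le> R1\<^sup>2 / 2" using K V by (simp add: e4)
    show "\<xi> \<noteq> []" using \<xi>(1) m(1) by auto
    show "set \<xi> \<subseteq> \<Omega>" using \<xi>(2) by (simp only: space)
    show "0 \<le> 4 * e" using e by simp
  qed (fact sets riesz R Q(1) K V C | rule r disc[THEN conjunct1] disc[THEN conjunct2], assumption?)+
  thus ?thesis using \<xi>(1) unfolding e4 Q_def by blast
qed

text \<open>A negative power beats every power of the logarithm. The logarithmic factor is the price
  of passing from ln (2 V) to ln (2 v) in \<open>absorb_constant\<close>.\<close>

lemma rescaling_exists:
  fixes X \<alpha> g :: real
  assumes "0 < \<alpha>"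
  shows "\<exists>\<kappa>::nat. 1 \<le> \<kappa> \<and> X * (real \<kappa> powr - \<alpha> * (1 + 2 * ln (4 * real \<kappa>)) powr \<bar>g\<bar>) \<le> 1"
proof -
  have "((\<lambda>n::nat. real n powr - \<alpha> * (1 + 2 * ln (4 * real n)) powr \<bar>g\<bar>) \<longlongrightarrow> 0) at_top"
    using assms by real_asymp
  hence "((\<lambda>n::nat. X * (real n powr - \<alpha> * (1 + 2 * ln (4 * real n)) powr \<bar>g\<bar>)) \<longlongrightarrow> X * 0) at_top"
    by (intro tendsto_intros)
  hence "\<forall>\<^sub>F n::nat in at_top. X * (real n powr - \<alpha> * (1 + 2 * ln (4 * real n)) powr \<bar>g\<bar>) < 1"
    by (rule order_tendstoD) simp
  then obtain N where "\<And>n. N \<le> n \<Longrightarrow> X * (real n powr - \<alpha> * (1 + 2 * ln (4 * real n)) powr \<bar>g\<bar>) < 1"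
    by (auto simp: eventually_at_top_linorder)
  thus ?thesis by (intro exI[of _ "max N 1"]) (auto intro: less_imp_le)
qed

text \<open>Since the exponent of \<open>v\<close> is negative, enlarging the sparsity level by a constant factor
  absorbs every constant in the error bound; this is why \<open>C\<close> may be chosen independently of
  \<open>R\<^sub>1\<close> and \<open>R\<^sub>2\<close>.\<close>

lemma absorb_constant:
  fixes a b \<beta> p X :: real and D :: nat
  defines "g \<equiv> real D * (a + b)" and "\<alpha> \<equiv> 1 / p + 1 / \<beta> + a - 1"
  assumes \<alpha>: "0 < \<alpha>" and X: "0 \<le> X" and v: "1 \<le> v" and \<kappa>: "1 \<le> \<kappa>" and V: "\<kappa> * v \<le> V" "V \<le> 2 * (\<kappa> * v)"
    and small: "X * (\<kappa> powr - \<alpha> * (1 + 2 * ln (4 * \<kappa>)) powr \<bar>g\<bar>) \<le> 1"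
  shows "X * V powr (1 - 1 / p) * approx_rate a b \<beta> D V \<le> v powr (1 - 1 / p - 1 / \<beta> - a) * ln (2 * v) powr g"
    and "ln (2 * V) \<le> (1 + 2 * ln (4 * \<kappa>)) * ln (2 * v)"
proof -
  have \<kappa>v: "1 \<le> \<kappa> * v" using \<kappa> v mult_mono[of 1 \<kappa> 1 v] by simp
  have V1: "1 \<le> V" using \<kappa>v V by linarith
  have lv: "1 / 2 \<le> ln (2 * v)"
  proof -
    have "ln 2 \<le> ln (2 * v)" using v by simp
    thus ?thesis using ln2_ge_two_thirds by linarith
  qed
  have l4: "0 \<le> ln (4 * \<kappa>)" using \<kappa> by (intro ln_ge_zero) auto
  have "ln (2 * V) \<le> ln ((4 * \<kappa>) * v)" using V V1 v \<kappa> by simp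
  also have "\<dots> = ln (4 * \<kappa>) + ln v" using v \<kappa> by (intro ln_mult_pos) auto
  finally have "ln (2 * V) \<le> ln (4 * \<kappa>) + ln v" .
  moreover have "ln v \<le> ln (2 * v)" using v by simp
  moreover have "ln (4 * \<kappa>) * 1 \<le> ln (4 * \<kappa>) * (2 * ln (2 * v))" using l4 lv by (intro mult_left_mono) auto
  ultimately show up: "ln (2 * V) \<le> (1 + 2 * ln (4 * \<kappa>)) * ln (2 * v)" by (simp add: algebra_simps)
  have "v \<le> \<kappa> * v" using v \<kappa> by simp
  hence "v \<le> V" using V by linarith
  hence "ln (2 * v) \<le> ln (2 * V)" using v by simp
  also have "\<dots> \<le> (1 + 2 * ln (4 * \<kappa>)) * ln (2 * V)"
    using l4 V1 by (intro mult_right_mono[of 1 _ "ln (2 * V)", simplified]) auto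
  finally have lg: "ln (2 * V) powr g \<le> (1 + 2 * ln (4 * \<kappa>)) powr \<bar>g\<bar> * ln (2 * v) powr g"
    using up V1 v by (intro powr_le_powr_comparable) auto
  have "1 - 1 / p + (- (1 / \<beta>) - a) = - \<alpha>" by (simp add: \<alpha>_def)
  hence "V powr (1 - 1 / p) * V powr (- (1 / \<beta>) - a) = V powr - \<alpha>"
    by (simp only: powr_add[symmetric])
  also have "\<dots> \<le> (\<kappa> * v) powr - \<alpha>" using \<alpha> V \<kappa>v by (intro powr_mono2') auto
  also have "\<dots> = \<kappa> powr - \<alpha> * v powr - \<alpha>" by (rule powr_mult)
  finally have va: "V powr (1 - 1 / p) * V powr (- (1 / \<beta>) - a) \<le> \<kappa> powr - \<alpha> * v powr - \<alpha>" .
  have "X * V powr (1 - 1 / p) * approx_rate a b \<beta> D V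
      = X * ((V powr (1 - 1 / p) * V powr (- (1 / \<beta>) - a)) * ln (2 * V) powr g)"
    by (simp add: approx_rate_def g_def)
  also have "\<dots> \<le> X * ((\<kappa> powr - \<alpha> * v powr - \<alpha>) * ((1 + 2 * ln (4 * \<kappa>)) powr \<bar>g\<bar> * ln (2 * v) powr g))"
    by (rule mult_left_mono[OF mult_mono[OF va lg]]) (use X in auto)
  also have "\<dots> = (X * (\<kappa> powr - \<alpha> * (1 + 2 * ln (4 * \<kappa>)) powr \<bar>g\<bar>)) * (v powr - \<alpha> * ln (2 * v) powr g)"
    by (simp only: mult_ac)
  also have "\<dots> \<le> 1 * (v powr - \<alpha> * ln (2 * v) powr g)" using small by (intro mult_right_mono) auto
  also have "- \<alpha> = 1 - 1 / p - 1 / \<beta> - a" by (simp add: \<alpha>_def)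
  finally show "X * V powr (1 - 1 / p) * approx_rate a b \<beta> D V \<le> v powr (1 - 1 / p - 1 / \<beta> - a) * ln (2 * v) powr g" by simp
qed

text \<open>Common interface of the two claims, which differ only in K. The sparsity level is a
  power of two because the algorithm runs in dyadic stages.\<close>

definition good_sample ::
  "real \<Rightarrow> real \<Rightarrow> real \<Rightarrow> real \<Rightarrow> real \<Rightarrow> real \<Rightarrow> real \<Rightarrow> real \<Rightarrow> 'x::topological_space set \<Rightarrow> 'x measure
     \<Rightarrow> (int ^ 'd::finite \<Rightarrow> 'x \<Rightarrow> complex) \<Rightarrow> nat \<Rightarrow> nat \<Rightarrow> nat \<Rightarrow> nat \<Rightarrow> 'x list \<Rightarrow> bool" where
  "good_sample a b \<beta> p R1 R2 K C \<Omega> \<mu> \<psi> v m l J \<xi> \<longleftrightarrow> length \<xi> = m \<and>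
     sampled_riesz_system \<mu> \<Omega> \<psi> \<xi> (\<Union>j\<le>J. hyperbolic_layer j) R1 R2 (R1\<^sup>2 / (2 * K * 2 ^ l)) K (2 ^ l) C
       (approx_rate a b \<beta> (CARD('d) - 1)) \<and>
     (\<forall>f\<in>W_class a b \<beta> \<Omega> \<psi>. \<exists>c.
        sparse_tails C (approx_rate a b \<beta> (CARD('d) - 1)) (\<Union>j\<le>J. hyperbolic_layer j) (2 ^ l) c \<and>
        (\<forall>x\<in>\<Omega>. ((\<lambda>k. c k * \<psi> k x) has_sum f x) UNIV)) \<and>
     recovery_const R1 R2 K C p * (2 ^ l) powr (1 - 1 / p) * approx_rate a b \<beta> (CARD('d) - 1) (2 ^ l)
       \<le> real v powr (1 - 1 / p - 1 / \<beta> - a) * ln (2 * real v) powr (real (CARD('d) - 1) * (a + b))"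

lemma exists_good_sample:
  fixes a b \<beta> p K R1 R2 C :: real
  defines "D \<equiv> CARD('d::finite) - 1"
  assumes p: "2 \<le> p" and a: "0 < a" and \<beta>: "0 < \<beta>" "\<beta> \<le> 1" and R: "0 < R1" "R1 \<le> R2" and K: "1 \<le> K" and C: "1 \<le> C"
    and tails: "\<And>V. 1 \<le> V \<Longrightarrow> \<exists>J. real J \<le> C * ln (2 * V) \<and>
      (\<forall>c :: int ^ 'd \<Rightarrow> complex. (\<forall>j. A_quasinorm \<beta> j c \<le> layer_weight a (real D * b) j) \<longrightarrow>
         sparse_tails C (approx_rate a b \<beta> D) (\<Union>j\<le>J. hyperbolic_layer j) V c)"
  shows "\<exists>c>0. \<forall>(\<Omega> :: 'x::topological_space set) \<mu> (\<psi> :: int ^ 'd \<Rightarrow> 'x \<Rightarrow> complex).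
     borel_prob_on \<Omega> \<mu> \<and> bounded_riesz_system R1 R2 \<Omega> \<mu> \<psi> \<longrightarrow>
     (\<forall>v m :: nat. 1 \<le> v \<and> c * real v * ln (2 * real v) ^ 4 \<le> real m \<longrightarrow>
       (\<exists>l J \<xi>. good_sample a b \<beta> p R1 R2 K C \<Omega> \<mu> \<psi> v m l J \<xi>))"
proof -
  define \<alpha> where "\<alpha> = 1 / p + 1 / \<beta> + a - 1"
  define X where "X = recovery_const R1 R2 K C p"
  \<comment> \<open>Here \<beta> \<le> 1 is used: it makes the exponent of v negative for every
    p.\<close>
  have "1 \<le> 1 / \<beta>" "0 < 1 / p" using \<beta> p by simp_all
  hence \<alpha>: "0 < \<alpha>" using a unfolding \<alpha>_def by linarith
  have X: "0 \<le> X" by (simp add: X_def recovery_const_def)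
  obtain \<kappa> :: nat where \<kappa>: "1 \<le> \<kappa>" "X * (real \<kappa> powr - \<alpha> * (1 + 2 * ln (4 * real \<kappa>)) powr \<bar>real D * (a + b)\<bar>) \<le> 1"
    using rescaling_exists[OF \<alpha>] by blast
  define cL where "cL = 1 + 2 * (\<bar>ln (1024 * K / R1\<^sup>2)\<bar> + 2)"
  define cN where "cN = 2 * (2 + real CARD('d)) + (real CARD('d) + 1) * C"
  define cS where "cS = 1 + 2 * ln (4 * real \<kappa>)"
  \<comment> \<open>16 in place of the 8 of \<open>exists_sampled_system\<close>, because 2^l may be
    as large as 2 \<kappa> v.\<close>
  define A where "A = 25600 * (16 * K * real \<kappa> / R1\<^sup>2) * cL\<^sup>2 * cN"
  define c where "c = A * cS ^ 3 * 2"
  have cS: "1 \<le> cS" using \<kappa> by (simp add: cS_def)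
  have cL: "0 < cL" by (simp add: cL_def)
  have cN: "0 < cN" using C by (simp add: cN_def add_pos_nonneg)
  have A: "0 < A" using K \<kappa> R cL cN by (simp add: A_def)
  have c: "0 < c" using A cS by (simp add: c_def)
  show ?thesis
  proof (intro exI[of _ c] conjI c allI impI, elim conjE)
    fix \<Omega> :: "'x set" and \<mu> and \<psi> :: "int ^ 'd \<Rightarrow> 'x \<Rightarrow> complex" and v m :: nat
    assume \<mu>: "borel_prob_on \<Omega> \<mu>" and riesz: "bounded_riesz_system R1 R2 \<Omega> \<mu> \<psi>" and v: "1 \<le> v"
      and m: "c * real v * ln (2 * real v) ^ 4 \<le> real m"
    have v1: "1 \<le> real v" using v by simp
    have lv: "1 / 2 \<le> ln (2 * real v)"
    proof -
      have "ln 2 \<le> ln (2 * real v)" using v1 by simp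
      thus ?thesis using ln2_ge_two_thirds by linarith
    qed
    have \<kappa>1: "1 \<le> real \<kappa>" using \<kappa> by simp
    have "1 * 1 \<le> real \<kappa> * real v" using \<kappa>1 v1 by (intro mult_mono) auto
    then obtain l where l: "real \<kappa> * real v \<le> 2 ^ l" "2 ^ l \<le> 2 * (real \<kappa> * real v)"
      using power_of_two_between[of "real \<kappa> * real v"] by auto
    have V: "1 \<le> (2::real) ^ l" by simp
    obtain J where J: "real J \<le> C * ln (2 * 2 ^ l)"
      "\<forall>c :: int ^ 'd \<Rightarrow> complex. (\<forall>j. A_quasinorm \<beta> j c \<le> layer_weight a (real D * b) j) \<longrightarrow>
         sparse_tails C (approx_rate a b \<beta> D) (\<Union>j\<le>J. hyperbolic_layer j) (2 ^ l) c"
      using tails[OF V] by (elim exE conjE)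
    note absorb = absorb_constant[OF \<alpha>[unfolded \<alpha>_def] X v1 \<kappa>1 l \<kappa>(2)[unfolded \<alpha>_def]]
    have "0 < c * real v * ln (2 * real v) ^ 4" using c v1 lv by (intro mult_pos_pos zero_less_power) auto
    hence m1: "1 \<le> m" using m by (cases m) auto
    have m2: "25600 * (8 * K * 2 ^ l / R1\<^sup>2) * cL\<^sup>2 * cN * ln (2 * 2 ^ l) ^ 3 \<le> real m"
    proof -
      define y where "y = ln (2 * real v)"
      have y: "1 / 2 \<le> y" using lv by (simp add: y_def)
      have p1: "25600 * (8 * K * 2 ^ l / R1\<^sup>2) * cL\<^sup>2 * cN \<le> A * real v"
      proof -
        have "25600 * (8 * K / R1\<^sup>2) * cL\<^sup>2 * cN * 2 ^ l \<le> 25600 * (8 * K / R1\<^sup>2) * cL\<^sup>2 * cN * (2 * (real \<kappa> * real v))"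
          using l(2) K R cL cN by (intro mult_left_mono) auto
        thus ?thesis by (simp add: A_def mult_ac)
      qed
      have "1 \<le> 2 * (2::real) ^ l" using V by linarith
      hence l0: "0 \<le> ln (2 * (2::real) ^ l)" by (rule ln_ge_zero)
      have "ln (2 * 2 ^ l) \<le> cS * y" using absorb(2) unfolding cS_def y_def .
      hence p2: "ln (2 * 2 ^ l) ^ 3 \<le> (cS * y) ^ 3" using l0 by (rule power_mono)
      have "25600 * (8 * K * 2 ^ l / R1\<^sup>2) * cL\<^sup>2 * cN * ln (2 * 2 ^ l) ^ 3 \<le> A * real v * (cS * y) ^ 3"
        by (rule mult_mono[OF p1 p2]) (use A l0 in auto)
      also have "\<dots> = A * cS ^ 3 * real v * (y ^ 3 * 1)" by (simp add: power_mult_distrib mult_ac)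
      \<comment> \<open>The discretization produces three logarithms; as ln (2 v) \<ge> 1/2, the
        fourth costs only the factor 2 in \<open>c\<close>.\<close>
      also have "\<dots> \<le> A * cS ^ 3 * real v * (y ^ 3 * (2 * y))"
        using y A cS by (intro mult_left_mono) auto
      also have "\<dots> = c * real v * y ^ 4" by (simp add: c_def power4_eq_xxxx power3_eq_cube mult_ac)
      finally show ?thesis using m unfolding y_def by linarith
    qed
    have "\<exists>\<xi>. length \<xi> = m \<and>
      sampled_riesz_system \<mu> \<Omega> \<psi> \<xi> (\<Union>j\<le>J. hyperbolic_layer j) R1 R2 (R1\<^sup>2 / (2 * K * 2 ^ l)) K (2 ^ l) C (approx_rate a b \<beta> D)"
      using m2 unfolding cL_def cN_def
      by (intro exists_sampled_system[OF \<mu> riesz R K V C _ J(1) m1]) (simp_all add: approx_rate_pos)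
    then obtain \<xi> where \<xi>: "length \<xi> = m \<and>
      sampled_riesz_system \<mu> \<Omega> \<psi> \<xi> (\<Union>j\<le>J. hyperbolic_layer j) R1 R2 (R1\<^sup>2 / (2 * K * 2 ^ l)) K (2 ^ l) C (approx_rate a b \<beta> D)"
      by (rule exE)
    have fin: "recovery_const R1 R2 K C p * (2 ^ l) powr (1 - 1 / p) * approx_rate a b \<beta> D (2 ^ l)
           \<le> real v powr (1 - 1 / p - 1 / \<beta> - a) * ln (2 * real v) powr (real D * (a + b))"
      using absorb(1) unfolding X_def .
    have coeff: "\<exists>c. sparse_tails C (approx_rate a b \<beta> D) (\<Union>j\<le>J. hyperbolic_layer j) (2 ^ l) c \<and>
        (\<forall>x\<in>\<Omega>. ((\<lambda>k. c k * \<psi> k x) has_sum f x) UNIV)" if f: "f \<in> W_class a b \<beta> \<Omega> \<psi>" for f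
    proof -
      from W_class_coefficients[OF f] obtain c
        where c: "\<forall>j. A_quasinorm \<beta> j c \<le> layer_weight a (real (CARD('d) - 1) * b) j"
          "\<forall>x\<in>\<Omega>. ((\<lambda>k. c k * \<psi> k x) has_sum f x) UNIV" by (elim exE conjE)
      from J(2)[THEN spec, THEN mp, OF c(1)[folded D_def]] c(2) show ?thesis by (intro exI conjI)
    qed
    have "good_sample a b \<beta> p R1 R2 K C \<Omega> \<mu> \<psi> v m l J \<xi>"
      unfolding good_sample_def using \<xi> coeff fin unfolding D_def by simp
    thus "\<exists>l J \<xi>. good_sample a b \<beta> p R1 R2 K C \<Omega> \<mu> \<psi> v m l J \<xi>" by blast
  qed
qed

theorem theorem1p2:
  fixes p a b \<beta> :: real
  assumes "2 \<le> p" and "0 < a" and "0 < \<beta>" and "\<beta> \<le> 1"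
  shows "\<exists>C>0. \<forall>R1 R2 :: real. 0 < R1 \<and> R1 \<le> R2 \<longrightarrow>
    (\<exists>c>0. \<forall>(\<Omega> :: (real ^ 'd::finite) set) \<mu> (\<psi> :: int ^ 'd \<Rightarrow> real ^ 'd \<Rightarrow> complex).
       compact \<Omega> \<and> borel_prob_on \<Omega> \<mu> \<and> bounded_riesz_system R1 R2 \<Omega> \<mu> \<psi> \<longrightarrow>
       (\<forall>v m :: nat. 1 \<le> v \<and> real m \<ge> c * real v * ln (2 * real v) ^ 4 \<longrightarrow>
          optimal_recovery m (W_class a b \<beta> \<Omega> \<psi>) p \<Omega> \<mu>
            \<le> ennreal (C * real v powr (1 - 1 / p - 1 / \<beta> - a)
                        * ln (2 * real v) powr (real (CARD('d) - 1) * (a + b))))) \<and>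
    (\<forall>t. 0 < t \<and> t \<le> 1 \<longrightarrow>
      (\<exists>c>0. \<forall>(\<Omega> :: (real ^ 'd) set) \<mu> (\<psi> :: int ^ 'd \<Rightarrow> real ^ 'd \<Rightarrow> complex).
         compact \<Omega> \<and> borel_prob_on \<Omega> \<mu> \<and> bounded_riesz_system R1 R2 \<Omega> \<mu> \<psi> \<longrightarrow>
         (\<forall>v m :: nat. 1 \<le> v \<and> real m \<ge> c * real v * ln (2 * real v) ^ 4 \<longrightarrow>
            womp_provides m (W_class a b \<beta> \<Omega> \<psi>) p \<Omega> \<mu> \<psi> t
              (C * real v powr (1 - 1 / p - 1 / \<beta> - a)
                 * ln (2 * real v) powr (real (CARD('d) - 1) * (a + b))))))"
proof -
  define bound where "bound = (\<lambda>v. real v powr (1 - 1 / p - 1 / \<beta> - a) * ln (2 * real v) powr (real (CARD('d) - 1) * (a + b)))"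
  note p = assms(1) and a = assms(2) and \<beta> = assms(3,4)
  have "\<exists>C\<ge>1. \<forall>V\<ge>1. \<exists>J. real J \<le> C * ln (2 * V) \<and>
      (\<forall>c :: int ^ 'd \<Rightarrow> complex. (\<forall>j. A_quasinorm \<beta> j c \<le> layer_weight a (real (CARD('d) - 1) * b) j) \<longrightarrow>
         sparse_tails C (approx_rate a b \<beta> (CARD('d) - 1)) (\<Union>j\<le>J. hyperbolic_layer j) V c)"
    by (rule class_sparse_tails[OF a \<beta>])
  then obtain C where C: "1 \<le> C \<and> (\<forall>V\<ge>1. \<exists>J. real J \<le> C * ln (2 * V) \<and>
      (\<forall>c :: int ^ 'd \<Rightarrow> complex. (\<forall>j. A_quasinorm \<beta> j c \<le> layer_weight a (real (CARD('d) - 1) * b) j) \<longrightarrow>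
         sparse_tails C (approx_rate a b \<beta> (CARD('d) - 1)) (\<Union>j\<le>J. hyperbolic_layer j) V c))"
    by (rule exE)
  note C1 = conjunct1[OF C] and tails = conjunct2[OF C, THEN spec, THEN mp]
  have sample: "\<exists>c>0. \<forall>(\<Omega> :: (real ^ 'd) set) \<mu> (\<psi> :: int ^ 'd \<Rightarrow> real ^ 'd \<Rightarrow> complex).
     borel_prob_on \<Omega> \<mu> \<and> bounded_riesz_system R1 R2 \<Omega> \<mu> \<psi> \<longrightarrow>
     (\<forall>v m :: nat. 1 \<le> v \<and> c * real v * ln (2 * real v) ^ 4 \<le> real m \<longrightarrow>
       (\<exists>l J \<xi>. good_sample a b \<beta> p R1 R2 K C \<Omega> \<mu> \<psi> v m l J \<xi>))"
    if "0 < R1" "R1 \<le> R2" "1 \<le> K" for R1 R2 K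
    by (rule exists_good_sample[OF p a \<beta> that C1 tails])
  have recovery: "optimal_recovery m (W_class a b \<beta> \<Omega> \<psi>) p \<Omega> \<mu> \<le> ennreal (bound v)"
    if good: "good_sample a b \<beta> p R1 R2 (2 * C) C \<Omega> \<mu> \<psi> v m l J \<xi>"
    for R1 R2 \<Omega> \<mu> and \<psi> :: "int ^ 'd \<Rightarrow> real ^ 'd \<Rightarrow> complex" and v m l J \<xi>
  proof -
    note g = good[unfolded good_sample_def]
    have "optimal_recovery m (W_class a b \<beta> \<Omega> \<psi>) p \<Omega> \<mu>
        \<le> ennreal (recovery_const R1 R2 (2 * C) C p * (2 ^ l) powr (1 - 1 / p) * approx_rate a b \<beta> (CARD('d) - 1) (2 ^ l))"
      by (rule sampled_riesz_system.optimal_recovery_le[OF conjunct1[OF conjunct2[OF g]] p order_refl infinite_UNIV_int_vec conjunct1[OF g]])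
        (rule bspec[OF conjunct1[OF conjunct2[OF conjunct2[OF g]]]])
    also have "\<dots> \<le> ennreal (bound v)"
      unfolding bound_def by (intro ennreal_leI conjunct2[OF conjunct2[OF conjunct2[OF g]]])
    finally show ?thesis .
  qed
  have womp: "womp_provides m (W_class a b \<beta> \<Omega> \<psi>) p \<Omega> \<mu> \<psi> t (bound v)"
    if t: "0 < t" and N0: "exp (- (t\<^sup>2 * (R1\<^sup>2 / 100) / C) * real N0) * (2 powr (1 / \<beta> + a + \<bar>real (CARD('d) - 1) * (a + b)\<bar>))\<^sup>2 \<le> 1"
      and good: "good_sample a b \<beta> p R1 R2 (2 * real N0 + C) C \<Omega> \<mu> \<psi> v m l J \<xi>"
    for t N0 R1 R2 \<Omega> \<mu> and \<psi> :: "int ^ 'd \<Rightarrow> real ^ 'd \<Rightarrow> complex" and v m l J \<xi>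
  proof -
    let ?Q = "\<Union>j\<le>J. hyperbolic_layer j :: (int ^ 'd) set"
    note g = good[unfolded good_sample_def]
    interpret sampled_riesz_system \<mu> \<Omega> \<psi> \<xi> ?Q R1 R2 "R1\<^sup>2 / (2 * (2 * real N0 + C) * 2 ^ l)" "2 * real N0 + C" "2 ^ l" C
      "approx_rate a b \<beta> (CARD('d) - 1)"
      using g by (rule conjunct1[OF conjunct2])
    have err: "Lp_norm p \<mu> (f (N0 * (2 ^ Suc l - 2))) \<le> bound v"
      if f0: "f0 \<in> W_class a b \<beta> \<Omega> \<psi>" and run: "womp_run (empirical_measure \<xi>) \<psi> ?Q t f0 (N0 * (2 ^ Suc l - 2)) \<kappa> f"
      for f0 \<kappa> f
    proof -
      obtain c where c: "sparse_tails C (approx_rate a b \<beta> (CARD('d) - 1)) ?Q (2 ^ l) c"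
        "\<And>x. x \<in> \<Omega> \<Longrightarrow> ((\<lambda>k. c k * \<psi> k x) has_sum f0 x) UNIV" 
        using bspec[OF conjunct1[OF conjunct2[OF conjunct2[OF g]]] f0] by blast
      have "Lp_norm p \<mu> (f (N0 * (2 ^ Suc l - 2)))
         \<le> recovery_const R1 R2 (2 * real N0 + C) C p * (2 ^ l) powr (1 - 1 / p) * approx_rate a b \<beta> (CARD('d) - 1) (2 ^ l)"
        by (rule womp_error[OF p t c refl order_refl approx_rate_doubling[OF _ a \<beta>(1)] N0 run])
      also have "\<dots> \<le> bound v" unfolding bound_def by (rule conjunct2[OF conjunct2[OF conjunct2[OF g]]])
      finally show ?thesis .
    qed
    have "is_dictionary (empirical_measure \<xi>) \<psi> ?Q"
      using zero_in_hyperbolic_layer by (intro empirical_dictionary) auto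
    hence "length \<xi> = m \<and> set \<xi> \<subseteq> \<Omega> \<and> finite ?Q \<and> is_dictionary (empirical_measure \<xi>) \<psi> ?Q \<and>
        (\<forall>f0\<in>W_class a b \<beta> \<Omega> \<psi>. \<forall>\<kappa> f. womp_run (empirical_measure \<xi>) \<psi> ?Q t f0 (N0 * (2 ^ Suc l - 2)) \<kappa> f \<longrightarrow>
           Lp_norm p \<mu> (f (N0 * (2 ^ Suc l - 2))) \<le> bound v)"
      by (intro conjI conjunct1[OF g] \<xi>(2) Q ballI allI impI err)
    thus ?thesis unfolding womp_provides_def by (intro exI)
  qed
  \<comment> \<open>N0 depends on t and R1 through the contraction rate; this passes to K and
    finally to the constant c of the second claim.\<close>
  have iterations: "\<exists>N0 :: nat. exp (- (t\<^sup>2 * (R1\<^sup>2 / 100) / C) * real N0) * X\<^sup>2 \<le> 1" if "0 < t" "0 < R1" "0 < X" for t R1 X :: real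
  proof -
    define q where "q = t\<^sup>2 * (R1\<^sup>2 / 100) / C"
    have q: "0 < q" using that C1 by (simp add: q_def)
    obtain N0 :: nat where "ln (X\<^sup>2) / q < real N0" using reals_Archimedean2 by blast
    hence "ln (X\<^sup>2) < q * real N0" using q by (simp add: field_simps)
    hence "exp (ln (X\<^sup>2)) \<le> exp (q * real N0)" by simp
    hence "X\<^sup>2 \<le> exp (q * real N0)" using that by simp
    hence "exp (- q * real N0) * X\<^sup>2 \<le> 1" by (simp add: exp_minus field_simps)
    thus ?thesis unfolding q_def by blast
  qed
  show ?thesis
  \<comment> \<open>The rescaling has absorbed every constant, so 1 is a witness, independent of R1
    and R2.\<close>
  proof (rule exI[of _ 1], intro conjI allI impI)
    fix R1 R2 :: real assume R: "0 < R1 \<and> R1 \<le> R2"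
    \<comment> \<open>K = 2 C holds the support of the decoder's choice and that of an approximant,
      each of size at most C V.\<close>
    have K: "1 \<le> 2 * C" using C1 by simp
    obtain c where c: "0 < c" and ex: "\<forall>(\<Omega> :: (real ^ 'd) set) \<mu> (\<psi> :: int ^ 'd \<Rightarrow> real ^ 'd \<Rightarrow> complex).
       borel_prob_on \<Omega> \<mu> \<and> bounded_riesz_system R1 R2 \<Omega> \<mu> \<psi> \<longrightarrow>
       (\<forall>v m :: nat. 1 \<le> v \<and> c * real v * ln (2 * real v) ^ 4 \<le> real m \<longrightarrow>
         (\<exists>l J \<xi>. good_sample a b \<beta> p R1 R2 (2 * C) C \<Omega> \<mu> \<psi> v m l J \<xi>))"
      using sample[OF conjunct1[OF R] conjunct2[OF R] K] by (elim exE conjE)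
    show "\<exists>c>0. \<forall>(\<Omega> :: (real ^ 'd) set) \<mu> (\<psi> :: int ^ 'd \<Rightarrow> real ^ 'd \<Rightarrow> complex).
       compact \<Omega> \<and> borel_prob_on \<Omega> \<mu> \<and> bounded_riesz_system R1 R2 \<Omega> \<mu> \<psi> \<longrightarrow>
       (\<forall>v m :: nat. 1 \<le> v \<and> real m \<ge> c * real v * ln (2 * real v) ^ 4 \<longrightarrow>
          optimal_recovery m (W_class a b \<beta> \<Omega> \<psi>) p \<Omega> \<mu>
            \<le> ennreal (1 * real v powr (1 - 1 / p - 1 / \<beta> - a) * ln (2 * real v) powr (real (CARD('d) - 1) * (a + b))))"
    proof (intro exI[of _ c] conjI c allI impI, elim conjE)
      fix \<Omega> :: "(real ^ 'd) set" and \<mu> and \<psi> :: "int ^ 'd \<Rightarrow> real ^ 'd \<Rightarrow> complex" and v m :: nat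
      assume "borel_prob_on \<Omega> \<mu>" "bounded_riesz_system R1 R2 \<Omega> \<mu> \<psi>" "1 \<le> v" "c * real v * ln (2 * real v) ^ 4 \<le> real m"
      hence "\<exists>l J \<xi>. good_sample a b \<beta> p R1 R2 (2 * C) C \<Omega> \<mu> \<psi> v m l J \<xi>"
        using ex by simp
      then obtain l J \<xi> where good: "good_sample a b \<beta> p R1 R2 (2 * C) C \<Omega> \<mu> \<psi> v m l J \<xi>"
        by (elim exE)
      show "optimal_recovery m (W_class a b \<beta> \<Omega> \<psi>) p \<Omega> \<mu>
            \<le> ennreal (1 * real v powr (1 - 1 / p - 1 / \<beta> - a) * ln (2 * real v) powr (real (CARD('d) - 1) * (a + b)))"
        using recovery[OF good] unfolding bound_def mult_1 .
    qed
  next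
    fix R1 R2 t :: real assume R: "0 < R1 \<and> R1 \<le> R2" and t: "0 < t \<and> t \<le> 1"
    obtain N0 :: nat where N0: "exp (- (t\<^sup>2 * (R1\<^sup>2 / 100) / C) * real N0) * (2 powr (1 / \<beta> + a + \<bar>real (CARD('d) - 1) * (a + b)\<bar>))\<^sup>2 \<le> 1"
      using iterations[of t R1 "2 powr (1 / \<beta> + a + \<bar>real (CARD('d) - 1) * (a + b)\<bar>)"] R t by auto
    have K: "1 \<le> 2 * real N0 + C" using C1 by simp
    obtain c where c: "0 < c" and ex: "\<forall>(\<Omega> :: (real ^ 'd) set) \<mu> (\<psi> :: int ^ 'd \<Rightarrow> real ^ 'd \<Rightarrow> complex).
       borel_prob_on \<Omega> \<mu> \<and> bounded_riesz_system R1 R2 \<Omega> \<mu> \<psi> \<longrightarrow>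
       (\<forall>v m :: nat. 1 \<le> v \<and> c * real v * ln (2 * real v) ^ 4 \<le> real m \<longrightarrow>
         (\<exists>l J \<xi>. good_sample a b \<beta> p R1 R2 (2 * real N0 + C) C \<Omega> \<mu> \<psi> v m l J \<xi>))"
      using sample[OF conjunct1[OF R] conjunct2[OF R] K] by (elim exE conjE)
    show "\<exists>c>0. \<forall>(\<Omega> :: (real ^ 'd) set) \<mu> (\<psi> :: int ^ 'd \<Rightarrow> real ^ 'd \<Rightarrow> complex).
       compact \<Omega> \<and> borel_prob_on \<Omega> \<mu> \<and> bounded_riesz_system R1 R2 \<Omega> \<mu> \<psi> \<longrightarrow>
       (\<forall>v m :: nat. 1 \<le> v \<and> real m \<ge> c * real v * ln (2 * real v) ^ 4 \<longrightarrow>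
          womp_provides m (W_class a b \<beta> \<Omega> \<psi>) p \<Omega> \<mu> \<psi> t
            (1 * real v powr (1 - 1 / p - 1 / \<beta> - a) * ln (2 * real v) powr (real (CARD('d) - 1) * (a + b))))"
    proof (intro exI[of _ c] conjI c allI impI, elim conjE)
      fix \<Omega> :: "(real ^ 'd) set" and \<mu> and \<psi> :: "int ^ 'd \<Rightarrow> real ^ 'd \<Rightarrow> complex" and v m :: nat
      assume "borel_prob_on \<Omega> \<mu>" "bounded_riesz_system R1 R2 \<Omega> \<mu> \<psi>" "1 \<le> v" "c * real v * ln (2 * real v) ^ 4 \<le> real m"
      hence "\<exists>l J \<xi>. good_sample a b \<beta> p R1 R2 (2 * real N0 + C) C \<Omega> \<mu> \<psi> v m l J \<xi>"
        using ex by simp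
      then obtain l J \<xi> where good: "good_sample a b \<beta> p R1 R2 (2 * real N0 + C) C \<Omega> \<mu> \<psi> v m l J \<xi>"
        by (elim exE)
      show "womp_provides m (W_class a b \<beta> \<Omega> \<psi>) p \<Omega> \<mu> \<psi> t
            (1 * real v powr (1 - 1 / p - 1 / \<beta> - a) * ln (2 * real v) powr (real (CARD('d) - 1) * (a + b)))"
        using womp[OF conjunct1[OF t] N0 good] unfolding bound_def mult_1 .
    qed
  qed simp
qed

end
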